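(* Let $G$ be a finite simple undirected graph of order $n$ and minimum degree $\delta$, with toughness $\tau(G) > 1$. If $\delta \geq \frac{1}{3}(n-2)$, then each longest cycle in $G$ is a dominating cycle.
   Context: The order $n$ of $G$ is its number of vertices, and $\delta$ is its minimum vertex degree. For $S\subseteq V(G)$, $G\backslash S$ is the subgraph of $G$ induced by $V(G)\backslash S$, and for a subgraph $H$, $G\backslash H$ means $G\backslash V(H)$. Let $s(H)$ denote the number of connected components of a graph $H$. For real $t$, $G$ is $t$-tough if $|S|\ge t\, s(G\backslash S)$ for every $S\subseteq V(G)$ with $s(G\backslash S)>1$. The toughness $\tau(G)$ is the maximum $t$ for which $G$ is $t$-tough, with $\tau(K_n)=\infty$ for all $n\ge 1$. A cycle of length $t$ is a sequence $v_1v_2\dots v_tv_1$ of distinct vertices $v_1,\dots,v_t$ with $v_iv_{i+1}\in E(G)$ for each $i\in\{1,\dots,t\}$, where $v_{t+1}=v_1$. By convention, a single edge counts as a cycle of length $2$ and a single vertex as a cycle of length $1$. A longest cycle is one of maximum length in $G$. A cycle $C$ in $G$ is dominating if $G\backslash C$ has no edges. *)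

theory Defs
  imports
    "Graph_Theory.Digraph_Component"
    "Graph_Theory.Kuratowski"
    "HOL-Library.Extended_Real"
begin

text \<open>
  A finite simple undirected graph is a digraph satisfying the locale \<^locale>\<open>graph\<close>: finite,
  without loops and parallel arcs, and symmetric. Every undirected edge is thus represented by its
  two orientations, so the degree of a vertex is its out-degree and the connected components are
  the strongly connected components.
\<close>

definition min_degree :: "('a, 'b) pre_digraph \<Rightarrow> nat" where
  "min_degree G = Min (out_degree G ` verts G)"

definition delete_verts :: "('a, 'b) pre_digraph \<Rightarrow> 'a set \<Rightarrow> ('a, 'b) pre_digraph" where
  "delete_verts G S = G \<restriction> (verts G - S)"

definition num_components :: "('a, 'b) pre_digraph \<Rightarrow> nat" where
  "num_components G = card (pre_digraph.sccs G)"

definition tough :: "real \<Rightarrow> ('a, 'b) pre_digraph \<Rightarrow> bool" where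
  "tough t G \<longleftrightarrow>
     (\<forall>S \<subseteq> verts G. num_components (delete_verts G S) > 1 \<longrightarrow>
        real (card S) \<ge> t * real (num_components (delete_verts G S)))"

text \<open>The maximum in the second case exists: see \<open>toughness_maximum\<close> below.\<close>

definition toughness :: "('a, 'b) pre_digraph \<Rightarrow> ereal" where
  "toughness G = (if \<exists>n. complete_digraph n G then \<infinity> else ereal (GREATEST t. tough t G))"

text \<open>
  A cycle is given by the list of its vertices in cyclic order. Two adjacent vertices satisfy the
  adjacency condition below, so an edge is a cycle of length 2; a single vertex does not, since
  there are no loops, and is admitted separately as a cycle of length 1.
\<close>

definition is_cycle :: "('a, 'b) pre_digraph \<Rightarrow> 'a list \<Rightarrow> bool" where
  "is_cycle G vs \<longleftrightarrow> vs \<noteq> [] \<and> distinct vs \<and> set vs \<subseteq> verts G \<and>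
     (length vs = 1 \<or>
      (\<forall>i < length vs. vs ! i \<rightarrow>\<^bsub>G\<^esub> vs ! (Suc i mod length vs)))"

definition longest_cycle :: "('a, 'b) pre_digraph \<Rightarrow> 'a list \<Rightarrow> bool" where
  "longest_cycle G vs \<longleftrightarrow> is_cycle G vs \<and> (\<forall>ws. is_cycle G ws \<longrightarrow> length ws \<le> length vs)"

definition dominating_cycle :: "('a, 'b) pre_digraph \<Rightarrow> 'a list \<Rightarrow> bool" where
  "dominating_cycle G vs \<longleftrightarrow> is_cycle G vs \<and> arcs (delete_verts G (set vs)) = {}"

lemma two_components_if_not_complete:
  assumes "graph G" and "\<nexists>n. complete_digraph n G"
  obtains S where "S \<subseteq> verts G" and "num_components (delete_verts G S) > 1"
proof -
  interpret graph G by fact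
  have "arcs_ends G \<noteq> {(u, v). (u, v) \<in> verts G \<times> verts G \<and> u \<noteq> v}"
    using assms by (auto simp: complete_digraph_def)
  moreover have "arcs_ends G \<subseteq> {(u, v). (u, v) \<in> verts G \<times> verts G \<and> u \<noteq> v}"
    using adj_not_same by auto
  ultimately obtain u v where uv: "u \<in> verts G" "v \<in> verts G" "u \<noteq> v" "(u, v) \<notin> arcs_ends G"
    by auto
  then have vu: "(v, u) \<notin> arcs_ends G"
    using arcs_ends_symmetric[OF sym_arcs] by blast
  define S where "S = verts G - {u, v}"
  define H where "H = delete_verts G S"
  have vH: "verts H = {u, v}" using uv by (auto simp: H_def delete_verts_def S_def)
  have "wf_digraph H" unfolding H_def delete_verts_def
    by (rule wellformed_induce_subgraph)
  then interpret H: wf_digraph H .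
  have "arcs_ends H = {}"
  proof -
    have "arcs_ends H \<subseteq> arcs_ends G \<inter> {u, v} \<times> {u, v}"
      using uv by (auto simp: H_def delete_verts_def S_def arcs_ends_conv)
    then show ?thesis using uv vu adj_not_same by auto
  qed
  then have reach: "x \<rightarrow>\<^sup>*\<^bsub>H\<^esub> y \<longleftrightarrow> x = y \<and> x \<in> {u, v}" for x y
    by (auto simp: reachable_def vH elim: rtrancl_on.cases)
  have sub: "{{u}, {v}} \<subseteq> pre_digraph.sccs_verts H"
    by (auto simp: pre_digraph.sccs_verts_def reach)
  have "pre_digraph.sccs_verts H \<subseteq> Pow {u, v}"
    by (auto simp: pre_digraph.sccs_verts_def reach)
  then have "finite (pre_digraph.sccs_verts H)" by (rule finite_subset) simp
  from card_mono[OF this sub] have "1 < num_components H"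
    using uv by (simp add: num_components_def H.card_sccs_verts)
  then show thesis using that[of S] by (simp add: H_def S_def)
qed

lemma toughness_maximum:
  assumes "graph G" and "\<nexists>n. complete_digraph n G"
  obtains t where "toughness G = ereal t" and "tough t G" and "\<And>t'. tough t' G \<Longrightarrow> t' \<le> t"
proof -
  interpret graph G by fact
  define F where "F = {S. S \<subseteq> verts G \<and> num_components (delete_verts G S) > 1}"
  define r where "r = (\<lambda>S. real (card S) / real (num_components (delete_verts G S)))"
  have "finite F" by (rule finite_subset[of _ "Pow (verts G)"]) (auto simp: F_def)
  moreover have "F \<noteq> {}"
    using two_components_if_not_complete[OF assms] unfolding F_def by blast
  moreover have "tough t G \<longleftrightarrow> (\<forall>S\<in>F. t \<le> r S)" for t
    by (auto simp: tough_def F_def r_def pos_le_divide_eq)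
  ultimately have iff: "tough t G \<longleftrightarrow> t \<le> Min (r ` F)" for t
    by simp
  have "(GREATEST t. tough t G) = Min (r ` F)"
    by (rule Greatest_equality) (auto simp: iff)
  then show thesis using assms(2) by (intro that[of "Min (r ` F)"]) (auto simp: toughness_def iff)
qed

end

theory Submission
  imports Defs
begin

text \<open>
  Let \<open>C\<close> be a longest cycle, \<open>H\<close> a component of its complement with at least two vertices, \<open>A\<close> the
  set of neighbours of \<open>H\<close> on \<open>C\<close>, \<open>R\<close> the remaining vertices, and \<open>s = |A| \<ge> 3\<close>. Rerouting \<open>C\<close>
  through \<open>H\<close> bounds the segments of \<open>C\<close> between consecutive vertices of \<open>A\<close> from below, and
  counting the neighbours of a vertex of \<open>H\<close> and of the successors of two vertices of \<open>A\<close> in the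
  style of Bondy gives \<open>s + |H| - 1 - \<delta> \<le> 3\<close>. So \<open>H\<close> is nearly complete and nearly completely joined
  to \<open>A\<close>, and \<open>n \<le> 3\<delta> + 2\<close> leaves no room for any missing adjacency: \<open>H\<close> is complete and every
  vertex of \<open>A\<close> is adjacent to all of \<open>H\<close>.

  Then the lengths of the segments exceed \<open>|H|\<close> by at most 3 in total, whereas an edge between two
  different segments forces a joint excess of at least 2. Because the toughness exceeds 1, several
  pairs of segments have to be connected. Rerouting \<open>C\<close> along such an edge can produce another longest
  cycle that avoids a piece of a segment. The same structure theorem applied to that piece shows that
  all edges leaving a segment start in a single vertex, and deleting \<open>A\<close> together with one or two such
  vertices leaves too many components.
\<close>

section \<open>Cycles and detours in a finite graph\<close>

text \<open>Write h for |H| and call s + h - 1 - \<delta> the slack: for each vertex of H it bounds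
  the missed attachment vertices plus the missed vertices of H, so slack 0 gives the full adjacency.
  For h \<ge> 3 Bondy counting alone stops at slack 3, because a detour through H is only sure to
  have two vertices. The rest is removed by length: a segment has at least as many vertices as any
  path of H that fits between its ends. A Hamilton cycle of H offers long detours; without one, the
  ends of a longest path have so many non-neighbours in H that the slack leaves little room for
  missed attachment vertices, which alone could shorten the segments. Either way the cycle outgrows
  3\<delta> + 2. At slack 0 the order bound becomes total excess + |R| \<le> 3 - (s - 2)(h - 2), the
  origin of the 3. The last obstacle is h = 2 with three segments of three vertices whose middle
  vertices are pairwise adjacent: deleting A and middle vertices is at best one component short,
  until the outer vertices of one such segment are shown to be non-adjacent, so that it
  splits.\<close>

locale fin_graph =
  fixes V :: "'a set" and E :: "'a \<Rightarrow> 'a \<Rightarrow> bool"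
  assumes finite_V: "finite V"
    and sym: "E x y \<Longrightarrow> E y x"
    and irrefl: "\<not> E x x"
    and in_V: "E x y \<Longrightarrow> x \<in> V"
begin

lemma E_comm: "E x y \<longleftrightarrow> E y x"
  using sym by blast

lemma in_V2: "E x y \<Longrightarrow> y \<in> V"
  using in_V sym by blast

definition path_in :: "'a set \<Rightarrow> 'a list \<Rightarrow> bool" where
  "path_in X P \<longleftrightarrow> P \<noteq> [] \<and> distinct P \<and> set P \<subseteq> X \<and> successively E P"

text \<open>Edges count as cycles of length 2. Single vertices are left out: they are never longest
  once the graph has an edge.\<close>

definition cyc :: "'a list \<Rightarrow> bool" where
  "cyc xs \<longleftrightarrow> 2 \<le> length xs \<and> distinct xs \<and> set xs \<subseteq> V \<and> successively E xs \<and> E (last xs) (hd xs)"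

definition max_cyc :: "'a list \<Rightarrow> bool" where
  "max_cyc xs \<longleftrightarrow> cyc xs \<and> (\<forall>ys. cyc ys \<longrightarrow> length ys \<le> length xs)"

lemma max_cyc_distinct: "max_cyc xs \<Longrightarrow> distinct xs"
  by (simp add: max_cyc_def cyc_def)

lemma max_cyc_le: "max_cyc xs \<Longrightarrow> cyc ys \<Longrightarrow> length ys \<le> length xs"
  by (simp add: max_cyc_def)

lemma max_cyc_same_length: "max_cyc xs \<Longrightarrow> cyc ys \<Longrightarrow> length ys = length xs \<Longrightarrow> max_cyc ys"
  by (simp add: max_cyc_def)

lemma successively_flip [simp]: "successively (\<lambda>x y. E y x) xs = successively E xs"
proof -
  have "(\<lambda>x y. E y x) = E" using sym by blast
  then show ?thesis by (rule arg_cong)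
qed

lemma cyc_rotate: "cyc (xs @ ys) \<Longrightarrow> cyc (ys @ xs)"
  by (cases "xs = []"; cases "ys = []")
     (auto simp: cyc_def successively_append_iff last_append hd_append)

lemma max_cyc_rotate: "max_cyc (xs @ ys) \<Longrightarrow> max_cyc (ys @ xs)"
  by (auto simp: max_cyc_def dest: cyc_rotate)

lemma path_in_rev: "path_in X P \<Longrightarrow> path_in X (rev P)"
  by (auto simp: path_in_def)

text \<open>\<open>X\<close> and \<open>Z\<close> are complementary arcs of the cycle, and
  \<open>P\<close> takes the place of \<open>X\<close>.\<close>

lemma cyc_insert:
  assumes "max_cyc (X @ Z)" "Z \<noteq> []" "path_in (V - set (X @ Z)) P"
    and "E (last Z) (hd P)" "E (last P) (hd Z)"
  shows "cyc (P @ Z)"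
proof -
  have "P \<noteq> []" using assms(3) by (simp add: path_in_def)
  then have "2 \<le> length P + length Z" using assms(2) by (cases P; cases Z) auto
  then show ?thesis
    using assms by (auto simp: max_cyc_def cyc_def path_in_def successively_append_iff)
qed

lemma insert_le:
  assumes "max_cyc (X @ Z)" "Z \<noteq> []" "path_in (V - set (X @ Z)) P"
    and "E (last Z) (hd P)" "E (last P) (hd Z)"
  shows "length P \<le> length X"
  using max_cyc_le[OF assms(1) cyc_insert[OF assms]] by simp

text \<open>The new cycle leaves the end of \<open>Z\<close> through \<open>P\<close> to the end of
  \<open>Y\<close>, runs back along \<open>Y\<close> and returns over \<open>L\<close> to the start
  of \<open>Z\<close>. Only \<open>X\<close> and \<open>W\<close> are lost.\<close>

lemma cyc_cross:
  assumes "max_cyc (X @ Y @ W @ Z)" "Y \<noteq> []" "Z \<noteq> []"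
    and P: "path_in (V - set (X @ Y @ W @ Z)) P"
    and "E (last Z) (hd P)" "E (last P) (last Y)"
    and L: "successively E (hd Y # L @ [hd Z])" "distinct L"
      "set L \<subseteq> V - set (X @ Y @ W @ Z)" "set L \<inter> set P = {}"
  shows "cyc (P @ rev Y @ L @ Z)"
proof -
  have "P \<noteq> []" using P by (simp add: path_in_def)
  then have "2 \<le> length (P @ rev Y @ L @ Z)" using assms(2,3) by (cases P; cases Z) auto
  moreover have "successively E (rev Y @ L @ Z)"
    using assms by (cases "L = []")
      (auto simp: max_cyc_def cyc_def successively_append_iff
         last_rev successively_Cons)
  ultimately show ?thesis
    using assms \<open>P \<noteq> []\<close>
    by (auto simp: max_cyc_def cyc_def path_in_def successively_append_iff[of _ P] hd_rev hd_append last_append)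
qed

lemma cross_le:
  assumes "max_cyc (X @ Y @ W @ Z)" "Y \<noteq> []" "Z \<noteq> []"
    and P: "path_in (V - set (X @ Y @ W @ Z)) P"
    and "E (last Z) (hd P)" "E (last P) (last Y)"
    and L: "successively E (hd Y # L @ [hd Z])" "distinct L"
      "set L \<subseteq> V - set (X @ Y @ W @ Z)" "set L \<inter> set P = {}"
  shows "length P + length L \<le> length X + length W"
  using max_cyc_le[OF assms(1) cyc_cross[OF assms]] by simp

text \<open>The mirror image of \<open>cyc_cross\<close>: \<open>P\<close> joins the first vertices
  of \<open>Y\<close> and \<open>Z\<close>, and \<open>L\<close> the last ones.\<close>

lemma cyc_cross':
  assumes "max_cyc (X @ Y @ W @ Z)" "Y \<noteq> []" "Z \<noteq> []"
    and P: "path_in (V - set (X @ Y @ W @ Z)) P"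
    and "E (hd Z) (hd P)" "E (last P) (hd Y)"
    and L: "successively E (last Y # L @ [last Z])" "distinct L"
      "set L \<subseteq> V - set (X @ Y @ W @ Z)" "set L \<inter> set P = {}"
  shows "cyc (P @ Y @ L @ rev Z)"
proof -
  have "P \<noteq> []" using P by (simp add: path_in_def)
  then have "2 \<le> length (P @ Y @ L @ rev Z)" using assms(2,3) by (cases P; cases Z) auto
  moreover have "successively E (Y @ L @ rev Z)"
    using assms by (cases "L = []")
      (auto simp: max_cyc_def cyc_def successively_append_iff
         hd_rev successively_Cons)
  ultimately show ?thesis
    using assms \<open>P \<noteq> []\<close>
    by (auto simp: max_cyc_def cyc_def path_in_def successively_append_iff[of _ P] hd_append last_append last_rev)
qed

lemma cross'_le:
  assumes "max_cyc (X @ Y @ W @ Z)" "Y \<noteq> []" "Z \<noteq> []"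
    and P: "path_in (V - set (X @ Y @ W @ Z)) P"
    and "E (hd Z) (hd P)" "E (last P) (hd Y)"
    and L: "successively E (last Y # L @ [last Z])" "distinct L"
      "set L \<subseteq> V - set (X @ Y @ W @ Z)" "set L \<inter> set P = {}"
  shows "length P + length L \<le> length X + length W"
  using max_cyc_le[OF assms(1) cyc_cross'[OF assms]] by simp

text \<open>The two chords at the ends of \<open>Y1\<close> give the cycle
  \<open>P @ rev Y2 @ Y1 @ Z\<close>, which loses only \<open>X\<close>. This exchange is what makes
  the neighbourhoods of two successors nearly disjoint after a shift.\<close>

lemma gap_le:
  assumes "max_cyc (Y1 @ X @ Y2 @ Z)" "Y1 \<noteq> []" "Y2 \<noteq> []" "Z \<noteq> []"
    and P: "path_in (V - set (Y1 @ X @ Y2 @ Z)) P"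
    and "E (last Z) (hd P)" "E (last P) (last Y2)" "E (hd Y2) (hd Y1)" "E (last Y1) (hd Z)"
  shows "length P \<le> length X"
proof -
  have "P \<noteq> []" using P by (simp add: path_in_def)
  then have "2 \<le> length (P @ rev Y2 @ Y1 @ Z)" using assms(2-4) by (cases P; cases Z) auto
  moreover have "successively E (rev Y2 @ Y1 @ Z)"
    using assms
      by (auto simp: max_cyc_def cyc_def successively_append_iff
         last_rev hd_append)
  ultimately have "cyc (P @ rev Y2 @ Y1 @ Z)"
    using assms \<open>P \<noteq> []\<close>
    by (auto simp: max_cyc_def cyc_def path_in_def successively_append_iff[of _ P] hd_rev hd_append last_append)
  from max_cyc_le[OF assms(1) this] show ?thesis by simp
qed

text \<open>The tour \<open>P @ rev Y @ [u, z] @ Z\<close> omits only \<open>v\<close>. It serves at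
  the very end, to exclude an edge between the outer vertices of a segment of three.\<close>

lemma skip_le:
  assumes "max_cyc ([u, z] @ Y @ [v] @ Z)" "Y \<noteq> []" "Z \<noteq> []"
    and P: "path_in (V - set ([u, z] @ Y @ [v] @ Z)) P"
    and "E (last Z) (hd P)" "E (last P) (last Y)" "E (hd Y) u" "E z (hd Z)"
  shows "length P \<le> 1"
proof -
  have "P \<noteq> []" using P by (simp add: path_in_def)
  moreover have "successively E (rev Y @ [u, z] @ Z)"
    using assms
      by (auto simp: max_cyc_def cyc_def successively_append_iff
         last_rev hd_append successively_Cons)
  ultimately have "cyc (P @ rev Y @ [u, z] @ Z)"
    using assms \<open>P \<noteq> []\<close>
    by (auto simp: max_cyc_def cyc_def path_in_def successively_append_iff[of _ P] hd_rev hd_append last_append)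
  from max_cyc_le[OF assms(1) this] show ?thesis by simp
qed

definition linked :: "'a set \<Rightarrow> 'a \<Rightarrow> 'a \<Rightarrow> bool" where
  "linked X x y \<longleftrightarrow> (\<exists>P. path_in X P \<and> hd P = x \<and> last P = y)"

lemma linked_refl: "x \<in> X \<Longrightarrow> linked X x x"
  unfolding linked_def path_in_def by (intro exI[of _ "[x]"]) auto

lemma linked_in: "linked X x y \<Longrightarrow> x \<in> X \<and> y \<in> X"
  unfolding linked_def path_in_def by (metis hd_in_set last_in_set subsetD)

lemma linked_sym: "linked X x y \<Longrightarrow> linked X y x"
  unfolding linked_def using path_in_rev path_in_def by (metis hd_rev last_rev)

lemma linked_step:
  assumes "linked X x y" "E y z" "z \<in> X"
  shows "linked X x z"
proof -
  obtain P where P: "path_in X P" "hd P = x" "last P = y" using assms(1) unfolding linked_def by blast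
  show ?thesis
  proof (cases "z \<in> set P")
    case True
    then obtain P1 P2 where "P = P1 @ z # P2" by (meson split_list)
    then have "path_in X (P1 @ [z])" "hd (P1 @ [z]) = x"
      using P by (auto simp: path_in_def successively_append_iff hd_append)
    then show ?thesis unfolding linked_def by force
  next
    case False
    then have "path_in X (P @ [z])" "hd (P @ [z]) = x"
      using P assms by (auto simp: path_in_def successively_append_iff)
    then show ?thesis unfolding linked_def by force
  qed
qed

lemma linked_along:
  assumes "linked X x (hd P)" "path_in X P"
  shows "linked X x (last P)"
  using assms
proof (induction P rule: rev_induct)
  case Nil then show ?case by (simp add: path_in_def)
next
  case (snoc v P)
  show ?case
  proof (cases "P = []")
    case True
    then show ?thesis using snoc.prems by simp
  next
    case False
    then have "path_in X P" "E (last P) v" "v \<in> X" "linked X x (hd P)"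
      using snoc.prems by (auto simp: path_in_def successively_append_iff)
    then show ?thesis using linked_step[of X x "last P" v] snoc.IH by auto
  qed
qed

lemma linked_trans: "linked X x y \<Longrightarrow> linked X y z \<Longrightarrow> linked X x z"
  using linked_along unfolding linked_def[of X y z] by blast

end

section \<open>A longest cycle and a nontrivial component of its complement\<close>

text \<open>Toughness above 1 is expressed without components: a labelling that is constant along
  the edges of G - S takes at most as many values as G - S has components, so it suffices to exhibit
  labellings with many values.\<close>

locale tough_graph = fin_graph +
  fixes \<delta> :: nat
  assumes degree_ge: "v \<in> V \<Longrightarrow> \<delta> \<le> card {w. E v w}"
    and card_V_le: "card V \<le> 3 * \<delta> + 2"
    and tough: "\<And>S (f :: 'a \<Rightarrow> nat). S \<subseteq> V \<Longrightarrow>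
      (\<And>x y. x \<in> V - S \<Longrightarrow> y \<in> V - S \<Longrightarrow> E x y \<Longrightarrow> f x = f y) \<Longrightarrow>
      2 \<le> card (f ` (V - S)) \<Longrightarrow> card (f ` (V - S)) < card S"

context tough_graph
begin

text \<open>Labelling the two sides by 0 and 1 gives 2 < |S|.\<close>

lemma separator_card:
  assumes "S \<subseteq> V" "X \<subseteq> V - S" "X \<noteq> {}" "V - S - X \<noteq> {}"
    and sep: "\<And>x y. x \<in> X \<Longrightarrow> y \<in> V - S - X \<Longrightarrow> \<not> E x y"
  shows "3 \<le> card S"
proof -
  define f :: "'a \<Rightarrow> nat" where "f = (\<lambda>v. if v \<in> X then 0 else 1)"
  obtain x y where xy: "x \<in> X" "y \<in> V - S - X" using assms by blast
  then have "f x = 0" "f y = 1" "x \<in> V - S" "y \<in> V - S" using assms by (auto simp: f_def)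
  then have "{0, 1} \<subseteq> f ` (V - S)" by (metis empty_subsetI image_eqI insert_subset)
  then have fI: "f ` (V - S) = {0, 1}" by (auto simp: f_def)
  have "card (f ` (V - S)) < card S"
  proof (rule tough)
    show "S \<subseteq> V" by fact
    show "f x = f y" if "x \<in> V - S" "y \<in> V - S" "E x y" for x y
      using that sep[of x y] sep[of y x] E_comm[of x y] unfolding f_def by auto
    show "2 \<le> card (f ` (V - S))" using fI by simp
  qed
  then show ?thesis using fI by simp
qed

end

locale cycle_component = tough_graph +
  fixes C :: "'a list" and H :: "'a set"
  assumes max_cyc_C: "max_cyc C"
    and H_sub: "H \<subseteq> V - set C"
    and card_H: "2 \<le> card H"
    and H_linked: "x \<in> H \<Longrightarrow> y \<in> H \<Longrightarrow> linked H x y"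
    and H_closed: "x \<in> H \<Longrightarrow> E x y \<Longrightarrow> y \<in> H \<or> y \<in> set C"
begin

definition A :: "'a set" where "A = {a \<in> set C. \<exists>y\<in>H. E a y}"

definition R :: "'a set" where "R = V - set C - H"

definition joined :: "nat \<Rightarrow> 'a \<Rightarrow> 'a \<Rightarrow> bool" where
  "joined p a b \<longleftrightarrow> (\<exists>P. path_in H P \<and> p \<le> length P \<and> E a (hd P) \<and> E (last P) b)"

text \<open>\<open>A\<close>, \<open>H\<close> and \<open>R\<close> depend only on the vertex set of
  the cycle, so the exchange lemmas are stated for every longest cycle on that set; this covers all
  rotations.\<close>

definition reordering :: "'a list \<Rightarrow> bool" where
  "reordering D \<longleftrightarrow> max_cyc D \<and> set D = set C"

lemma reordering_C: "reordering C"
  by (simp add: reordering_def max_cyc_C)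

lemma reordering_rotate: "reordering (X @ Y) \<Longrightarrow> reordering (Y @ X)"
  by (auto simp: reordering_def dest: max_cyc_rotate)

lemma A_sub: "A \<subseteq> set C" by (auto simp: A_def)

lemma finite_A: "finite A" using A_sub finite_subset by auto

lemma finite_H: "finite H" using H_sub finite_V finite_subset by auto

lemma finite_R: "finite R" using finite_V by (simp add: R_def)

lemma set_C_sub: "set C \<subseteq> V" using max_cyc_C by (simp add: max_cyc_def cyc_def)

lemma length_reordering: "reordering D \<Longrightarrow> length D = length C"
  using max_cyc_C by (metis distinct_card max_cyc_distinct reordering_def)

lemma card_V_split: "card V = length C + card H + card R"
proof -
  have "V = set C \<union> (H \<union> R)" using H_sub set_C_sub by (auto simp: R_def)
  moreover have "set C \<inter> (H \<union> R) = {}" "H \<inter> R = {}" using H_sub by (auto simp: R_def)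
  ultimately have "card V = card (set C) + (card H + card R)"
    using finite_H finite_R by (metis List.finite_set card_Un_disjoint finite_UnI)
  then show ?thesis using max_cyc_C by (simp add: distinct_card max_cyc_distinct)
qed

lemma joined_mono: "joined p a b \<Longrightarrow> q \<le> p \<Longrightarrow> joined q a b"
  unfolding joined_def by (meson order_trans)

lemma joined_sym: "joined p a b \<Longrightarrow> joined p b a"
  unfolding joined_def path_in_def
  by (metis hd_rev last_rev length_rev path_in_def path_in_rev sym)

lemma joined_1: "a \<in> A \<Longrightarrow> b \<in> A \<Longrightarrow> joined 1 a b"
proof -
  assume "a \<in> A" "b \<in> A"
  then obtain x y where "x \<in> H" "y \<in> H" "E a x" "E b y" by (auto simp: A_def)
  moreover obtain P where "path_in H P" "hd P = x" "last P = y"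
    using H_linked calculation unfolding linked_def by blast
  moreover have "1 \<le> length P" using calculation by (cases P) (auto simp: path_in_def)
  ultimately show ?thesis using sym unfolding joined_def by blast
qed

lemma joined_2: "x \<in> H \<Longrightarrow> y \<in> H \<Longrightarrow> x \<noteq> y \<Longrightarrow> E a x \<Longrightarrow> E b y \<Longrightarrow> joined 2 a b"
proof -
  assume *: "x \<in> H" "y \<in> H" "x \<noteq> y" "E a x" "E b y"
  obtain P where P: "path_in H P" "hd P = x" "last P = y"
    using H_linked * unfolding linked_def by blast
  then have "2 \<le> length P" using *(3)
    by (cases P; cases "tl P") (auto simp: path_in_def)
  then show ?thesis using P * sym unfolding joined_def by blast
qed

lemma path_in_mono: "path_in X P \<Longrightarrow> X \<subseteq> Y \<Longrightarrow> path_in Y P"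
  by (auto simp: path_in_def)

lemma path_in_H: "path_in H P \<Longrightarrow> set D = set C \<Longrightarrow> path_in (V - set D) P"
  using H_sub path_in_mono by metis

lemma joined_insert_le:
  assumes "reordering (X @ Z)" "Z \<noteq> []" "joined p (last Z) (hd Z)"
  shows "p \<le> length X"
proof -
  obtain P where "path_in H P" "p \<le> length P" "E (last Z) (hd P)" "E (last P) (hd Z)"
    using assms(3) by (auto simp: joined_def)
  then show ?thesis using insert_le[of X Z P] assms path_in_H unfolding reordering_def by fastforce
qed

lemma joined_cross_le:
  assumes "reordering (X @ Y @ W @ Z)" "Y \<noteq> []" "Z \<noteq> []" "joined p (last Z) (last Y)"
    and "successively E (hd Y # L @ [hd Z])" "distinct L" "set L \<subseteq> R"
  shows "p + length L \<le> length X + length W"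
proof -
  obtain P where P: "path_in H P" "p \<le> length P" "E (last Z) (hd P)" "E (last P) (last Y)"
    using assms(4) by (auto simp: joined_def)
  have "set L \<subseteq> V - set (X @ Y @ W @ Z)" "set L \<inter> set P = {}"
    using assms(1,7) P(1) by (auto simp: R_def reordering_def path_in_def)
  with P cross_le[of X Y W Z P L] assms path_in_H[OF P(1)] show ?thesis
    unfolding reordering_def by fastforce
qed

lemma joined_cross'_le:
  assumes "reordering (X @ Y @ W @ Z)" "Y \<noteq> []" "Z \<noteq> []" "joined p (hd Z) (hd Y)"
    and "successively E (last Y # L @ [last Z])" "distinct L" "set L \<subseteq> R"
  shows "p + length L \<le> length X + length W"
proof -
  obtain P where P: "path_in H P" "p \<le> length P" "E (hd Z) (hd P)" "E (last P) (hd Y)"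
    using assms(4) by (auto simp: joined_def)
  have "set L \<subseteq> V - set (X @ Y @ W @ Z)" "set L \<inter> set P = {}"
    using assms(1,7) P(1) by (auto simp: R_def reordering_def path_in_def)
  with P cross'_le[of X Y W Z P L] assms path_in_H[OF P(1)] show ?thesis
    unfolding reordering_def by fastforce
qed

lemma joined_gap_le:
  assumes "reordering (Y1 @ X @ Y2 @ Z)" "Y1 \<noteq> []" "Y2 \<noteq> []" "Z \<noteq> []" "joined p (last Z) (last Y2)"
    and "E (hd Y2) (hd Y1)" "E (last Y1) (hd Z)"
  shows "p \<le> length X"
proof -
  obtain P where P: "path_in H P" "p \<le> length P" "E (last Z) (hd P)" "E (last P) (last Y2)"
    using assms(5) by (auto simp: joined_def)
  with gap_le[of Y1 X Y2 Z P] assms path_in_H[OF P(1)] show ?thesis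
    unfolding reordering_def by fastforce
qed

text \<open>Otherwise a path through H could be inserted between the two without losing a
  vertex.\<close>

lemma not_consecutive:
  assumes "reordering Z" "Z \<noteq> []" "last Z \<in> A" shows "hd Z \<notin> A"
  using joined_insert_le[of "[]" Z 1] joined_1 assms by auto

lemma A_not_all: "\<not> set C \<subseteq> A"
proof
  assume "set C \<subseteq> A"
  moreover have "C \<noteq> []" using max_cyc_C by (auto simp: max_cyc_def cyc_def)
  ultimately show False using not_consecutive[OF reordering_C]
    by (meson hd_in_set last_in_set subsetD)
qed

lemma card_A: "3 \<le> card A"
proof (rule separator_card)
  show "A \<subseteq> V" using A_sub set_C_sub by blast
  show "H \<subseteq> V - A" using H_sub A_sub by blast
  show "H \<noteq> {}" using card_H by auto
  show "V - A - H \<noteq> {}" using A_not_all H_sub set_C_sub by blast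
  show "\<not> E x y" if "x \<in> H" "y \<in> V - A - H" for x y
    using that H_closed sym unfolding A_def by blast
qed

lemma index_count:
  "distinct U \<Longrightarrow> card {v \<in> set U. P v} = card {i. i < length U \<and> P (U ! i)}"
  by (metis Collect_conj_eq Int_commute distinct_length_filter length_filter_conv_card Collect_mem_eq)

end

text \<open>The four sets that are shown disjoint are \<open>I\<close> shifted by one, \<open>J\<close>, \<open>K\<close> and \<open>B\<close>, where the
  elements of \<open>B \<inter> J\<close> are shifted upwards.\<close>

lemma arc_card_le:
  fixes I J B K :: "nat set"
  assumes sub: "I \<subseteq> {..<l}" "J \<subseteq> {..<l}" "B \<subseteq> {..<l}" "K \<subseteq> {..<l}"
    and "0 \<notin> I"
    and IJ: "\<And>t. Suc t \<in> I \<Longrightarrow> t \<notin> J"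
    and IJ2: "\<And>t. t \<in> J \<Longrightarrow> Suc (Suc t) \<notin> I"
    and B: "\<And>t. t \<in> B \<Longrightarrow> Suc t \<notin> I \<and> Suc t \<notin> J \<and> Suc t \<notin> B"
    and K: "\<And>k. k \<in> K \<Longrightarrow> k \<notin> J \<and> Suc k \<notin> I \<and> k \<notin> B \<and> (\<forall>t\<in>B. k \<noteq> Suc t)"
  shows "card I + card J + card B + card K \<le> Suc l"
proof -
  define I' where "I' = {t. Suc t \<in> I}"
  define B1 where "B1 = {t \<in> B. t \<notin> J}"
  define B2 where "B2 = {t \<in> B. t \<in> J \<and> Suc t < l}"
  have fin: "finite I" "finite J" "finite B" "finite K"
    using sub finite_subset by blast+
  have "I = Suc ` I'" using \<open>0 \<notin> I\<close> unfolding I'_def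
    by (auto simp: image_iff) (metis not0_implies_Suc)
  then have cI: "card I = card I'" and finI: "finite I'"
    using fin finite_imageD[of Suc I'] by (auto simp: card_image)
  \<comment> \<open>The last position cannot be shifted up inside the arc. It accounts for the
    \<open>Suc\<close> in the bound.\<close>
  have "B \<subseteq> B1 \<union> B2 \<union> {l - 1}" using sub by (fastforce simp: B1_def B2_def)
  then have "card B \<le> card (B1 \<union> B2 \<union> {l - 1})" using fin by (intro card_mono) (auto simp: B1_def B2_def)
  also have "\<dots> \<le> card B1 + card B2 + 1"
    by (metis card_Un_le add_mono_thms_linordered_semiring(3) is_singletonI is_singleton_altdef order_trans)
  also have "card B2 = card (Suc ` B2)" by (simp add: card_image)
  finally have cB: "card B \<le> card B1 + card (Suc ` B2) + 1" .
  have fin': "finite B1" "finite B2" using fin by (auto simp: B1_def B2_def)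
  have "card I' + card J + card B1 + card (Suc ` B2) + card K
      = card (I' \<union> J \<union> B1 \<union> Suc ` B2 \<union> K)"
    apply (subst card_Un_disjoint)
    subgoal using finI fin fin' by simp
    subgoal using fin by simp
    subgoal using K by (auto simp: I'_def B1_def B2_def)
    apply (subst card_Un_disjoint)
    subgoal using finI fin fin' by simp
    subgoal using fin' by simp
    subgoal using IJ2 B by (auto simp: I'_def B1_def B2_def)
    apply (subst card_Un_disjoint)
    subgoal using finI fin fin' by simp
    subgoal using fin' by simp
    subgoal using B by (auto simp: I'_def B1_def B2_def)
    apply (subst card_Un_disjoint)
    using finI fin fin' IJ by (auto simp: I'_def B1_def B2_def)
  also have "\<dots> \<le> card {..<l}"
    using sub by (intro card_mono) (auto simp: I'_def B1_def B2_def)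
  finally show ?thesis using cI cB by simp
qed

section \<open>Bondy counting at the successors of two attachment vertices\<close>

context cycle_component
begin

text \<open>\<open>hd U\<close> and \<open>hd W\<close> are the successors of the attachment
  vertices \<open>last W\<close> and \<open>last U\<close>. Their neighbours on \<open>U\<close>
  occupy different positions once one of the two sets is shifted; the positions in \<open>A\<close>
  can be added, and \<open>K\<close> collects positions that are known to stay free.\<close>

lemma arc_count:
  assumes D: "reordering (U @ W)" and ne: "U \<noteq> []" "W \<noteq> []"
    and ends: "last U \<in> A" "last W \<in> A" and j2: "joined 2 (last W) (last U)"
    and KU: "K \<subseteq> {..<length U}"
    and K: "\<And>k. k \<in> K \<Longrightarrow> \<not> E (hd W) (U ! k)"
      "\<And>k. k \<in> K \<Longrightarrow> Suc k < length U \<Longrightarrow> \<not> E (hd U) (U ! Suc k)"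
      "\<And>k. k \<in> K \<Longrightarrow> U ! k \<notin> A"
      "\<And>k. Suc k \<in> K \<Longrightarrow> U ! k \<notin> A"
  shows "card {v \<in> set U. E (hd U) v} + card {v \<in> set U. E (hd W) v} + card {v \<in> set U. v \<in> A}
    + card K \<le> Suc (length U)"
proof -
  define l where "l = length U"
  define I where "I = {t. t < l \<and> E (hd U) (U ! t)}"
  define J where "J = {t. t < l \<and> E (hd W) (U ! t)}"
  define B where "B = {t. t < l \<and> U ! t \<in> A}"
  have dU: "distinct U" using D by (auto simp: reordering_def dest: max_cyc_distinct)
  have cut: "reordering (take (Suc t) U @ drop (Suc t) U @ W)" for t
    using D by (metis append.assoc append_take_drop_id)
  have hd_drop: "hd (drop (Suc t) U) = U ! Suc t" if "Suc t < l" for t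
    using that by (simp add: hd_drop_conv_nth l_def)
  have last_take: "last (take (Suc t) U) = U ! t" if "t < l" for t
    using that by (simp add: take_Suc_conv_app_nth l_def)
  have hd_take: "hd (take (Suc t) U) = hd U" for t using ne by simp
  have last_drop: "last (drop (Suc t) U) = last U" if "Suc t < l" for t
    using that by (simp add: l_def)
  have no_gap: "t \<notin> J" if "Suc t \<in> I" for t
  proof
    assume "t \<in> J"
    have "reordering (take (Suc t) U @ [] @ drop (Suc t) U @ W)" using cut by simp
    from joined_gap_le[OF this, of 2] have "2 \<le> length ([] :: 'a list)"
      using that \<open>t \<in> J\<close> ne j2 hd_drop last_take hd_take last_drop
      by (simp add: I_def J_def l_def E_comm)
    then show False by simp
  qed
  \<comment> \<open>This exchange drops the vertex \<open>U ! Suc t\<close>, so the detour through H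
    needs two vertices; this is the use of \<open>joined 2\<close>.\<close>
  have no_gap2: "Suc (Suc t) \<notin> I" if "t \<in> J" for t
  proof
    assume *: "Suc (Suc t) \<in> I"
    have "U = take (Suc t) U @ [U ! Suc t] @ drop (Suc (Suc t)) U"
      using * by (metis (no_types, lifting) Cons_eq_appendI I_def Suc_lessD append_Nil append_take_drop_id
        Cons_nth_drop_Suc l_def mem_Collect_eq)
    then have "reordering (take (Suc t) U @ [U ! Suc t] @ drop (Suc (Suc t)) U @ W)"
      using D by (metis append_assoc)
    from joined_gap_le[OF this, of 2] have "2 \<le> length [U ! Suc t]"
      using that * ne j2 hd_drop last_take hd_take last_drop
      by (simp add: I_def J_def l_def E_comm)
    then show False by simp
  qed
  \<comment> \<open>\<open>U ! Suc t\<close> follows an attachment vertex. An edge between two such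
    successors would admit a detour through H that loses nothing.\<close>
  have Bprop: "Suc t \<notin> I \<and> Suc t \<notin> J \<and> Suc t \<notin> B" if "t \<in> B" for t
  proof (cases "Suc t < l")
    case False
    then show ?thesis by (simp add: I_def J_def B_def)
  next
    case True
    have t: "t < l" "U ! t \<in> A" using that by (auto simp: B_def)
    note r = cut[of t]
    then have r': "reordering (drop (Suc t) U @ W @ take (Suc t) U)"
      using reordering_rotate[of "take (Suc t) U" "drop (Suc t) U @ W"] by simp
    have "Suc t \<notin> I"
    proof
      assume *: "Suc t \<in> I"
      have "1 + length ([] :: 'a list) \<le> length ([] :: 'a list) + length ([] :: 'a list)"
      proof (rule joined_cross_le)
        show "reordering ([] @ take (Suc t) U @ [] @ (drop (Suc t) U @ W))" using r by simp
        show "joined 1 (last (drop (Suc t) U @ W)) (last (take (Suc t) U))"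
          using joined_1 ends ne t last_take by simp
        show "successively E (hd (take (Suc t) U) # [] @ [hd (drop (Suc t) U @ W)])"
          using * True hd_drop by (simp add: hd_take I_def hd_append l_def)
      qed (use ne in auto)
      then show False by simp
    qed
    moreover have "Suc t \<notin> J"
    proof
      assume *: "Suc t \<in> J"
      have "1 + length ([] :: 'a list) \<le> length ([] :: 'a list) + length ([] :: 'a list)"
      proof (rule joined_cross_le)
        show "reordering ([] @ drop (Suc t) U @ [] @ (W @ take (Suc t) U))" using r' by simp
        show "joined 1 (last (W @ take (Suc t) U)) (last (drop (Suc t) U))"
          using joined_1 ends ne t last_take last_drop True by simp
        show "successively E (hd (drop (Suc t) U) # [] @ [hd (W @ take (Suc t) U)])"
          using * True hd_drop ne by (simp add: J_def E_comm)
      qed (use ne True in \<open>auto simp: l_def\<close>)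
      then show False by simp
    qed
    moreover have "Suc t \<notin> B"
      using not_consecutive[OF r'] True hd_drop ne t last_take by (auto simp: B_def l_def hd_append)
    ultimately show ?thesis by blast
  qed
  have "E (hd U) (U ! 0) \<longleftrightarrow> False" using ne irrefl by (simp add: hd_conv_nth)
  then have "card I + card J + card B + card K \<le> Suc l"
    using no_gap no_gap2 Bprop K KU
    by (intro arc_card_le) (auto simp: I_def J_def B_def l_def)
  then show ?thesis using dU by (simp add: index_count I_def J_def B_def l_def)
qed

lemma degree_split:
  assumes "u \<in> set C" "u \<notin> A" "set C = set U \<union> set W" "set U \<inter> set W = {}"
  shows "card {w. E u w} = card {v \<in> set U. E u v} + card {v \<in> set W. E u v} + card {v \<in> R. E u v}"
proof -
  have "{w. E u w} = {v \<in> set U. E u v} \<union> ({v \<in> set W. E u v} \<union> {v \<in> R. E u v})"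
    using assms in_V2 H_sub set_C_sub by (auto simp: A_def R_def)
  moreover have "{v \<in> set U. E u v} \<inter> ({v \<in> set W. E u v} \<union> {v \<in> R. E u v}) = {}"
    "{v \<in> set W. E u v} \<inter> {v \<in> R. E u v} = {}"
    using assms by (auto simp: R_def)
  moreover have "finite {v \<in> set U. E u v}" "finite {v \<in> set W. E u v}" "finite {v \<in> R. E u v}"
    using finite_R by auto
  ultimately show ?thesis by (simp only: card_Un_disjoint finite_Un add.assoc)
qed

text \<open>Adding the counts on both arcs gives 2\<delta> + |A| + (p - 2) \<le> |C| + |R| + 2,
  where |C| + |R| \<le> 3\<delta> + 2 - |H|. The gain p - 2 comes from the vertices of
  \<open>Q\<close> close to \<open>b\<close>: a chord from either successor to one of them would
  skip fewer than p vertices.\<close>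

lemma triple_degree_bound:
  assumes D: "reordering (U1 @ b # Q @ a' # W)" and W: "W \<noteq> []"
    and A: "b \<in> A" "a' \<in> A" "last W \<in> A" "set Q \<inter> A = {}"
    and j: "joined 2 (last W) a'" "joined p b a'" "joined p b (last W)" and "2 \<le> p"
  shows "card A + card H + p \<le> \<delta> + 6"
proof -
  define U where "U = U1 @ b # Q @ [a']"
  have D': "reordering (U @ W)" using D by (simp add: U_def)
  then have D'': "reordering (W @ U)" by (rule reordering_rotate)
  have ne: "U \<noteq> []" and lastU: "last U = a'" by (auto simp: U_def)
  have dist: "distinct (U @ W)" and setC: "set C = set U \<union> set W"
    using D' max_cyc_distinct[of "U @ W"] by (auto simp: reordering_def)
  have hdU: "hd U \<notin> A" using not_consecutive[OF D'] ne W A by (simp add: hd_append)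
  have hdW: "hd W \<notin> A" using not_consecutive[OF D''] ne W A lastU by (simp add: hd_append)
  have "p \<le> length Q"
  proof (rule joined_insert_le)
    have "reordering ((U1 @ [b]) @ (Q @ a' # W))" using D by simp
    from reordering_rotate[OF this] show "reordering (Q @ (a' # W @ U1 @ [b]))" by simp
    show "joined p (last (a' # W @ U1 @ [b])) (hd (a' # W @ U1 @ [b]))" using j by simp
  qed simp
  define n where "n = length U1"
  have U1: "U1 \<noteq> []" using hdU A(1) by (auto simp: U_def)
  \<comment> \<open>Position \<open>n + 1\<close>, right after \<open>b\<close>, is omitted: in
    \<open>arc_card_le\<close> the position of \<open>b\<close> may be shifted onto it.\<close>
  define K where "K = {n + 2..<n + p}"
  have nthQ: "U ! k = Q ! (k - n - 1)" "U ! k \<in> set Q" if "n < k" "k < n + p" for k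
    using that \<open>p \<le> length Q\<close> by (auto simp: U_def n_def nth_append nth_Cons')
  have split: "U @ W = (U1 @ [b]) @ take k (Q @ [a']) @ drop k (Q @ [a']) @ W" for k
    unfolding U_def by (metis append.assoc append_Cons append_Nil append_take_drop_id)
  have hd_drop: "hd (drop k (Q @ [a'])) = U ! (n + 1 + k)" if "k < p" for k
    using that \<open>p \<le> length Q\<close> by (simp add: hd_drop_conv_nth U_def n_def nth_append)
  \<comment> \<open>The rerouting loses the \<open>k\<close> vertices after \<open>b\<close> and
    gains a detour from \<open>b\<close> to \<open>last W\<close>.\<close>
  have notI: "\<not> E (hd U) (U ! (n + 1 + k))" if "k < p" for k
  proof
    assume *: "E (hd U) (U ! (n + 1 + k))"
    have "p + length ([] :: 'a list) \<le> length ([] :: 'a list) + length (take k (Q @ [a']))"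
    proof (rule joined_cross_le)
      show "reordering ([] @ (U1 @ [b]) @ take k (Q @ [a']) @ (drop k (Q @ [a']) @ W))"
        using D' split[of k] by simp
      show "joined p (last (drop k (Q @ [a']) @ W)) (last (U1 @ [b]))" using j W by (simp add: joined_sym)
      show "successively E (hd (U1 @ [b]) # [] @ [hd (drop k (Q @ [a']) @ W)])"
        using * U1 that hd_drop \<open>p \<le> length Q\<close> by (simp add: U_def hd_append)
    qed (use W in auto)
    then show False using that by simp
  qed
  \<comment> \<open>Again \<open>k\<close> vertices are lost, now against a detour from
    \<open>b\<close> to \<open>a'\<close>.\<close>
  have notJ: "\<not> E (hd W) (U ! (n + 1 + k))" if "k < p" for k
  proof
    assume *: "E (hd W) (U ! (n + 1 + k))"
    have "p + length ([] :: 'a list) \<le> length (take k (Q @ [a'])) + length ([] :: 'a list)"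
    proof (rule joined_cross_le)
      have "reordering ((U1 @ [b]) @ take k (Q @ [a']) @ drop k (Q @ [a']) @ W)"
        using D' split[of k] by simp
      from reordering_rotate[OF this]
      show "reordering (take k (Q @ [a']) @ drop k (Q @ [a']) @ [] @ (W @ U1 @ [b]))" by simp
      show "joined p (last (W @ U1 @ [b])) (last (drop k (Q @ [a'])))"
        using j that \<open>p \<le> length Q\<close> by simp
      show "successively E (hd (drop k (Q @ [a'])) # [] @ [hd (W @ U1 @ [b])])"
        using * W that hd_drop by (simp add: E_comm)
    qed (use that \<open>p \<le> length Q\<close> in auto)
    then show False using that by simp
  qed
  have "card {v \<in> set U. E (hd U) v} + card {v \<in> set U. E (hd W) v} + card {v \<in> set U. v \<in> A}
    + card K \<le> Suc (length U)"
  proof (rule arc_count[OF D' ne W])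
    show "last U \<in> A" "last W \<in> A" "joined 2 (last W) (last U)" using A j lastU by auto
    show "K \<subseteq> {..<length U}" using \<open>p \<le> length Q\<close> by (auto simp: K_def U_def n_def)
    fix k
    have "n + 1 + (k - n - 1) = k" "k - n - 1 < p" "n + 1 + (k - n) = Suc k" "k - n < p" if "k \<in> K"
      using that by (auto simp: K_def)
    then show "\<not> E (hd W) (U ! k)" "\<not> E (hd U) (U ! Suc k)" if "k \<in> K"
      using notJ[of "k - n - 1"] notI[of "k - n"] that by metis+
    show "U ! k \<notin> A" if "k \<in> K" using nthQ[of k] that A by (auto simp: K_def)
    show "U ! k \<notin> A" if "Suc k \<in> K" using nthQ[of k] that A by (auto simp: K_def)
  qed
  moreover have "card {v \<in> set W. E (hd W) v} + card {v \<in> set W. E (hd U) v} + card {v \<in> set W. v \<in> A}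
    + card ({} :: nat set) \<le> Suc (length W)"
    by (rule arc_count[OF D'' W ne]) (use A j lastU in \<open>auto intro: joined_sym\<close>)
  moreover have "card A = card {v \<in> set U. v \<in> A} + card {v \<in> set W. v \<in> A}"
  proof -
    have "A = {v \<in> set U. v \<in> A} \<union> {v \<in> set W. v \<in> A}" using A_sub setC by blast
    then show ?thesis using dist card_Un_disjoint[of "{v \<in> set U. v \<in> A}" "{v \<in> set W. v \<in> A}"] by fastforce
  qed
  moreover have "card {v \<in> R. E (hd U) v} + card {v \<in> R. E (hd W) v} \<le> card R"
  proof -
    \<comment> \<open>A common neighbour in \<open>R\<close> would replace the edge between the two
      successors in the crossing exchange.\<close>
    have "\<not> (E (hd U) v \<and> E (hd W) v)" if "v \<in> R" for v
    proof
      assume "E (hd U) v \<and> E (hd W) v"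
      then have "1 + length [v] \<le> length ([] :: 'a list) + length ([] :: 'a list)"
        using D' ne W lastU A joined_1 that by (intro joined_cross_le[of _ U _ W]) (auto simp: E_comm)
      then show False by simp
    qed
    then have "{v \<in> R. E (hd U) v} \<inter> {v \<in> R. E (hd W) v} = {}" by blast
    then have "card {v \<in> R. E (hd U) v} + card {v \<in> R. E (hd W) v}
      = card ({v \<in> R. E (hd U) v} \<union> {v \<in> R. E (hd W) v})"
      using finite_R by (simp add: card_Un_disjoint)
    also have "\<dots> \<le> card R" using finite_R by (intro card_mono) auto
    finally show ?thesis .
  qed
  moreover have "card {w. E (hd U) w} = card {v \<in> set U. E (hd U) v} + card {v \<in> set W. E (hd U) v} + card {v \<in> R. E (hd U) v}"
    using degree_split[of "hd U" U W] hdU setC dist ne by auto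
  moreover have "card {w. E (hd W) w} = card {v \<in> set U. E (hd W) v} + card {v \<in> set W. E (hd W) v} + card {v \<in> R. E (hd W) v}"
    using degree_split[of "hd W" U W] hdW setC dist W by auto
  moreover have "\<delta> \<le> card {w. E (hd U) w}" "\<delta> \<le> card {w. E (hd W) w}"
    using degree_ge[of "hd U"] degree_ge[of "hd W"] setC set_C_sub hd_in_set[OF ne] hd_in_set[OF W] by auto
  moreover have "card K = p - 2" by (simp add: K_def)
  moreover have "length U + length W = length C" using length_reordering[OF D'] by simp
  ultimately show ?thesis using card_V_split card_V_le \<open>2 \<le> p\<close> by linarith
qed

end

lemma segment_list:
  "\<exists>q D. xs = q @ concat (map (\<lambda>(a, q). a # q) D) \<and> set q \<inter> A = {} \<and>
     (\<forall>(a, q) \<in> set D. a \<in> A \<and> set q \<inter> A = {})"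
proof (induction xs)
  case Nil
  show ?case by (intro exI[of _ "[]"]) simp
next
  case (Cons x xs)
  then obtain q D where *: "xs = q @ concat (map (\<lambda>(a, q). a # q) D)" "set q \<inter> A = {}"
    "\<forall>(a, q) \<in> set D. a \<in> A \<and> set q \<inter> A = {}" by blast
  show ?case
  proof (cases "x \<in> A")
    case True
    then show ?thesis using * by (intro exI[of _ "[]"] exI[of _ "(x, q) # D"]) auto
  next
    case False
    then show ?thesis using * by (intro exI[of _ "x # q"] exI[of _ D]) auto
  qed
qed

lemma length_segments:
  "length (concat (map (\<lambda>(a, q). a # q) D)) = length D + (\<Sum>i<length D. length (snd (D ! i)))"
  by (induction D rule: rev_induct) (auto simp: nth_append case_prod_beta)

lemma set_segments:
  "set (concat (map (\<lambda>(a, q). a # q) D)) = fst ` set D \<union> (\<Union>d\<in>set D. set (snd d))"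
  by (induction D) auto

section \<open>The segments between consecutive attachment vertices\<close>

text \<open>The cycle is read from an attachment vertex on. \<open>D\<close> pairs each attachment
  vertex with the stretch of the cycle up to the next one, so there is no initial remainder.\<close>

locale segmented = cycle_component +
  fixes D :: "('a \<times> 'a list) list"
  assumes C_eq: "C = concat (map (\<lambda>(a, q). a # q) D)"
    and D_fst: "d \<in> set D \<Longrightarrow> fst d \<in> A"
    and D_snd: "d \<in> set D \<Longrightarrow> set (snd d) \<inter> A = {}"
begin

definition s :: nat where "s = length D"
definition att :: "nat \<Rightarrow> 'a" where "att i = fst (D ! i)"
definition seg :: "nat \<Rightarrow> 'a list" where "seg i = snd (D ! i)"
definition nx :: "nat \<Rightarrow> nat" where "nx i = Suc i mod s"

lemma D_nth: "i < s \<Longrightarrow> D ! i = (att i, seg i)"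
  by (simp add: att_def seg_def)

lemma att_in_A: "i < s \<Longrightarrow> att i \<in> A"
  using D_fst by (simp add: att_def s_def)

lemma seg_not_A: "i < s \<Longrightarrow> v \<in> set (seg i) \<Longrightarrow> v \<notin> A"
  using D_snd[of "D ! i"] by (auto simp: seg_def s_def)

lemma set_C: "set C = att ` {..<s} \<union> (\<Union>i<s. set (seg i))"
proof -
  have "set D = (!) D ` {..<s}" by (auto simp: s_def set_conv_nth)
  then show ?thesis unfolding C_eq set_segments att_def seg_def by (simp add: image_image)
qed

lemma A_eq: "A = att ` {..<s}"
  using set_C A_sub att_in_A seg_not_A by blast

lemma length_C: "length C = s + (\<Sum>i<s. length (seg i))"
  by (simp add: C_eq length_segments s_def seg_def)

lemma split_at:
  assumes "i < s"
  shows "C = concat (map (\<lambda>(a, q). a # q) (take i D)) @ att i # seg i @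
    concat (map (\<lambda>(a, q). a # q) (drop (Suc i) D))"
proof -
  have "D = take i D @ D ! i # drop (Suc i) D" using assms by (simp add: s_def id_take_nth_drop)
  then show ?thesis using C_eq D_nth[OF assms]
    by (metis (no_types, lifting) append_Cons case_prod_conv concat.simps(2) concat_append list.simps(9) map_append)
qed

lemma hd_segments:
  assumes "E' \<noteq> []"
  shows "hd (concat (map (\<lambda>(a, q). a # q) E') @ z) = fst (hd E')"
  using assms by (cases E') (auto simp: case_prod_beta)

text \<open>A rotation that brings both segments into view. Taking the head of
  \<open>B1 @ [att l]\<close> also covers the case that \<open>att l\<close> comes right after
  segment \<open>k\<close>.\<close>

lemma split_at2_less:
  assumes "k < l" "l < s"
  shows "\<exists>B1 B2. reordering (att k # seg k @ B1 @ att l # seg l @ B2) \<and>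
    hd (B1 @ [att l]) = att (nx k) \<and> hd (B2 @ [att k]) = att (nx l)"
proof -
  define cc :: "('a \<times> 'a list) list \<Rightarrow> 'a list" where "cc = (\<lambda>E'. concat (map (\<lambda>(a, q). a # q) E'))"
  have cc_app: "cc (x @ y) = cc x @ cc y" for x y by (simp add: cc_def)
  define M where "M = take (l - Suc k) (drop (Suc k) D)"
  have "drop (Suc k) D = M @ D ! l # drop (Suc l) D"
  proof -
    have "drop (l - Suc k) (drop (Suc k) D) = drop l D" using assms by simp
    also have "\<dots> = D ! l # drop (Suc l) D" using assms by (simp add: s_def Cons_nth_drop_Suc)
    finally show ?thesis unfolding M_def by (metis append_take_drop_id)
  qed
  then have DD: "D = take k D @ D ! k # M @ D ! l # drop (Suc l) D"
    using assms by (metis dual_order.strict_trans id_take_nth_drop s_def)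
  have "C = cc D" by (simp add: C_eq cc_def)
  also have "\<dots> = cc (take k D @ D ! k # M @ D ! l # drop (Suc l) D)" using DD by simp
  also have "\<dots> = cc (take k D) @ att k # seg k @ cc M @ att l # seg l @ cc (drop (Suc l) D)"
    using assms by (simp add: cc_def D_nth)
  finally have "reordering (cc (take k D) @ (att k # seg k @ cc M @ att l # seg l @ cc (drop (Suc l) D)))"
    using reordering_C by simp
  from reordering_rotate[OF this]
  have "reordering (att k # seg k @ cc M @ att l # seg l @ cc (drop (Suc l) D @ take k D))"
    by (simp add: cc_app)
  moreover have "hd (cc M @ [att l]) = att (nx k)"
  proof (cases "M = []")
    case True
    then have "l = Suc k" using assms by (auto simp: M_def s_def)
    then show ?thesis using True assms by (simp add: cc_def nx_def)
  next
    case False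
    then have "hd M = D ! Suc k" using assms by (simp add: M_def hd_drop_conv_nth s_def)
    then show ?thesis using False assms hd_segments[OF False] by (simp add: cc_def nx_def att_def)
  qed
  moreover have "hd (cc (drop (Suc l) D @ take k D) @ [att k]) = att (nx l)"
  proof (cases "drop (Suc l) D @ take k D = []")
    case True
    then have "k = 0" "Suc l = s" using assms by (auto simp: s_def)
    then show ?thesis using True assms by (simp add: cc_def nx_def)
  next
    case False
    have "hd (drop (Suc l) D @ take k D) = D ! nx l"
    proof (cases "Suc l < s")
      case True
      then show ?thesis by (simp add: nx_def s_def hd_append hd_drop_conv_nth)
    next
      case False
      then have *: "drop (Suc l) D = []" "Suc l = s" using assms by (auto simp: s_def)
      then show ?thesis using \<open>drop (Suc l) D @ take k D \<noteq> []\<close> by (cases k) (auto simp: nx_def hd_conv_nth)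
    qed
    then show ?thesis using hd_segments[OF False] by (simp only: cc_def att_def)
  qed
  ultimately show ?thesis by blast
qed

lemma split_at2:
  assumes "k < s" "l < s" "k \<noteq> l"
  obtains B1 B2 where "reordering (att k # seg k @ B1 @ att l # seg l @ B2)"
    "hd (B1 @ [att l]) = att (nx k)" "hd (B2 @ [att k]) = att (nx l)"
proof (cases "k < l")
  case True
  then show ?thesis using split_at2_less assms that by blast
next
  case False
  then have "l < k" using assms by simp
  then obtain B1 B2 where *: "reordering (att l # seg l @ B1 @ att k # seg k @ B2)"
    "hd (B1 @ [att k]) = att (nx l)" "hd (B2 @ [att l]) = att (nx k)"
    using split_at2_less assms by blast
  have "reordering ((att l # seg l @ B1) @ (att k # seg k @ B2))" using * by simp
  from reordering_rotate[OF this] show ?thesis using that * by simp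
qed

lemma distinct_C: "distinct C"
  using max_cyc_C by (rule max_cyc_distinct)

lemma distinct_split2:
  assumes "k < s" "l < s" "k \<noteq> l"
  shows "att k \<noteq> att l" "set (seg k) \<inter> set (seg l) = {}" "att k \<notin> set (seg k)"
proof -
  obtain B1 B2 where "reordering (att k # seg k @ B1 @ att l # seg l @ B2)"
    using split_at2[OF assms] .
  then have "distinct (att k # seg k @ B1 @ att l # seg l @ B2)"
    unfolding reordering_def using max_cyc_distinct by blast
  then show "att k \<noteq> att l" "set (seg k) \<inter> set (seg l) = {}" "att k \<notin> set (seg k)" by auto
qed

lemma inj_att: "inj_on att {..<s}"
  using distinct_split2 by (auto simp: inj_on_def)

lemma card_A_s: "card A = s"
  by (simp add: A_eq card_image inj_att)

lemma s_ge: "3 \<le> s"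
  using card_A card_A_s by simp

lemma nx_less: "nx i < s"
  using s_ge by (simp add: nx_def)

lemma nx_neq: "i < s \<Longrightarrow> nx i \<noteq> i"
  using s_ge by (cases "Suc i = s") (auto simp: nx_def)

lemma inj_nx: "inj_on nx {..<s}"
proof (rule inj_onI)
  fix i j assume "i \<in> {..<s}" "j \<in> {..<s}" "nx i = nx j"
  then show "i = j" by (cases "Suc i = s"; cases "Suc j = s") (auto simp: nx_def)
qed

lemma nx_image: "nx ` {..<s} = {..<s}"
  by (rule card_subset_eq) (auto simp: nx_less card_image inj_nx)

lemma sum_nx: "(\<Sum>i<s. f (nx i)) = (\<Sum>i<s. f i :: nat)"
  using sum.reindex[OF inj_nx, of f] nx_image by simp

text \<open>\<open>nx\<close> permutes the indices in a single cycle, so its iterates reach every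
  index.\<close>

lemma nx_exit:
  assumes "T \<subseteq> {..<s}" "T \<noteq> {}" "T \<noteq> {..<s}"
  shows "\<exists>i\<in>T. nx i \<notin> T"
proof (rule ccontr)
  assume *: "\<not> (\<exists>i\<in>T. nx i \<notin> T)"
  obtain i0 where "i0 \<in> T" "i0 < s" using assms by blast
  have "(i0 + n) mod s \<in> T" for n
  proof (induction n)
    case 0 then show ?case using \<open>i0 \<in> T\<close> \<open>i0 < s\<close> by simp
  next
    case (Suc n)
    then have "nx ((i0 + n) mod s) \<in> T" using * by blast
    then show ?case by (simp add: nx_def mod_Suc_eq)
  qed
  moreover have "\<exists>n. (i0 + n) mod s = j" if "j < s" for j
    using that \<open>i0 < s\<close> by (intro exI[of _ "s + j - i0"]) simp
  ultimately have "{..<s} \<subseteq> T" by (metis lessThan_iff subsetI)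
  then show False using assms by blast
qed

lemma seg_ge:
  assumes "i < s" "joined p (att i) (att (nx i))"
  shows "p \<le> length (seg i)"
proof -
  obtain B1 B2 where *: "reordering (att i # seg i @ B1 @ att (nx i) # seg (nx i) @ B2)"
    "hd (B1 @ [att (nx i)]) = att (nx i)"
    using split_at2[of i "nx i"] assms nx_less nx_neq by metis
  have "reordering ([att i] @ seg i @ B1 @ att (nx i) # seg (nx i) @ B2)" using * by simp
  from reordering_rotate[OF this]
  have "reordering (seg i @ (B1 @ att (nx i) # seg (nx i) @ B2 @ [att i]))" by simp
  moreover have "hd (B1 @ att (nx i) # seg (nx i) @ B2 @ [att i]) = att (nx i)"
    using * by (cases B1) auto
  ultimately show ?thesis using joined_insert_le assms(2)
    by (metis append_is_Nil_conv last_appendR last_ConsL list.distinct(1) last_ConsR)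
qed

lemma cycle_count: "s + (\<Sum>i<s. length (seg i)) + card H + card R \<le> 3 * \<delta> + 2"
  using card_V_split card_V_le length_C by simp

text \<open>The cycle is read from the vertex after \<open>att j\<close>, so that segment
  \<open>m\<close> becomes the \<open>Q\<close> of \<open>triple_degree_bound\<close>.\<close>

lemma triple_bound:
  assumes "m < s" "j < s" "j \<noteq> m" "j \<noteq> nx m" "2 \<le> p"
    and "joined 2 (att j) (att (nx m))" "joined p (att m) (att (nx m))" "joined p (att m) (att j)"
  shows "s + card H + p \<le> \<delta> + 6"
proof -
  obtain B1 B2 where *: "reordering (att m # seg m @ B1 @ att j # seg j @ B2)"
    "hd (B1 @ [att j]) = att (nx m)"
    using split_at2[of m j] assms by metis
  have "B1 \<noteq> []"
    using * assms distinct_split2[OF \<open>j < s\<close> nx_less] by auto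
  then obtain B where B: "B1 = att (nx m) # B" using * by (cases B1) auto
  have "reordering ((att m # seg m @ att (nx m) # B @ [att j]) @ (seg j @ B2))" using * B by simp
  from reordering_rotate[OF this]
  have "reordering ((seg j @ B2) @ att m # seg m @ att (nx m) # (B @ [att j]))" by simp
  from triple_degree_bound[OF this, of p] show ?thesis
    using assms att_in_A nx_less seg_not_A card_A_s by auto
qed

end

section \<open>Longest paths and Hamilton cycles inside the component\<close>

context cycle_component
begin

lemma crossing_edge:
  assumes "linked X u w" "u \<in> S" "w \<notin> S"
  shows "\<exists>a\<in>S \<inter> X. \<exists>b\<in>X - S. E a b"
proof -
  obtain P where "path_in X P" "hd P = u" "last P = w" using assms by (auto simp: linked_def)
  then show ?thesis using assms(2,3)
  proof (induction P arbitrary: u)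
    case Nil then show ?case by (simp add: path_in_def)
  next
    case (Cons v P)
    show ?case
    proof (cases "P = []")
      case True then show ?thesis using Cons.prems by auto
    next
      case False
      then have P: "path_in X P" "last P = w" "E v (hd P)" "v \<in> X"
        using Cons.prems by (auto simp: path_in_def successively_Cons)
      show ?thesis
      proof (cases "hd P \<in> S")
        case True then show ?thesis using Cons.IH P Cons.prems by blast
      next
        case False
        moreover have "hd P \<in> X" using P \<open>P \<noteq> []\<close> by (auto simp: path_in_def)
        moreover have "v \<in> S" using Cons.prems by simp
        ultimately show ?thesis using P by blast
      qed
    qed
  qed
qed

lemma longest_path:
  obtains P where "path_in H P" "\<And>Q. path_in H Q \<Longrightarrow> length Q \<le> length P"
proof -
  obtain y where "y \<in> H" using card_H by fastforce
  then have "path_in H [y]" by (simp add: path_in_def)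
  moreover have "\<forall>Q. path_in H Q \<longrightarrow> length Q \<le> card H"
    using finite_H by (metis card_mono distinct_card path_in_def)
  ultimately have "\<exists>P. path_in H P \<and> (\<forall>Q. path_in H Q \<longrightarrow> length Q \<le> length P)"
    using ex_has_greatest_nat[of "path_in H" "[y]" length "Suc (card H)"] by (auto simp: less_Suc_eq_le)
  then show ?thesis using that by blast
qed

lemma path_extend:
  assumes "path_in H P" "z \<in> H - set P" "E (last P) z"
  shows "path_in H (P @ [z])"
  using assms by (auto simp: path_in_def successively_append_iff)

definition hamiltonian_in :: "'a list \<Rightarrow> bool" where
  "hamiltonian_in Y \<longleftrightarrow> path_in H Y \<and> set Y = H \<and> E (last Y) (hd Y)"

text \<open>If the closed path missed a vertex, connectedness of H would give an edge leaving it;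
  opening the cycle at the end of that edge yields a longer path.\<close>

lemma closed_longest_path:
  assumes "path_in H Y" "E (last Y) (hd Y)" and max: "\<And>Q. path_in H Q \<Longrightarrow> length Q \<le> length Y"
  shows "hamiltonian_in Y"
proof -
  have "set Y = H"
  proof (rule ccontr)
    assume "set Y \<noteq> H"
    moreover have sub: "set Y \<subseteq> H" "Y \<noteq> []" using assms by (auto simp: path_in_def)
    ultimately obtain w where "w \<in> H" "w \<notin> set Y" by blast
    then obtain v z where vz: "v \<in> set Y" "z \<in> H - set Y" "E v z"
      using crossing_edge[of H "hd Y" w "set Y"] H_linked sub by (metis Int_iff hd_in_set subsetD)
    obtain Y1 Y2 where Y: "Y = Y1 @ v # Y2" using vz(1) by (meson split_list)
    have "path_in H (Y2 @ Y1 @ [v])"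
      using assms(1,2) by (auto simp: Y path_in_def successively_append_iff successively_Cons hd_append split: if_splits)
    moreover have "z \<in> H - set (Y2 @ Y1 @ [v])" using vz Y by auto
    ultimately have "path_in H ((Y2 @ Y1 @ [v]) @ [z])" using path_extend vz by fastforce
    from max[OF this] show False using Y by simp
  qed
  then show ?thesis using assms by (simp add: hamiltonian_in_def)
qed

text \<open>The usual rotation argument at the two ends of a longest path.\<close>

lemma hamiltonian_or_few_neighbours:
  assumes "3 \<le> card H"
  obtains Y where "hamiltonian_in Y"
  | P where "path_in H P" "3 \<le> length P" "\<not> E (hd P) (last P)"
      "card {z \<in> H. E (hd P) z} + card {z \<in> H. E (last P) z} < length P"
proof -
  obtain P where P: "path_in H P" and max: "\<And>Q. path_in H Q \<Longrightarrow> length Q \<le> length P"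
    using longest_path by blast
  have ne: "P \<noteq> []" and dP: "distinct P" and subP: "set P \<subseteq> H" and sP: "successively E P"
    using P by (auto simp: path_in_def)
  have lastN: "z \<in> set P" if "z \<in> H" "E (last P) z" for z
  proof (rule ccontr)
    assume "z \<notin> set P"
    then have "path_in H (P @ [z])" using path_extend P that by blast
    from max[OF this] show False by simp
  qed
  have hdN: "z \<in> set P" if "z \<in> H" "E (hd P) z" for z
  proof (rule ccontr)
    assume "z \<notin> set P"
    then have "path_in H (rev P @ [z])" using path_extend[of "rev P" z] path_in_rev P that ne by (simp add: last_rev)
    from max[OF this] show False by simp
  qed
  have len3: "3 \<le> length P"
  proof (rule ccontr)
    assume "\<not> 3 \<le> length P"
    then have l2: "length P \<le> 2" by simp
    have "card (set P) < card H" using assms l2 dP by (simp add: distinct_card)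
    then obtain w where "w \<in> H" "w \<notin> set P" using subP finite_H by (metis nat_less_le subsetI subset_antisym)
    then obtain v z where vz: "v \<in> set P" "z \<in> H - set P" "E v z"
      using crossing_edge[of H "hd P" w "set P"] H_linked subP ne by (metis Int_iff hd_in_set subsetD)
    \<comment> \<open>A path of at most two vertices consists of ends, and no edge leads from an end
      to a new vertex of H.\<close>
    have "v = hd P \<or> v = last P"
    proof (cases P)
      case (Cons a P') then show ?thesis using l2 vz(1) by (cases P') auto
    qed (use ne in simp)
    then show False using lastN hdN vz by blast
  qed
  show ?thesis
  proof (cases "\<exists>t. Suc t < length P \<and> E (hd P) (P ! Suc t) \<and> E (last P) (P ! t)")
    case True
    then obtain t where t: "Suc t < length P" "E (hd P) (P ! Suc t)" "E (last P) (P ! t)" by blast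
    define P1 where "P1 = take (Suc t) P"
    define P2 where "P2 = drop (Suc t) P"
    have PP: "P = P1 @ P2" by (simp add: P1_def P2_def)
    have ne12: "P1 \<noteq> []" "P2 \<noteq> []" using ne t by (auto simp: P1_def P2_def)
    have e: "E (hd P) (hd P2)" "E (last P) (last P1)"
      using t by (auto simp: P1_def P2_def hd_drop_conv_nth take_Suc_conv_app_nth)
    then have "path_in H (P1 @ rev P2)" "E (last (P1 @ rev P2)) (hd (P1 @ rev P2))"
      using P ne12 unfolding PP
      by (auto simp: path_in_def successively_append_iff hd_rev last_rev E_comm)
    moreover have "length Q \<le> length (P1 @ rev P2)" if "path_in H Q" for Q
      using max[OF that] PP by simp
    ultimately show ?thesis using closed_longest_path that(1) by blast
  next
    case False
    show ?thesis
    proof (cases "E (hd P) (last P)")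
      case True
      then show ?thesis using closed_longest_path[of P] P max that(1) E_comm by blast
    next
      case nadj: False
      have idx: "card {z \<in> H. E x z} = card {i. i < length P \<and> E x (P ! i)}" if "\<And>z. z \<in> H \<Longrightarrow> E x z \<Longrightarrow> z \<in> set P" for x
      proof -
        have "{z \<in> H. E x z} = {z \<in> set P. E x z}" using that subP by blast
        then show ?thesis using index_count[OF dP] by simp
      qed
      define I where "I = {i. i < length P \<and> E (hd P) (P ! i)}"
      define J where "J = {i. i < length P \<and> E (last P) (P ! i)}"
      have "0 \<notin> I" using irrefl ne by (simp add: I_def hd_conv_nth)
      then have "card I = card ((\<lambda>i. i - 1) ` I)"
        by (intro card_image[symmetric] inj_onI) (metis One_nat_def Suc_pred not_gr_zero)
      moreover have "(\<lambda>i. i - 1) ` I \<inter> J = {}"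
      proof -
        have "i - 1 \<notin> J" if "i \<in> I" for i
          using that \<open>0 \<notin> I\<close> False by (cases i) (auto simp: I_def J_def)
        then show ?thesis by blast
      qed
      moreover have "(\<lambda>i. i - 1) ` I \<union> J \<subseteq> {..<length P - 1}"
      proof -
        have "i < length P - 1" if "i \<in> J" for i
          using that irrefl ne by (cases "i = length P - 1") (auto simp: J_def last_conv_nth)
        moreover have "i - 1 < length P - 1" if "i \<in> I" for i
          using that \<open>0 \<notin> I\<close> by (cases i) (auto simp: I_def)
        ultimately show ?thesis by auto
      qed
      moreover have "finite I" "finite J" by (auto simp: I_def J_def)
      ultimately have "card I + card J \<le> length P - 1"
        by (metis card_Un_disjoint card_lessThan card_mono finite_imageI finite_lessThan)
      then show ?thesis using that(2)[OF P len3 nadj] idx[OF hdN] idx[OF lastN] len3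
        by (simp add: I_def J_def)
    qed
  qed
qed

lemma hamiltonian_rotate:
  assumes "hamiltonian_in (X @ Y)" shows "hamiltonian_in (Y @ X)"
  using assms
  by (cases "X = []"; cases "Y = []")
     (auto simp: hamiltonian_in_def path_in_def successively_append_iff)

lemma hamiltonian_length: "hamiltonian_in Y \<Longrightarrow> length Y = card H"
  by (auto simp: hamiltonian_in_def path_in_def distinct_card[symmetric])

lemma hamiltonian_joined_all:
  assumes "hamiltonian_in Y" "E a (hd Y)" "E b (last Y)"
  shows "joined (card H) a b"
  unfolding joined_def using assms hamiltonian_length[OF assms(1)]
  by (intro exI[of _ Y]) (auto simp: hamiltonian_in_def E_comm)

text \<open>The two arcs of the Hamilton cycle between \<open>x\<close> and \<open>y\<close> have
  |H| + 2 vertices together, and the longer one is taken.\<close>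

lemma hamiltonian_joined:
  assumes "hamiltonian_in Y" "x \<in> H" "y \<in> H" "x \<noteq> y" "E a x" "E b y"
  shows "\<exists>p. card H + 2 \<le> 2 * p \<and> joined p a b"
proof -
  obtain Y1 Y2 where "Y = Y1 @ x # Y2" using assms by (metis hamiltonian_in_def split_list)
  then have r: "hamiltonian_in ((x # Y2) @ Y1)" using assms(1) hamiltonian_rotate by blast
  then have "y \<in> set (Y2 @ Y1)" using assms by (auto simp: hamiltonian_in_def)
  then obtain Z1 Z2 where "Y2 @ Y1 = Z1 @ y # Z2" by (meson split_list)
  then have Z: "hamiltonian_in (x # Z1 @ y # Z2)" using r by simp
  then have len: "length Z1 + length Z2 + 2 = card H" using hamiltonian_length by fastforce
  have p1: "path_in H (x # Z1 @ [y])"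
    using Z by (auto simp: hamiltonian_in_def path_in_def successively_append_iff successively_Cons hd_append)
  then have j1: "joined (length Z1 + 2) a b" unfolding joined_def
    using assms by (intro exI[of _ "x # Z1 @ [y]"]) (auto simp: E_comm)
  have "hamiltonian_in ((y # Z2) @ (x # Z1))" using hamiltonian_rotate[of "x # Z1" "y # Z2"] Z by simp
  then have "path_in H (y # Z2 @ [x])"
    by (auto simp: hamiltonian_in_def path_in_def successively_append_iff successively_Cons hd_append split: if_splits)
  then have "joined (length Z2 + 2) b a" unfolding joined_def
    using assms by (intro exI[of _ "y # Z2 @ [x]"]) (auto simp: E_comm)
  then have j2: "joined (length Z2 + 2) a b" by (rule joined_sym)
  show ?thesis
  proof (cases "length Z1 \<le> length Z2")
    case True then show ?thesis using j2 len by (intro exI[of _ "length Z2 + 2"]) simp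
  next
    case False then show ?thesis using j1 len by (intro exI[of _ "length Z1 + 2"]) simp
  qed
qed

end

section \<open>Missing adjacencies between the component and its attachment vertices\<close>

context segmented
begin

definition good :: "nat \<Rightarrow> nat \<Rightarrow> bool" where
  "good i j \<longleftrightarrow> (\<exists>x\<in>H. \<exists>y\<in>H. x \<noteq> y \<and> E (att i) x \<and> E (att j) y)"

definition missing :: "'a \<Rightarrow> nat set" where
  "missing y = {i. i < s \<and> \<not> E (att i) y}"

lemma finite_missing: "finite (missing y)" by (simp add: missing_def)

lemma missing_sub: "missing y \<subseteq> {..<s}" by (auto simp: missing_def)

lemma att_neighbour: "i < s \<Longrightarrow> \<exists>y\<in>H. E (att i) y"
  using att_in_A by (auto simp: A_def)

text \<open>Two nonempty neighbour sets without distinct representatives are one and the same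
  singleton.\<close>

lemma not_good:
  assumes "i < s" "j < s" "\<not> good i j"
  obtains z where "z \<in> H" "E (att i) z" "E (att j) z"
    "\<And>y. y \<in> H \<Longrightarrow> y \<noteq> z \<Longrightarrow> i \<in> missing y \<and> j \<in> missing y"
proof -
  obtain x y where x: "x \<in> H" "E (att i) x" and y: "y \<in> H" "E (att j) y"
    using att_neighbour assms by blast
  have no: "\<And>v w. v \<in> H \<Longrightarrow> w \<in> H \<Longrightarrow> E (att i) v \<Longrightarrow> E (att j) w \<Longrightarrow> v = w"
    using assms(3) unfolding good_def by blast
  have "x = y" using no x y by simp
  then have "E (att j) x" using y by simp
  moreover have "w \<notin> H \<or> \<not> E (att i) w \<and> \<not> E (att j) w" if "w \<noteq> x" for w
    using that no[of w y] no[of x w] x y \<open>x = y\<close> by auto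
  ultimately show ?thesis using that[of x] x assms by (auto simp: missing_def)
qed

lemma good_joined: "good i j \<Longrightarrow> joined 2 (att i) (att j)"
  unfolding good_def using joined_2 by blast

lemma good_sym: "good i j \<Longrightarrow> good j i"
  unfolding good_def by metis

text \<open>All neighbours of \<open>y\<close> lie in \<open>A\<close> or in \<open>H - {y}\<close>,
  which offer s + |H| - 1 candidates.\<close>

lemma degree_H:
  assumes "y \<in> H"
  shows "card {w. E y w} + card (missing y) + card {z \<in> H. z \<noteq> y \<and> \<not> E y z} = s + card H - 1"
proof -
  have "{w. E y w} = {w \<in> A. E y w} \<union> {z \<in> H. E y z}"
    unfolding A_def using assms H_closed sym by blast
  moreover have "{w \<in> A. E y w} \<inter> {z \<in> H. E y z} = {}" using A_sub H_sub by auto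
  moreover have "finite {w \<in> A. E y w}" "finite {z \<in> H. E y z}" using finite_A finite_H by auto
  ultimately have 1: "card {w. E y w} = card {w \<in> A. E y w} + card {z \<in> H. E y z}"
    by (simp only: card_Un_disjoint)
  have "{w \<in> A. E y w} = att ` ({..<s} - missing y)"
    by (auto simp: A_eq missing_def E_comm)
  then have "card {w \<in> A. E y w} = card ({..<s} - missing y)"
    using inj_att by (metis (no_types, lifting) Diff_subset card_image inj_on_subset)
  then have 2: "card {w \<in> A. E y w} + card (missing y) = s"
    using card_mono[OF _ missing_sub, of y] missing_sub
    by (simp add: card_Diff_subset finite_missing)
  have "H - {y} = {z \<in> H. E y z} \<union> {z \<in> H. z \<noteq> y \<and> \<not> E y z}" using irrefl by auto
  moreover have "{z \<in> H. E y z} \<inter> {z \<in> H. z \<noteq> y \<and> \<not> E y z} = {}" by auto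
  moreover have "finite {z \<in> H. E y z}" "finite {z \<in> H. z \<noteq> y \<and> \<not> E y z}" using finite_H by auto
  ultimately have "card (H - {y}) = card {z \<in> H. E y z} + card {z \<in> H. z \<noteq> y \<and> \<not> E y z}"
    by (simp only: card_Un_disjoint)
  then show ?thesis using 1 2 assms card_H finite_H by simp
qed

text \<open>The slack s + |H| - 1 - \<delta> is all that a vertex of H may miss.\<close>

lemma miss_le:
  assumes "y \<in> H"
  shows "\<delta> + card (missing y) + card {z \<in> H. z \<noteq> y \<and> \<not> E y z} \<le> s + card H - 1"
  using degree_H[OF assms] degree_ge[of y] assms H_sub by auto

text \<open>A nonempty proper subset of the cyclic order is left by \<open>nx\<close> at least
  once.\<close>

lemma card_shift_le:
  assumes "T \<subseteq> {..<s}" "T \<noteq> {..<s}"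
  shows "card {i \<in> T. nx i \<in> T} \<le> card T - 1"
proof (cases "T = {}")
  case False
  then obtain i where "i \<in> T" "nx i \<notin> T" using nx_exit assms by blast
  then have "{i \<in> T. nx i \<in> T} \<subseteq> T - {i}" by auto
  then have "card {i \<in> T. nx i \<in> T} \<le> card (T - {i})"
    using assms finite_subset by (intro card_mono) auto
  then show ?thesis using \<open>i \<in> T\<close> by simp
qed simp

text \<open>These are the segments for which only one vertex is guaranteed instead of two.\<close>

definition nbad :: nat where "nbad = card {i. i < s \<and> \<not> good i (nx i)}"

text \<open>The ends of such a segment share their only neighbour in H. One of \<open>x\<close>,
  \<open>y\<close> is a different vertex and is missed by both ends, so the segment joins two
  consecutive members of \<open>missing x\<close> or of \<open>missing y\<close>.\<close>

lemma nbad_le: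
  assumes "x \<in> H" "y \<in> H" "x \<noteq> y" "missing x \<noteq> {..<s}" "missing y \<noteq> {..<s}"
  shows "nbad \<le> (card (missing x) - 1) + (card (missing y) - 1)"
proof -
  have "{i. i < s \<and> \<not> good i (nx i)} \<subseteq>
    {i \<in> missing x. nx i \<in> missing x} \<union> {i \<in> missing y. nx i \<in> missing y}"
  proof
    fix i assume i: "i \<in> {i. i < s \<and> \<not> good i (nx i)}"
    then obtain z where "z \<in> H" "\<And>y. y \<in> H \<Longrightarrow> y \<noteq> z \<Longrightarrow> i \<in> missing y \<and> nx i \<in> missing y"
      using not_good[of i "nx i"] nx_less by blast
    then show "i \<in> {i \<in> missing x. nx i \<in> missing x} \<union> {i \<in> missing y. nx i \<in> missing y}"
      using assms by blast
  qed
  then have "nbad \<le> card ({i \<in> missing x. nx i \<in> missing x} \<union> {i \<in> missing y. nx i \<in> missing y})"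
    unfolding nbad_def by (intro card_mono) (auto simp: finite_missing)
  also have "\<dots> \<le> card {i \<in> missing x. nx i \<in> missing x} + card {i \<in> missing y. nx i \<in> missing y}"
    by (rule card_Un_le)
  finally show ?thesis using card_shift_le[OF missing_sub] assms by (meson add_mono order_trans)
qed

lemma seg_nonempty: "i < s \<Longrightarrow> 1 \<le> length (seg i)"
  using seg_ge[of i 1] joined_1 att_in_A nx_less by blast

lemma seg_ge_2: "i < s \<Longrightarrow> good i (nx i) \<Longrightarrow> 2 \<le> length (seg i)"
  using seg_ge good_joined by blast

text \<open>The ends \<open>x\<close>, \<open>y\<close> of a path in \<open>H\<close> force a long segment between two attachment vertices
  unless both orientations are blocked, and this uses up two non-adjacencies.\<close>

lemma segment_sum:
  assumes P: "path_in H P" "hd P = x" "last P = y" and m: "length P = m" "2 \<le> m"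
  obtains F where "F \<le> s" "F \<le> card (missing x) + card (missing y)"
    "m * s \<le> (\<Sum>i<s. length (seg i)) + nbad + (m - 2) * F"
proof -
  define fails where "fails = (\<lambda>i. \<not> (E (att i) x \<and> E (att (nx i)) y) \<and> \<not> (E (att i) y \<and> E (att (nx i)) x))"
  define F where "F = card {i. i < s \<and> fails i}"
  have ind: "(\<Sum>i<s. of_bool (Q i)) = card {i. i < s \<and> Q i}" for Q :: "nat \<Rightarrow> bool"
    by (simp add: lessThan_def Int_def)
  define ms where "ms = (\<lambda>i. of_bool (i \<in> missing x) + of_bool (i \<in> missing y) :: nat)"
  have "F \<le> card {..<s}" unfolding F_def by (intro card_mono) auto
  then have "F \<le> s" by simp
  moreover have "F \<le> card (missing x) + card (missing y)"
  proof -
    \<comment> \<open>A blocked segment lacks an adjacency in each orientation, and these two are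
      different. Each missing adjacency is seen from both segments at its attachment vertex, hence
      the factor 2 on either side.\<close>
    have "2 * F = (\<Sum>i<s. 2 * of_bool (fails i))" unfolding F_def by (simp only: ind sum_distrib_left[symmetric])
    also have "\<dots> \<le> (\<Sum>i<s. ms i + ms (nx i))"
      using nx_less by (intro sum_mono) (auto simp: ms_def fails_def missing_def)
    also have "\<dots> = 2 * (\<Sum>i<s. ms i)" by (simp add: sum.distrib sum_nx)
    also have "(\<Sum>i<s. ms i) = card (missing x) + card (missing y)"
    proof -
      have "{i. i < s \<and> i \<in> missing v} = missing v" for v by (auto simp: missing_def)
      then show ?thesis unfolding ms_def sum.distrib by (simp only: ind)
    qed
    finally show ?thesis by simp
  qed
  moreover have "m * s \<le> (\<Sum>i<s. length (seg i)) + nbad + (m - 2) * F"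
  proof -
    have "m * s = (\<Sum>i<s. m)" by simp
    also have "\<dots> \<le> (\<Sum>i<s. length (seg i) + of_bool (\<not> good i (nx i)) + (m - 2) * of_bool (fails i))"
    proof (intro sum_mono)
      fix i assume "i \<in> {..<s}"
      then have i: "i < s" by simp
      \<comment> \<open>A blocked segment still has two vertices, or one if its ends are not good;
        this explains \<open>m - 2\<close> and the middle term.\<close>
      show "m \<le> length (seg i) + of_bool (\<not> good i (nx i)) + (m - 2) * of_bool (fails i)"
      proof (cases "fails i")
        case True
        then show ?thesis using seg_nonempty[OF i] seg_ge_2[OF i] m by (cases "good i (nx i)") auto
      next
        case False
        then have "joined m (att i) (att (nx i)) \<or> joined m (att (nx i)) (att i)"
          using P m unfolding fails_def joined_def by (auto simp: E_comm)
        then have "m \<le> length (seg i)" using seg_ge[OF i] joined_sym by blast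
        then show ?thesis by simp
      qed
    qed
    also have "\<dots> = (\<Sum>i<s. length (seg i)) + nbad + (m - 2) * F"
      unfolding sum.distrib nbad_def F_def by (simp only: ind sum_distrib_left[symmetric])
    finally show ?thesis .
  qed
  ultimately show ?thesis using that by blast
qed

end

text \<open>\<open>a\<close>, \<open>b\<close> stand for the non-neighbours within H of the two ends
  of a path with \<open>k + 2\<close> vertices, \<open>tx\<close>, \<open>ty\<close> for the
  attachment vertices that these ends miss, \<open>F\<close> and \<open>g\<close> for the blocked
  and the other segments, and \<open>c\<close> for \<open>nbad\<close>.\<close>

lemma few_neighbours_arith:
  fixes h \<delta> s k g F a b tx ty c :: nat
  assumes deg: "2 * h \<le> a + b + k + 3" "\<delta> + tx + a + 1 \<le> s + h" "\<delta> + ty + b + 1 \<le> s + h"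
    and "s + h \<le> \<delta> + 4" "k + 2 \<le> h" "1 \<le> a" "1 \<le> b" "s = F + g" "F \<le> tx + ty" "3 \<le> s" "1 \<le> k"
    and c: "c \<le> (tx - 1) + (ty - 1)" and sum: "k * g + 3 * s + h \<le> 3 * \<delta> + 2 + c"
  shows False
proof -
  define q where "q = k * g"
  \<comment> \<open>Doubling \<open>sum\<close> and adding three times both degree bounds cancels
    \<open>\<delta>\<close> and \<open>s\<close>; then \<open>h\<close> is eliminated through the
    first bound and \<open>k + 2 \<le> h\<close>.\<close>
  have main: "2 * q + 3 * tx + 3 * ty \<le> k + 3 + 2 * c" using deg sum[folded q_def] assms(5) by linarith
  show False
  proof (cases "tx + ty = 0")
    case True
    then have "3 \<le> g" "c = 0" using assms by auto
    then have "k * 3 \<le> q" by (simp add: q_def)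
    then show False using main \<open>c = 0\<close> \<open>1 \<le> k\<close> by linarith
  next
    case False
    then have c1: "c + 1 \<le> tx + ty" using c by linarith
    show False
    proof (cases "g = 0")
      case True
      have M: "3 \<le> tx + ty" "tx + ty + k \<le> 5" "tx \<le> 2" "ty \<le> 2" using assms True by linarith+
      then have "c + 2 \<le> tx + ty" using c by linarith
      then show False using main M \<open>c + 2 \<le> tx + ty\<close> by linarith
    next
      case False
      then have "k \<le> q" by (simp add: q_def)
      then show False using main c1 \<open>1 \<le> k\<close> \<open>tx + ty \<noteq> 0\<close> by linarith
    qed
  qed
qed

section \<open>Components are complete and completely attached\<close>

context segmented
begin

text \<open>\<open>S\<close> may mix attachment vertices with vertices of H, so a neighbour shared
  by several attachment vertices can serve as a cut vertex.\<close>

lemma H_separator: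
  assumes "S \<subseteq> V" "H - S \<noteq> {}" "set C - S \<noteq> {}" "\<And>v y. v \<in> A - S \<Longrightarrow> y \<in> H - S \<Longrightarrow> \<not> E v y"
  shows "3 \<le> card S"
proof (rule separator_card[OF assms(1), of "H - S"])
  show "H - S \<subseteq> V - S" using H_sub by blast
  show "H - S \<noteq> {}" by fact
  show "V - S - (H - S) \<noteq> {}" using assms(3) H_sub set_C_sub by blast
  show "\<not> E x y" if "x \<in> H - S" "y \<in> V - S - (H - S)" for x y
  proof
    assume "E x y"
    then have "E y x" by (rule sym)
    moreover have "y \<in> set C" using H_closed[OF _ \<open>E x y\<close>] that by blast
    ultimately have "y \<in> A - S" using that by (auto simp: A_def)
    then show False using assms(4) that \<open>E y x\<close> by blast
  qed
qed

text \<open>If no consecutive pair were good, a single common neighbour would be handed on from each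
  attachment vertex to the next, and this one vertex would cut the rest of H off from the
  cycle.\<close>

lemma ex_good_successor: "\<exists>m<s. good m (nx m)"
proof (rule ccontr)
  assume "\<not> (\<exists>m<s. good m (nx m))"
  then have bad: "\<not> good m (nx m)" if "m < s" for m using that by blast
  have "0 < s" using s_ge by simp
  then obtain z where z: "z \<in> H" "\<And>y. y \<in> H \<Longrightarrow> y \<noteq> z \<Longrightarrow> 0 \<in> missing y"
    using not_good[of 0 "nx 0"] bad nx_less by metis
  define T where "T = {i. i < s \<and> (\<forall>y\<in>H. y \<noteq> z \<longrightarrow> i \<in> missing y)}"
  have "0 \<in> T" using z \<open>0 < s\<close> by (simp add: T_def)
  have "T = {..<s}"
  proof (rule ccontr)
    assume "T \<noteq> {..<s}"
    then obtain i where i: "i \<in> T" "nx i \<notin> T"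
      using nx_exit[of T] \<open>0 \<in> T\<close> by (auto simp: T_def)
    then obtain z' where z': "z' \<in> H" "E (att i) z'"
      "\<And>y. y \<in> H \<Longrightarrow> y \<noteq> z' \<Longrightarrow> nx i \<in> missing y"
      using not_good[of i "nx i"] bad nx_less unfolding T_def by (metis (no_types, lifting) mem_Collect_eq)
    then have "z' = z" using i(1) by (auto simp: T_def missing_def)
    then show False using i z' nx_less by (auto simp: T_def)
  qed
  have "3 \<le> card {z}"
  proof (rule H_separator)
    show "{z} \<subseteq> V" using z H_sub by blast
    show "H - {z} \<noteq> {}" using card_H card_mono[of "{z}" H] by fastforce
    show "set C - {z} \<noteq> {}" using A_not_all z H_sub by blast
    show "\<not> E v y" if "v \<in> A - {z}" "y \<in> H - {z}" for v y
      using that \<open>T = {..<s}\<close> by (auto simp: A_eq T_def missing_def)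
  qed
  then show False by simp
qed

text \<open>Start from a good pair \<open>m\<close>, \<open>nx m\<close>. An attachment vertex that
  is not good with one of them has the same single neighbour in H. If this held for all others, two
  vertices would separate H from the cycle: for each of \<open>m\<close>, \<open>nx m\<close> its
  only neighbour in H or, if it has several, the attachment vertex itself. This choice is
  \<open>rep\<close>.\<close>

lemma ex_good_triple:
  assumes "3 \<le> card H"
  shows "\<exists>m j. m < s \<and> j < s \<and> j \<noteq> m \<and> j \<noteq> nx m \<and> good m (nx m) \<and> good m j \<and> good j (nx m)"
proof -
  obtain m where m: "m < s" "good m (nx m)" using ex_good_successor by blast
  define rep where "rep = (\<lambda>i. if \<exists>z. {y \<in> H. E (att i) y} = {z} then THE z. {y \<in> H. E (att i) y} = {z} else att i)"
  have rep: "rep i = z" if "{y \<in> H. E (att i) y} = {z}" for i z using that by (auto simp: rep_def)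
  have rep_cases: "rep i = att i \<or> (rep i \<in> H \<and> {y \<in> H. E (att i) y} = {rep i})" for i
  proof (cases "\<exists>z. {y \<in> H. E (att i) y} = {z}")
    case True
    then obtain z where "{y \<in> H. E (att i) y} = {z}" by blast
    then show ?thesis using rep by blast
  qed (simp add: rep_def)
  show ?thesis
  proof (rule ccontr)
    assume no: "\<not> ?thesis"
    define S where "S = {rep m, rep (nx m)}"
    have S2: "card S \<le> 2" "finite S" by (auto simp: S_def card_insert_if)
    have "3 \<le> card S"
    proof (rule H_separator)
      have "att m \<in> V" "att (nx m) \<in> V" using att_in_A m nx_less A_sub set_C_sub by blast+
      then show "S \<subseteq> V" using rep_cases[of m] rep_cases[of "nx m"] H_sub by (auto simp: S_def)
      have big: "B - S \<noteq> {}" if "3 \<le> card B" for B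
        using that S2 card_mono[of S B] by fastforce
      show "H - S \<noteq> {}" using assms by (rule big)
      have "card A \<le> card (set C)" using A_sub by (intro card_mono) auto
      then show "set C - S \<noteq> {}" using card_A by (intro big) simp
      fix v y assume v: "v \<in> A - S" and y: "y \<in> H - S"
      obtain j where j: "j < s" "v = att j" using v by (auto simp: A_eq)
      show "\<not> E v y"
      proof
        assume "E v y"
        have sole: "{y \<in> H. E (att i) y} = {rep i}" if ng: "\<not> good i j" "i < s" for i
        proof -
          obtain z where "z \<in> H" "E (att i) z" "\<And>y. y \<in> H \<Longrightarrow> y \<noteq> z \<Longrightarrow> i \<in> missing y"
            using not_good[OF ng(2) j(1) ng(1)] by metis
          then have "{y \<in> H. E (att i) y} = {z}" by (auto simp: missing_def)
          then show ?thesis using rep by simp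
        qed
        have sole': "y = rep i" if ng: "\<not> good i j" "i < s" for i
        proof -
          obtain z where "z \<in> H" "E (att i) z" "\<And>y. y \<in> H \<Longrightarrow> y \<noteq> z \<Longrightarrow> j \<in> missing y"
            using not_good[OF ng(2) j(1) ng(1)] by metis
          then show ?thesis using \<open>E v y\<close> y j sole[OF ng] by (auto simp: missing_def)
        qed
        consider "j = m" | "j = nx m" | "\<not> good m j" | "\<not> good (nx m) j"
          using no m j good_sym by blast
        then show False
        proof cases
          case 1 then show ?thesis using rep_cases[of m] v y j \<open>E v y\<close> by (auto simp: S_def)
        next
          case 2 then show ?thesis using rep_cases[of "nx m"] v y j \<open>E v y\<close> by (auto simp: S_def)
        next
          case 3 then show ?thesis using sole'[of m] m y by (simp add: S_def)
        next
          case 4 then show ?thesis using sole'[of "nx m"] nx_less y by (simp add: S_def)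
        qed
      qed
    qed
    then show False using S2 by simp
  qed
qed

lemma delta_le: "\<delta> + 1 \<le> s + card H"
proof -
  obtain y where "y \<in> H" using card_H by fastforce
  from miss_le[OF this] show ?thesis using card_H by simp
qed

lemma excess_bound:
  assumes "3 \<le> card H"
  shows "s + card H + 2 \<le> \<delta> + 6"
proof -
  obtain m j where "m < s" "j < s" "j \<noteq> m" "j \<noteq> nx m" "good m (nx m)" "good m j" "good j (nx m)"
    using ex_good_triple[OF assms] by blast
  then show ?thesis using triple_bound[of m j 2] good_joined by simp
qed

text \<open>The arc from \<open>hamiltonian_joined\<close> has at least (|H| + 2) / 2 vertices; as
  its length is an integer, p up to (|H| + 3) / 2 is allowed.\<close>

lemma excess_bound_hamiltonian:
  assumes "3 \<le> card H" "hamiltonian_in Y" "2 * p \<le> card H + 3" "2 \<le> p"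
  shows "s + card H + p \<le> \<delta> + 6"
proof -
  obtain m j where *: "m < s" "j < s" "j \<noteq> m" "j \<noteq> nx m" "good m (nx m)" "good m j" "good j (nx m)"
    using ex_good_triple[OF assms(1)] by blast
  have "joined p (att i) (att k)" if ik: "good i k" for i k
  proof -
    obtain q where "card H + 2 \<le> 2 * q" "joined q (att i) (att k)"
      using ik hamiltonian_joined[OF assms(2)] unfolding good_def by blast
    then show ?thesis using assms(3) joined_mono[of q _ _ p] by simp
  qed
  then show ?thesis using triple_bound[of m j p] * assms(4) good_joined by blast
qed

text \<open>Few neighbours in H use up slack at both ends of \<open>P\<close>, so these ends miss
  few attachment vertices; the segments that are not blocked have at least |P| vertices, and the
  order is exceeded.\<close>

lemma not_hamiltonian_False:
  assumes P: "path_in H P" and m: "3 \<le> length P" and nadj: "\<not> E (hd P) (last P)"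
    and few: "card {z \<in> H. E (hd P) z} + card {z \<in> H. E (last P) z} < length P"
  shows False
proof -
  define x where "x = hd P"
  define y where "y = last P"
  define m where "m = length P"
  have xy: "x \<in> H" "y \<in> H" "x \<noteq> y"
  proof -
    show "x \<in> H" "y \<in> H" using P by (auto simp: path_in_def x_def y_def)
    show "x \<noteq> y" using P assms(2) by (cases P) (auto simp: path_in_def x_def y_def)
  qed
  have mh: "m \<le> card H" using P finite_H by (metis card_mono distinct_card m_def path_in_def)
  have part: "card {z \<in> H. z \<noteq> v \<and> \<not> E v z} + card {z \<in> H. E v z} + 1 = card H" if "v \<in> H" for v
  proof -
    have "H = insert v ({z \<in> H. z \<noteq> v \<and> \<not> E v z} \<union> {z \<in> H. E v z})" using that by auto
    moreover have "v \<notin> {z \<in> H. z \<noteq> v \<and> \<not> E v z} \<union> {z \<in> H. E v z}" using irrefl by auto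
    moreover have "{z \<in> H. z \<noteq> v \<and> \<not> E v z} \<inter> {z \<in> H. E v z} = {}" by auto
    ultimately show ?thesis using finite_H
      by (metis (no_types, lifting) Suc_eq_plus1 card_Un_disjoint card_insert_disjoint finite_Un finite_insert)
  qed
  define tx where "tx = card (missing x)"
  define ty where "ty = card (missing y)"
  define nx' where "nx' = card {z \<in> H. z \<noteq> x \<and> \<not> E x z}"
  define ny' where "ny' = card {z \<in> H. z \<noteq> y \<and> \<not> E y z}"
  have pos: "1 \<le> nx'" "1 \<le> ny'"
  proof -
    have "y \<in> {z \<in> H. z \<noteq> x \<and> \<not> E x z}" using xy nadj by (auto simp: x_def y_def)
    then show "1 \<le> nx'" unfolding nx'_def using finite_H
      by (metis (no_types, lifting) Suc_leI card_gt_0_iff One_nat_def empty_iff finite_Collect_conjI finite_subset mem_Collect_eq subsetI)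
    have "x \<in> {z \<in> H. z \<noteq> y \<and> \<not> E y z}" using xy nadj E_comm by (auto simp: x_def y_def)
    then show "1 \<le> ny'" unfolding ny'_def using finite_H
      by (metis (no_types, lifting) Suc_leI card_gt_0_iff One_nat_def empty_iff finite_Collect_conjI finite_subset mem_Collect_eq subsetI)
  qed
  have few': "2 * card H \<le> nx' + ny' + m + 1"
    using few part[OF xy(1)] part[OF xy(2)] by (simp add: nx'_def ny'_def x_def y_def m_def)
  have dx: "\<delta> + tx + nx' + 1 \<le> s + card H" "\<delta> + ty + ny' + 1 \<le> s + card H"
    using miss_le[OF xy(1)] miss_le[OF xy(2)] card_H unfolding tx_def ty_def nx'_def ny'_def by simp_all
  have "3 \<le> card H" using assms(2) mh by (simp add: m_def)
  then have d3: "s + card H + 2 \<le> \<delta> + 6" by (rule excess_bound)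
  have "tx < s" "ty < s" using dx d3 s_ge pos by linarith+
  then have proper: "missing x \<noteq> {..<s}" "missing y \<noteq> {..<s}"
    unfolding tx_def ty_def by (metis card_lessThan less_irrefl)+
  have bad: "nbad \<le> (tx - 1) + (ty - 1)" unfolding tx_def ty_def by (rule nbad_le[OF xy proper])
  obtain F where F: "F \<le> s" "F \<le> tx + ty"
    "m * s \<le> (\<Sum>i<s. length (seg i)) + nbad + (m - 2) * F"
    unfolding tx_def ty_def
    using segment_sum[OF P x_def[symmetric] y_def[symmetric] m_def[symmetric]] assms(2) m_def by auto
  have total: "s + (\<Sum>i<s. length (seg i)) + card H \<le> 3 * \<delta> + 2" using cycle_count by simp
  obtain g where g: "s = F + g" using F(1) le_Suc_ex by blast
  define k where "k = m - 2"
  have k: "m = k + 2" using assms(2) by (simp add: k_def m_def)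
  have "k * g + 3 * s + card H \<le> 3 * \<delta> + 2 + nbad"
    using F(3) total unfolding k g by (simp add: algebra_simps)
  then show False
    using few_neighbours_arith[of "card H" nx' ny' k \<delta> tx s ty F g nbad]
      few' dx d3 mh pos bad F(2) g s_ge m k by (simp add: m_def)
qed

lemma hamiltonian_hd:
  assumes "hamiltonian_in Y" "y \<in> H"
  obtains Y' where "hamiltonian_in (y # Y')"
proof -
  obtain Y1 Y2 where "Y = Y1 @ y # Y2" using assms by (metis hamiltonian_in_def split_list)
  then have "hamiltonian_in ((y # Y2) @ Y1)" using assms(1) hamiltonian_rotate by blast
  then show ?thesis using that by simp
qed

lemma nx_nx_neq: "i < s \<Longrightarrow> nx (nx i) \<noteq> i"
  using s_ge by (cases "Suc i = s"; cases "Suc (Suc i) = s") (auto simp: nx_def)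

text \<open>With slack 1 no vertex of H is missed by both ends of the segment. If no Hamilton path
  of H joined them, adjacency to \<open>att i\<close> would pass along the Hamilton cycle: the
  vertex after a neighbour of \<open>att i\<close> is not adjacent to \<open>att (nx i)\<close>,
  hence adjacent to \<open>att i\<close>. In the end \<open>att (nx i)\<close> would have no
  neighbour in H.\<close>

lemma hamiltonian_segment_ge:
  assumes h: "3 \<le> card H" and Y: "hamiltonian_in Y" and tight: "s + card H = \<delta> + 2" and i: "i < s"
  shows "card H \<le> length (seg i)"
proof (rule ccontr)
  assume "\<not> card H \<le> length (seg i)"
  then have nj: "\<not> joined (card H) (att i) (att (nx i))" using seg_ge i by blast
  then have nj': "\<not> joined (card H) (att (nx i)) (att i)" using joined_sym by blast
  have one: "\<not> (i \<in> missing y \<and> nx i \<in> missing y)" if "y \<in> H" for y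
  proof
    assume "i \<in> missing y \<and> nx i \<in> missing y"
    then have "card {i, nx i} \<le> card (missing y)" using finite_missing by (intro card_mono) auto
    then show False using miss_le[OF that] tight nx_neq[OF i] h by simp
  qed
  obtain y0 where "y0 \<in> H" "E (att i) y0" using att_neighbour[OF i] by blast
  then obtain Y' where Y': "hamiltonian_in (y0 # Y')" using hamiltonian_hd Y by blast
  define Z where "Z = y0 # Y'"
  have Z: "hamiltonian_in Z" and setZ: "set Z = H" using Y' by (auto simp: Z_def hamiltonian_in_def)
  have step: "\<not> E (att (nx i)) (Z ! Suc t)" if "Suc t < length Z" "E (att i) (Z ! t)" for t
  proof
    assume *: "E (att (nx i)) (Z ! Suc t)"
    have "hamiltonian_in (drop (Suc t) Z @ take (Suc t) Z)"
      using hamiltonian_rotate[of "take (Suc t) Z" "drop (Suc t) Z"] Z by simp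
    from hamiltonian_joined_all[OF this, of "att (nx i)" "att i"] show False
      using * that nj' by (simp add: hd_drop_conv_nth take_Suc_conv_app_nth hd_append)
  qed
  have all: "t < length Z \<Longrightarrow> E (att i) (Z ! t)" for t
  proof (induction t)
    case 0 then show ?case using \<open>E (att i) y0\<close> by (simp add: Z_def)
  next
    case (Suc t)
    then have "nx i \<in> missing (Z ! Suc t)" using step[of t] nx_less by (simp add: missing_def)
    moreover have "Z ! Suc t \<in> H" using Suc.prems setZ nth_mem by blast
    ultimately show ?case using one i by (auto simp: missing_def)
  qed
  obtain y where "y \<in> H" "E (att (nx i)) y" using att_neighbour[OF nx_less] by blast
  then obtain t where t: "t < length Z" "E (att (nx i)) (Z ! t)" using setZ by (metis in_set_conv_nth)
  show False
  proof (cases t)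
    case 0
    have "Z \<noteq> []" by (simp add: Z_def)
    moreover from this have "E (att i) (last Z)" using all[of "length Z - 1"] by (simp add: last_conv_nth)
    ultimately show ?thesis using hamiltonian_joined_all[OF Z, of "att (nx i)" "att i"] t 0 nj'
      by (simp add: hd_conv_nth)
  next
    case (Suc t')
    then show ?thesis using step[of t'] all[of t'] t by simp
  qed
qed

text \<open>With slack 2 the bad segment \<open>i\<close> accounts for everything that a vertex of H
  other than \<open>z\<close> may miss, so each further attachment vertex is adjacent to all of H
  except possibly \<open>z\<close>.\<close>

lemma hamiltonian_segment_ge_other:
  assumes h: "3 \<le> card H" and Y: "hamiltonian_in Y" and tight: "s + card H = \<delta> + 3"
    and i: "i < s" "\<not> good i (nx i)" and j: "j < s" "j \<noteq> i"
  shows "card H \<le> length (seg j)"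
proof -
  obtain z where z: "\<And>y. y \<in> H \<Longrightarrow> y \<noteq> z \<Longrightarrow> i \<in> missing y \<and> nx i \<in> missing y"
    using not_good[of i "nx i"] i nx_less by metis
  have adj: "E (att c) y" if "y \<in> H" "y \<noteq> z" "c < s" "c \<noteq> i" "c \<noteq> nx i" for c y
  proof (rule ccontr)
    assume "\<not> E (att c) y"
    then have "{c, i, nx i} \<subseteq> missing y" using z that by (auto simp: missing_def)
    then have "card {c, i, nx i} \<le> card (missing y)" using finite_missing by (intro card_mono) auto
    then show False using miss_le[OF that(1)] tight nx_neq[OF i(1)] that h by simp
  qed
  have full: "joined (card H) (att c) (att d)" if cd: "c < s" "d < s" "c \<noteq> i" "c \<noteq> nx i" for c d
  proof -
    obtain y where y: "y \<in> H" "E (att d) y" using att_neighbour cd by blast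
    then obtain Y' where Y': "hamiltonian_in (y # Y')" using hamiltonian_hd Y by blast
    then have "length Y' + 1 = card H" using hamiltonian_length by fastforce
    then have ne: "Y' \<noteq> []" "2 \<le> length Y'" using h by auto
    have "distinct Y'" "set Y' \<subseteq> H" using Y' by (auto simp: hamiltonian_in_def path_in_def)
    \<comment> \<open>These are the two neighbours of \<open>y\<close> on the Hamilton cycle; at
      least one is not \<open>z\<close>, and the Hamilton path from \<open>y\<close> to it is
      used.\<close>
    then have "hd Y' \<noteq> last Y'" "hd Y' \<in> H" "last Y' \<in> H" using ne by (cases Y'; auto)+
    then consider "last Y' \<noteq> z" "last Y' \<in> H" | "hd Y' \<noteq> z" "hd Y' \<in> H" by metis
    then show ?thesis
    proof cases
      case 1
      then show ?thesis using hamiltonian_joined_all[OF Y', of "att d" "att c"] y adj cd ne joined_sym by simp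
    next
      case 2
      have "hamiltonian_in (Y' @ [y])" using hamiltonian_rotate[of "[y]" Y'] Y' by simp
      then show ?thesis using hamiltonian_joined_all[of "Y' @ [y]" "att c" "att d"] 2 y adj cd ne by simp
    qed
  qed
  have "joined (card H) (att j) (att (nx j))"
  proof (cases "j = nx i")
    case False then show ?thesis using full j nx_less by blast
  next
    case True
    then have "nx j \<noteq> i" "nx j \<noteq> nx i" using nx_nx_neq nx_neq i j by auto
    then show ?thesis using full[of "nx j" j] j nx_less joined_sym by blast
  qed
  then show ?thesis using seg_ge j by blast
qed

text \<open>Counting with p = 3 leaves slack 1 and 2, where the segments become too long. If the
  slack is 2 and all consecutive pairs are good, only three vertices per segment are guaranteed;
  this is enough because counting with p = 4 forces |H| \<le> 4.\<close>

lemma hamiltonian_tight: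
  assumes h: "3 \<le> card H" and Y: "hamiltonian_in Y"
  shows "s + card H = \<delta> + 1"
proof (rule ccontr)
  assume "s + card H \<noteq> \<delta> + 1"
  moreover have "s + card H + 3 \<le> \<delta> + 6" using excess_bound_hamiltonian[OF h Y, of 3] h by simp
  ultimately consider "s + card H = \<delta> + 2" | "s + card H = \<delta> + 3" using delta_le by linarith
  then show False
  proof cases
    case 1
    then have "s * card H \<le> (\<Sum>i<s. length (seg i))"
      using hamiltonian_segment_ge[OF h Y] sum_bounded_below[of "{..<s}" "card H" "\<lambda>i. length (seg i)"] by simp
    then have "s + s * card H + card H \<le> 3 * \<delta> + 2" using cycle_count by linarith
    moreover obtain a b where "s = 3 + a" "card H = 3 + b" using s_ge h le_Suc_ex by metis
    ultimately show False using 1 by (simp add: algebra_simps)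
  next
    case 2
    have h4: "card H \<le> 4"
    proof (rule ccontr)
      assume "\<not> card H \<le> 4"
      then show False using excess_bound_hamiltonian[OF h Y, of 4] 2 by simp
    qed
    show False
    proof (cases "\<exists>i<s. \<not> good i (nx i)")
      case True
      then obtain i where i: "i < s" "\<not> good i (nx i)" by blast
      have "(s - 1) * card H \<le> (\<Sum>j\<in>{..<s} - {i}. length (seg j))"
        using hamiltonian_segment_ge_other[OF h Y 2 i] i
          sum_bounded_below[of "{..<s} - {i}" "card H" "\<lambda>i. length (seg i)"] by simp
      moreover have "(\<Sum>j<s. length (seg j)) = length (seg i) + (\<Sum>j\<in>{..<s} - {i}. length (seg j))"
        using i by (intro sum.remove) auto
      ultimately have "s + 1 + (s - 1) * card H + card H \<le> 3 * \<delta> + 2"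
        using cycle_count seg_nonempty[OF i(1)] by linarith
      moreover obtain a b where "s = 3 + a" "card H = 3 + b" using s_ge h le_Suc_ex by metis
      ultimately show False using 2 by (simp add: algebra_simps)
    next
      case False
      have "3 \<le> length (seg i)" if i: "i < s" for i
      proof -
        have "good i (nx i)" using False i by blast
        then obtain q where "card H + 2 \<le> 2 * q" "joined q (att i) (att (nx i))"
          using hamiltonian_joined[OF Y] unfolding good_def by blast
        then show ?thesis using seg_ge[OF i] h by fastforce
      qed
      then have "3 * s \<le> (\<Sum>i<s. length (seg i))"
        using sum_bounded_below[of "{..<s}" 3 "\<lambda>i. length (seg i)"] by simp
      then have "4 * s + card H \<le> 3 * \<delta> + 2" using cycle_count by linarith
      then show False using 2 h4 s_ge by linarith
    qed
  qed
qed

section \<open>Connections between segments, and toughness in terms of labels on the cycle\<close>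

definition pre :: "nat \<Rightarrow> 'a \<Rightarrow> nat" where
  "pre k v = length (takeWhile (\<lambda>u. u \<noteq> v) (seg k))"

definition post :: "nat \<Rightarrow> 'a \<Rightarrow> nat" where
  "post k v = length (seg k) - 1 - pre k v"

definition link :: "nat \<Rightarrow> 'a \<Rightarrow> 'a \<Rightarrow> bool" where
  "link n v w \<longleftrightarrow> (\<exists>L. successively E (v # L @ [w]) \<and> distinct L \<and> set L \<subseteq> R \<and> length L = n)"

lemma link_0: "link 0 v w \<longleftrightarrow> E v w"
  by (auto simp: link_def)

lemma split_seg:
  assumes "v \<in> set (seg k)"
  obtains X X' where "seg k = X @ v # X'" "pre k v = length X" "post k v = length X'"
proof -
  obtain X X' where *: "seg k = X @ v # X'" "v \<notin> set X" using assms by (meson split_list_first)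
  then have "takeWhile (\<lambda>u. u \<noteq> v) (seg k) = X @ takeWhile (\<lambda>u. u \<noteq> v) (v # X')"
    unfolding *(1) by (intro takeWhile_append2) auto
  then show ?thesis using that * by (simp add: pre_def post_def)
qed

lemma pre_post: "v \<in> set (seg k) \<Longrightarrow> pre k v + post k v + 1 = length (seg k)"
  by (erule split_seg) simp

lemma nth_pre: "v \<in> set (seg k) \<Longrightarrow> seg k ! pre k v = v"
  by (erule split_seg) simp

text \<open>The connection and a detour through H from \<open>att k\<close> to \<open>att l\<close>
  form a cycle that omits only the parts before \<open>v\<close> and \<open>w\<close>. With the next
  attachment vertices, the parts after them are omitted.\<close>

lemma link_le:
  assumes kl: "k < s" "l < s" "k \<noteq> l" and v: "v \<in> set (seg k)" and w: "w \<in> set (seg l)"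
    and L: "link n v w"
    and j: "joined p (att k) (att l)" "joined p (att (nx k)) (att (nx l))"
  shows "p + n \<le> pre k v + pre l w" "p + n \<le> post k v + post l w"
proof -
  obtain X X' where X: "seg k = X @ v # X'" "pre k v = length X" "post k v = length X'" using split_seg v by blast
  obtain Y Y' where Y: "seg l = Y @ w # Y'" "pre l w = length Y" "post l w = length Y'" using split_seg w by blast
  obtain L where L: "successively E (v # L @ [w])" "distinct L" "set L \<subseteq> R" "length L = n"
    using assms by (auto simp: link_def)
  obtain B1 B2 where B: "reordering (att k # seg k @ B1 @ att l # seg l @ B2)"
    "hd (B1 @ [att l]) = att (nx k)" "hd (B2 @ [att k]) = att (nx l)"
    using split_at2[OF kl] .
  have "reordering ([att k] @ (X @ (v # X' @ B1 @ [att l]) @ Y @ (w # Y' @ B2)))"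
    using B X Y by simp
  from reordering_rotate[OF this]
  have "reordering (X @ (v # X' @ B1 @ [att l]) @ Y @ (w # Y' @ B2 @ [att k]))" by simp
  from joined_cross_le[OF this, of p L] show "p + n \<le> pre k v + pre l w"
    using L j X Y by (simp add: joined_sym)
  have "reordering ((att k # X @ [v]) @ (X' @ (B1 @ att l # Y @ [w]) @ Y' @ B2))"
    using B X Y by simp
  from reordering_rotate[OF this]
  have "reordering (X' @ (B1 @ att l # Y @ [w]) @ Y' @ (B2 @ att k # X @ [v]))" by simp
  moreover have "hd (B1 @ att l # Y @ [w]) = att (nx k)" using B(2) by (cases B1) auto
  moreover have "hd (B2 @ att k # X @ [v]) = att (nx l)" using B(3) by (cases B2) auto
  moreover have "successively E (w # rev L @ [v])"
  proof -
    have "successively E (rev (v # L @ [w]))" using L(1) by (simp only: successively_rev successively_flip)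
    then show ?thesis by simp
  qed
  ultimately show "p + n \<le> post k v + post l w"
    using joined_cross'_le[of X' "B1 @ att l # Y @ [w]" Y' "B2 @ att k # X @ [v]" p "rev L"] L j X Y
    by (simp add: joined_sym)
qed

definition index :: "'a \<Rightarrow> nat" where
  "index v = (THE i. i < s \<and> v \<in> set (seg i))"

lemma index_eq:
  assumes "i < s" "v \<in> set (seg i)"
  shows "index v = i"
  unfolding index_def
  by (rule the_equality) (use assms distinct_split2(2) in auto)

lemma in_seg_index: "v \<in> set C - A \<Longrightarrow> index v < s \<and> v \<in> set (seg (index v))"
  using set_C index_eq by (auto simp: A_eq)

text \<open>Only the rest of the cycle needs labels. H is cut off because
  \<open>A \<subseteq> S\<close> and contributes the extra 1. A component of \<open>R\<close>
  inherits the label of any cycle vertex it reaches; two such vertices are linked, so the choice is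
  immaterial.\<close>

lemma tough_labels:
  fixes g :: "'a \<Rightarrow> nat"
  assumes S: "A \<subseteq> S" "S \<subseteq> set C"
    and g: "\<And>v w n. v \<in> set C - S \<Longrightarrow> w \<in> set C - S \<Longrightarrow> link n v w \<Longrightarrow> g v = g w"
    and pos: "\<And>v. v \<in> set C - S \<Longrightarrow> 0 < g v" and ne: "set C - S \<noteq> {}"
  shows "card (g ` (set C - S)) + 1 < card S"
proof -
  define reach where "reach = (\<lambda>v w. w \<in> set C - S \<and> (\<exists>u. linked R v u \<and> E u w))"
  \<comment> \<open>0 marks H, and is also the default for parts of \<open>R\<close> that reach no
    remaining cycle vertex.\<close>
  define f where "f = (\<lambda>v. if v \<in> H then 0 else if v \<in> set C then g v
    else if \<exists>w. reach v w then g (SOME w. reach v w) else 0)"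
  have fC: "f v = g v" if "v \<in> set C - S" for v using that H_sub by (auto simp: f_def)
  have fH: "f v = 0" if "v \<in> H" for v using that by (simp add: f_def)
  have reach_link: "\<exists>n. link n w w'" if a: "v \<in> R" "E w v" "reach v w'" for v w w'
  proof -
    obtain u P where P: "path_in R P" "hd P = v" "last P = u" "E u w'"
      using a(3) by (auto simp: reach_def linked_def)
    then have "successively E (w # P @ [w'])" using a(2)
      by (auto simp: path_in_def successively_Cons successively_append_iff)
    then show ?thesis using P(1) by (auto simp: link_def path_in_def)
  qed
  have CR: "f v = f w" if vw: "v \<in> R" "w \<in> set C - S" "E v w" for v w
  proof -
    have "reach v w" using vw linked_refl by (auto simp: reach_def)
    define w' where "w' = (SOME w. reach v w)"
    have w': "reach v w'" unfolding w'_def using \<open>reach v w\<close> by (rule someI)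
    have "f v = g w'" using vw(1) \<open>reach v w\<close> by (auto simp: f_def R_def w'_def)
    also obtain n where "link n w w'" using reach_link[OF vw(1) sym[OF vw(3)] w'] by blast
    then have "g w' = g w" using g[of w w' n] vw w' by (simp add: reach_def)
    finally show ?thesis using fC vw by simp
  qed
  have RR: "f v = f w" if vw: "v \<in> R" "w \<in> R" "E v w" for v w
  proof -
    have vw': "linked R v w" using linked_step[OF linked_refl[OF vw(1)] vw(3) vw(2)] .
    then have "linked R v u \<longleftrightarrow> linked R w u" for u
      using linked_trans[OF vw'] linked_trans[OF linked_sym[OF vw']] by metis
    then have "reach v = reach w" unfolding reach_def by simp
    then show ?thesis using vw by (auto simp: f_def R_def)
  qed
  have const: "f x = f y" if xy: "x \<in> V - S" "y \<in> V - S" "E x y" for x y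
  proof -
    have "E y x" using xy by (simp add: E_comm)
    have cases: "v \<in> H \<or> v \<in> set C - S \<or> v \<in> R" if "v \<in> V - S" for v using that by (auto simp: R_def)
    have HH: "w \<in> H" if "v \<in> H" "E v w" "w \<in> V - S" for v w
    proof (rule ccontr)
      assume "w \<notin> H"
      then have "w \<in> A" using H_closed[OF that(1,2)] that E_comm by (auto simp: A_def)
      then show False using that S by blast
    qed
    consider "x \<in> H \<or> y \<in> H" | "x \<in> set C - S" "y \<in> set C - S" | "x \<in> R" "y \<in> set C - S"
      | "y \<in> R" "x \<in> set C - S" | "x \<in> R" "y \<in> R" using cases xy by blast
    then show ?thesis
    proof cases
      case 1 then show ?thesis using HH fH xy \<open>E y x\<close> by metis
    next
      case 2 then show ?thesis using fC g[of x y 0] xy link_0 by simp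
    next
      case 3 then show ?thesis using CR xy by blast
    next
      case 4 then show ?thesis using CR \<open>E y x\<close> by metis
    next
      case 5 then show ?thesis using RR xy by blast
    qed
  qed
  obtain y where "y \<in> H" using card_H by fastforce
  then have "0 \<in> f ` (V - S)" using fH H_sub S by (metis DiffD1 DiffD2 DiffI image_eqI subsetD)
  moreover have "g ` (set C - S) \<subseteq> f ` (V - S)"
  proof (rule image_subsetI)
    fix v assume v: "v \<in> set C - S"
    then have "v \<in> V - S" using set_C_sub by blast
    then show "g v \<in> f ` (V - S)" using fC[OF v] by (metis imageI)
  qed
  ultimately have "insert 0 (g ` (set C - S)) \<subseteq> f ` (V - S)" by blast
  then have "card (insert 0 (g ` (set C - S))) \<le> card (f ` (V - S))"
    using finite_V by (intro card_mono) auto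
  moreover have "0 \<notin> g ` (set C - S)" using pos by fastforce
  ultimately have le: "card (g ` (set C - S)) + 1 \<le> card (f ` (V - S))" by simp
  moreover have "1 \<le> card (g ` (set C - S))" using ne by (simp add: Suc_le_eq card_gt_0_iff)
  ultimately have "card (f ` (V - S)) < card S"
    using const S set_C_sub by (intro tough) auto
  then show ?thesis using le by simp
qed

lemma index_image:
  assumes "A \<subseteq> S" "\<And>i. i < s \<Longrightarrow> \<not> set (seg i) \<subseteq> S"
  shows "index ` (set C - S) = {..<s}"
proof
  show "index ` (set C - S) \<subseteq> {..<s}" using in_seg_index assms(1) by blast
  show "{..<s} \<subseteq> index ` (set C - S)"
  proof
    fix i assume "i \<in> {..<s}"
    then have i: "i < s" by simp
    then obtain v where v: "v \<in> set (seg i)" "v \<notin> S" using assms(2) by blast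
    then have "v \<in> set C - S" "index v = i" using i set_C index_eq by auto
    then show "i \<in> index ` (set C - S)" by blast
  qed
qed

lemma seg_not_empty: "i < s \<Longrightarrow> seg i \<noteq> []"
  using seg_nonempty by fastforce

lemma link_classes:
  fixes h :: "nat \<Rightarrow> nat"
  assumes "\<And>k l v w n. k < s \<Longrightarrow> l < s \<Longrightarrow> k \<noteq> l \<Longrightarrow> v \<in> set (seg k) \<Longrightarrow> w \<in> set (seg l) \<Longrightarrow>
    link n v w \<Longrightarrow> h k = h l"
  shows "card (h ` {..<s}) + 1 < s"
proof -
  define g where "g = (\<lambda>v. Suc (h (index v)))"
  have "\<not> set (seg i) \<subseteq> A" if "i < s" for i
    using seg_not_empty[OF that] seg_not_A[OF that] hd_in_set by blast
  then have "index ` (set C - A) = {..<s}" by (intro index_image) auto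
  then have "g ` (set C - A) = Suc ` h ` {..<s}" unfolding g_def by (metis image_image)
  then have "card (g ` (set C - A)) = card (h ` {..<s})" by (simp add: card_image)
  moreover have "card (g ` (set C - A)) + 1 < card A"
  proof (rule tough_labels)
    show "set C - A \<noteq> {}" using A_not_all by blast
    show "g v = g w" if vw: "v \<in> set C - A" "w \<in> set C - A" "link n v w" for v w n
    proof (cases "index v = index w")
      case False
      then have "h (index v) = h (index w)"
        using in_seg_index[OF vw(1)] in_seg_index[OF vw(2)] vw(3) by (intro assms) auto
      then show ?thesis by (simp add: g_def)
    qed (simp add: g_def)
  qed (auto simp: A_sub g_def)
  ultimately show ?thesis using card_A_s by simp
qed

text \<open>Let d = s - \<delta>, so the slack is d + 1. Each vertex of H misses at most d + 1
  attachment vertices, hence at most 2d segments are bad, while the order leaves 2s - 3d vertices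
  for all segments. So d = 0 and every segment has exactly two vertices, too few for a connection
  between two of them; this contradicts toughness.\<close>

lemma two_tight:
  assumes h: "card H = 2"
  shows "s + card H = \<delta> + 1"
proof (rule ccontr)
  assume "s + card H \<noteq> \<delta> + 1"
  then have ge: "\<delta> \<le> s" using delta_le h by simp
  obtain x y where xy: "H = {x, y}" "x \<noteq> y" using h by (meson card_2_iff)
  have "E x y"
  proof -
    obtain v w where "v \<in> {x} \<inter> H" "w \<in> H - {x}" "E v w"
      using crossing_edge[of H x y "{x}"] H_linked xy by blast
    then show ?thesis using xy by auto
  qed
  have proper: "missing v \<noteq> {..<s}" if vw: "H = {v, w}" "v \<noteq> w" for v w
  proof
    assume all: "missing v = {..<s}"
    have "3 \<le> card {w}"
    proof (rule separator_card)
      show "{w} \<subseteq> V" "{v} \<subseteq> V - {w}" using vw H_sub by auto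
      show "V - {w} - {v} \<noteq> {}" using vw H_sub set_C_sub A_not_all by blast
      show "\<not> E u u'" if u: "u \<in> {v}" "u' \<in> V - {w} - {v}" for u u'
      proof
        assume "E u u'"
        then have "E v u'" "E u' v" using u E_comm by auto
        moreover have vH: "v \<in> H" using vw by blast
        moreover have "u' \<notin> H" using u vw by blast
        ultimately have "u' \<in> A" using H_closed unfolding A_def by blast
        then obtain i where "i < s" "u' = att i" by (auto simp: A_eq)
        then show False using all \<open>E u u'\<close> u E_comm by (auto simp: missing_def)
      qed
    qed simp
    then show False by simp
  qed
  have P: "path_in H [x, y]" using xy \<open>E x y\<close> by (simp add: path_in_def)
  have xH: "x \<in> H" "y \<in> H" using xy by auto
  obtain F where F: "2 * s \<le> (\<Sum>i<s. length (seg i)) + nbad + (2 - 2) * F"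
    using segment_sum[OF P, of x y 2] by auto
  have bad: "nbad \<le> (card (missing x) - 1) + (card (missing y) - 1)"
    using nbad_le[OF xH xy(2)] proper xy by (metis insert_commute)
  have dx: "\<delta> + card (missing x) \<le> s + 1" "\<delta> + card (missing y) \<le> s + 1"
    using miss_le[of x] miss_le[of y] xy h by auto
  obtain d where d: "s = \<delta> + d" using ge le_Suc_ex by blast
  have "card (missing x) - 1 \<le> d" "card (missing y) - 1 \<le> d" using dx d by auto
  then have "nbad \<le> 2 * d" using bad by linarith
  then have "2 * s \<le> (\<Sum>i<s. length (seg i)) + 2 * d" using F by simp
  then have tight: "\<delta> = s" "(\<Sum>i<s. length (seg i)) \<le> 2 * s" using d cycle_count h by linarith+
  have good: "good i j" if ij: "i < s" "j < s" "i \<noteq> j" for i j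
  proof (rule ccontr)
    assume "\<not> good i j"
    then obtain z where z: "\<And>y. y \<in> H \<Longrightarrow> y \<noteq> z \<Longrightarrow> i \<in> missing y \<and> j \<in> missing y"
      using not_good[of i j] ij by metis
    have "\<exists>v\<in>H. v \<noteq> z" using xy by auto
    then obtain v where v: "v \<in> H" "{i, j} \<subseteq> missing v" using z by blast
    then have "card {i, j} \<le> card (missing v)" using finite_missing by (intro card_mono) auto
    then show False using dx v(1) xy tight ij by auto
  qed
  have len: "length (seg i) = 2" if i: "i < s" for i
  proof (rule ccontr)
    have ge2: "2 \<le> length (seg j)" if "j < s" for j using that good seg_ge_2 nx_less nx_neq by metis
    assume "length (seg i) \<noteq> 2"
    then have "(\<Sum>i<s. 2) < (\<Sum>i<s. length (seg i))"
      using ge2 i by (intro sum_strict_mono_ex1) (auto intro!: bexI[of _ i] simp: le_neq_implies_less)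
    then show False using tight by simp
  qed
  have "card ((\<lambda>i. i) ` {..<s}) + 1 < s"
  proof (rule link_classes)
    fix k l v w n
    assume kl: "k < s" "l < s" "k \<noteq> l" "v \<in> set (seg k)" "w \<in> set (seg l)" "link n v w"
    have "nx k \<noteq> nx l" using inj_nx kl by (auto simp: inj_on_def)
    then have "2 + n \<le> pre k v + pre l w" "2 + n \<le> post k v + post l w"
      using link_le[OF kl(1-6), of 2] good kl nx_less good_joined by blast+
    then show "k = l" using pre_post[OF kl(4)] pre_post[OF kl(5)] len kl by simp
  qed
  then show False by simp
qed

lemma tight: "s + card H = \<delta> + 1"
proof (cases "card H = 2")
  case False
  then have "3 \<le> card H" using card_H by simp
  then show ?thesis
    using hamiltonian_or_few_neighbours hamiltonian_tight not_hamiltonian_False by metis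
qed (rule two_tight)

lemma degree_exact:
  assumes "y \<in> H"
  shows "missing y = {}" "{z \<in> H. z \<noteq> y \<and> \<not> E y z} = {}"
  using miss_le[OF assms] tight finite_missing[of y] finite_H by auto

lemma H_complete: "x \<in> H \<Longrightarrow> y \<in> H \<Longrightarrow> x \<noteq> y \<Longrightarrow> E x y"
  using degree_exact(2)[of x] by blast

lemma H_attached: "a \<in> A \<Longrightarrow> y \<in> H \<Longrightarrow> E a y"
  using degree_exact(1)[of y] by (auto simp: A_eq missing_def)

lemma H_twins:
  assumes "x \<in> H" "y \<in> H" "E x v" "v \<noteq> y"
  shows "E y v"
proof (cases "v \<in> H")
  case True then show ?thesis using H_complete assms by blast
next
  case False
  then have "v \<in> A" using H_closed[OF assms(1,3)] assms(1) sym[OF assms(3)] unfolding A_def by blast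
  then show ?thesis using H_attached assms(2) E_comm by blast
qed

end

section \<open>The extremal configuration\<close>

context tough_graph
begin

lemma linked_component:
  assumes "linked X x u" "linked X x w"
  shows "linked {v. linked X x v} u w"
proof -
  obtain P where P: "path_in X P" "hd P = u" "last P = w"
    using linked_trans[OF linked_sym[OF assms(1)] assms(2)] by (auto simp: linked_def)
  have "v \<in> {v. linked X x v}" if vP: "v \<in> set P" for v
  proof -
    obtain P1 P2 where "P = P1 @ v # P2" using vP by (meson split_list)
    then have "path_in X (P1 @ [v])" "hd (P1 @ [v]) = u"
      using P by (auto simp: path_in_def successively_append_iff hd_append)
    then show ?thesis using linked_along[of X x "P1 @ [v]"] assms(1) by simp
  qed
  then show ?thesis using P unfolding linked_def by (intro exI[of _ P]) (auto simp: path_in_def)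
qed

text \<open>Stated for every longest cycle, since it is also needed for rerouted ones. The rotation
  to an attachment vertex makes the initial part in \<open>segment_list\<close> empty.\<close>

lemma ex_segmented:
  assumes C: "max_cyc C" and x: "x \<in> V - set C" and y: "y \<in> V - set C" and xy: "E x y"
  shows "\<exists>C' H D. segmented V E \<delta> C' H D \<and> set C' = set C \<and> x \<in> H \<and> y \<in> H"
proof -
  define H where "H = {v. linked (V - set C) x v}"
  have xH: "x \<in> H" using linked_refl[OF x] by (simp add: H_def)
  have yH: "y \<in> H" using linked_step[OF linked_refl[OF x] xy y] by (simp add: H_def)
  have HV: "H \<subseteq> V - set C" using linked_in unfolding H_def by blast
  have comp: "cycle_component V E \<delta> C' H" if C': "max_cyc C'" "set C' = set C" for C'
  proof (unfold_locales)
    show "max_cyc C'" by fact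
    show "H \<subseteq> V - set C'" using HV C' by simp
    have "card {x, y} \<le> card H"
      using xH yH HV finite_V by (intro card_mono) (auto intro: finite_subset)
    then show "2 \<le> card H" using xy irrefl by (cases "x = y") auto
    show "linked H u w" if "u \<in> H" "w \<in> H" for u w
      using linked_component that unfolding H_def by blast
    show "w \<in> H \<or> w \<in> set C'" if "u \<in> H" "E u w" for u w
      using that C' linked_step in_V2 unfolding H_def by blast
  qed
  interpret c: cycle_component V E \<delta> C H using comp C by blast
  obtain a where a: "a \<in> c.A" using c.card_A by fastforce
  then obtain X Y where XY: "C = X @ a # Y" using c.A_sub by (meson split_list subsetD)
  define C' where "C' = a # Y @ X"
  have C': "max_cyc C'" "set C' = set C"
    using max_cyc_rotate[of X "a # Y"] C XY by (auto simp: C'_def)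
  interpret d: cycle_component V E \<delta> C' H using comp C' by blast
  have "a \<in> d.A" using a C' by (simp add: c.A_def d.A_def)
  obtain q D where D: "C' = q @ concat (map (\<lambda>(a, q). a # q) D)" "set q \<inter> d.A = {}"
    "\<forall>(a, q) \<in> set D. a \<in> d.A \<and> set q \<inter> d.A = {}" using segment_list[of C' d.A] by blast
  have "q = []" using D \<open>a \<in> d.A\<close> by (cases q) (auto simp: C'_def)
  have "segmented V E \<delta> C' H D"
  proof unfold_locales
    show "C' = concat (map (\<lambda>(a, q). a # q) D)" using D(1) \<open>q = []\<close> by simp
    show "fst p \<in> d.A" "set (snd p) \<inter> d.A = {}" if "p \<in> set D" for p
      using bspec[OF D(3) that] by (simp_all add: case_prod_beta)
  qed
  then show ?thesis using C' xH yH by blast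
qed

text \<open>The form in which the structure theorem is carried over to rerouted cycles: it speaks
  only of neighbourhoods, not of the new attachment vertices.\<close>

lemma outside_twins:
  assumes "max_cyc C" "x \<in> V - set C" "y \<in> V - set C" "E x y" "E x v" "v \<noteq> y"
  shows "E y v"
proof -
  obtain C' H D where "segmented V E \<delta> C' H D" and xy: "x \<in> H" "y \<in> H"
    using ex_segmented[OF assms(1-4)] by blast
  then interpret segmented V E \<delta> C' H D by blast
  show ?thesis using H_twins xy assms by blast
qed

end

lemma propagate:
  assumes "successively E xs" "\<And>x y. x \<in> set xs \<Longrightarrow> y \<in> set xs \<Longrightarrow> E x y \<or> E y x \<Longrightarrow> P x \<Longrightarrow> P y"
    and "w \<in> set xs" "P w" "u \<in> set xs"
  shows "P u"
  using assms
proof (induction xs arbitrary: u w)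
  case Nil then show ?case by simp
next
  case (Cons x xs)
  show ?case
  proof (cases "xs = []")
    case True then show ?thesis using Cons.prems by simp
  next
    case False
    then have s: "successively E xs" "E x (hd xs)" "hd xs \<in> set xs"
      using Cons.prems(1) by (auto simp: successively_Cons)
    have step: "P v" if "u \<in> set xs" "v \<in> set xs" "E u v \<or> E v u" "P u" for u v
      using Cons.prems(2)[of u v] that by simp
    obtain w' where w': "w' \<in> set xs" "P w'"
    proof (cases "w = x")
      case True
      then show ?thesis using that[of "hd xs"] Cons.prems(2)[of x "hd xs"] Cons.prems(4) s by simp
    next
      case False
      then show ?thesis using that[of w] Cons.prems by simp
    qed
    have all: "P v" if "v \<in> set xs" for v by (rule Cons.IH[OF s(1) _ w' that]) (rule step)
    show ?thesis
    proof (cases "u = x")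
      case True then show ?thesis using Cons.prems(2)[of "hd xs" x] all s by simp
    next
      case False then show ?thesis using all Cons.prems by simp
    qed
  qed
qed

section \<open>Excess of the segments and further longest cycles\<close>

context segmented
begin

lemma H_path: obtains P where "path_in H P" "length P = card H"
proof -
  obtain P where P: "set P = H" "distinct P" using finite_distinct_list finite_H by blast
  have "successively E xs" if "distinct xs" "set xs \<subseteq> H" for xs
    using that by (induction xs) (auto simp: successively_Cons intro!: H_complete)
  then have "path_in H P" using P card_H by (auto simp: path_in_def)
  then show ?thesis using that P by (simp add: distinct_card[symmetric])
qed

lemma path_ends: "path_in H P \<Longrightarrow> hd P \<in> H \<and> last P \<in> H"
  by (auto simp: path_in_def)

lemma joined_all: "a \<in> A \<Longrightarrow> b \<in> A \<Longrightarrow> joined (card H) a b"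
  using H_path H_attached path_ends E_comm unfolding joined_def by (metis order_refl)

definition excess :: "nat \<Rightarrow> nat" where "excess i = length (seg i) - card H"

lemma length_seg: "i < s \<Longrightarrow> length (seg i) = card H + excess i"
  using seg_ge[of i "card H"] joined_all att_in_A nx_less by (simp add: excess_def)

text \<open>Inserting \<delta> = s + |H| - 1 into the order bound leaves 3 - (s - 2)(|H| - 2) for
  the excess and \<open>R\<close>; then s \<ge> 3 is used.\<close>

lemma budget: "(\<Sum>i<s. excess i) + card R + card H \<le> 5"
proof -
  have "(\<Sum>i<s. length (seg i)) = s * card H + (\<Sum>i<s. excess i)"
    by (simp add: length_seg sum.distrib)
  then have le: "s + s * card H + (\<Sum>i<s. excess i) + card H + card R \<le> 3 * \<delta> + 2"
    using cycle_count by simp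
  obtain a b where ab: "s = 3 + a" "card H = 2 + b" using s_ge card_H le_Suc_ex by metis
  have "s * card H = 6 + 3 * b + 2 * a + a * b" unfolding ab by (simp add: algebra_simps)
  then show ?thesis using le tight ab by linarith
qed

lemma excess_add_le: "k < s \<Longrightarrow> l < s \<Longrightarrow> k \<noteq> l \<Longrightarrow> excess k + excess l \<le> (\<Sum>i<s. excess i)"
  using sum_mono2[of "{..<s}" "{k, l}" excess] by simp

lemma excess_le: "k < s \<Longrightarrow> excess k \<le> (\<Sum>i<s. excess i)"
  using sum_mono2[of "{..<s}" "{k}" excess] by simp

text \<open>Adding both bounds of \<open>link_le\<close> shows that the joint excess is at least 2n
  + 2. The budget permits only n = 0, so every connection is an edge.\<close>

lemma link_position:
  assumes kl: "k < s" "l < s" "k \<noteq> l" and v: "v \<in> set (seg k)" and w: "w \<in> set (seg l)" and L: "link n v w"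
  shows "E v w" "card H \<le> pre k v + pre l w" "card H \<le> post k v + post l w" "2 \<le> excess k + excess l"
proof -
  have le: "card H + n \<le> pre k v + pre l w" "card H + n \<le> post k v + post l w"
    using link_le[OF kl v w L] joined_all att_in_A kl nx_less by blast+
  then have n: "2 * n + 2 \<le> excess k + excess l"
    using pre_post[OF v] pre_post[OF w] length_seg[OF kl(1)] length_seg[OF kl(2)] by linarith
  then have "n = 0" using excess_add_le[OF kl] budget card_H by linarith
  then show "E v w" "card H \<le> pre k v + pre l w" "card H \<le> post k v + post l w" "2 \<le> excess k + excess l"
    using L le n link_0 by auto
qed

lemma distinct_seg: "i < s \<Longrightarrow> distinct (seg i)"
  using split_at distinct_C by (metis distinct.simps(2) distinct_append)

lemma successively_seg:
  assumes "i < s" shows "successively E (seg i)"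
proof -
  have "successively E C" using max_cyc_C by (simp add: max_cyc_def cyc_def)
  then show ?thesis using split_at[OF assms]
    by (metis append_Cons successively_append_iff append.assoc append_Nil)
qed

lemma pre_hd: "seg k \<noteq> [] \<Longrightarrow> pre k (hd (seg k)) = 0"
  by (cases "seg k") (auto simp: pre_def)

lemma post_last:
  assumes "k < s" "seg k \<noteq> []" shows "post k (last (seg k)) = 0"
proof -
  obtain X X' where X: "seg k = X @ last (seg k) # X'" "post k (last (seg k)) = length X'"
    using split_seg[OF last_in_set[OF assms(2)]] by metis
  have "X' = []"
  proof (rule ccontr)
    assume "X' \<noteq> []"
    then have "last (seg k) \<in> set X'" using X(1) by (metis last_ConsR last_appendR last_in_set list.distinct(1))
    then show False using X(1) distinct_seg[OF assms(1)] by (metis distinct.simps(2) distinct_append)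
  qed
  then show ?thesis using X by simp
qed

lemma pre_inj: "v \<in> set (seg k) \<Longrightarrow> w \<in> set (seg k) \<Longrightarrow> pre k v = pre k w \<Longrightarrow> v = w"
  using nth_pre by metis

text \<open>If a segment is exactly as long as \<open>H\<close>, then \<open>H\<close> can take its place in the cycle, and the
  segment becomes part of a component of the complement, whose adjacent vertices are twins.\<close>

lemma short_segment_link:
  assumes kl: "k < s" "l < s" "k \<noteq> l" and v: "v \<in> set (seg k)" and w: "w \<in> set (seg l)" and vw: "E v w"
    and short: "excess l = 0"
  shows "card H = 2" "excess k = 3" "pre k v = 2"
proof -
  obtain B1 B2 where B: "reordering (att l # seg l @ B1 @ att k # seg k @ B2)"
    "hd (B1 @ [att k]) = att (nx l)" "hd (B2 @ [att l]) = att (nx k)"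
    using split_at2[of l k] kl by metis
  define Z where "Z = B1 @ att k # seg k @ B2 @ [att l]"
  have "reordering ([att l] @ (seg l @ B1 @ att k # seg k @ B2))" using B by simp
  from reordering_rotate[OF this] have r: "reordering (seg l @ Z)" by (simp add: Z_def)
  have hdZ: "hd Z = att (nx l)" using B(2) by (cases B1) (auto simp: Z_def)
  obtain P where P: "path_in H P" "length P = card H" using H_path .
  have m: "max_cyc (seg l @ Z)" and setZ: "set (seg l) \<union> set Z = set C"
    using r by (auto simp: reordering_def)
  have "cyc (P @ Z)"
  proof (rule cyc_insert[OF m])
    show "path_in (V - set (seg l @ Z)) P" using path_in_H[OF P(1), of "seg l @ Z"] setZ by simp
    show "E (last Z) (hd P)" using H_attached att_in_A kl path_ends[OF P(1)] by (simp add: Z_def)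
    show "E (last P) (hd Z)" using H_attached att_in_A nx_less path_ends[OF P(1)] hdZ E_comm by metis
  qed (simp add: Z_def)
  moreover have "length (P @ Z) = length (seg l @ Z)" using P length_seg[OF kl(2)] short by simp
  ultimately have N: "max_cyc (P @ Z)" using max_cyc_same_length[OF m] by blast
  have out: "u \<in> V - set (P @ Z)" if "u \<in> set (seg l)" for u
  proof -
    have "u \<notin> set Z" using max_cyc_distinct[OF m] that by auto
    moreover have "u \<in> set C" using that setZ by blast
    ultimately show ?thesis using P H_sub set_C_sub by (auto simp: path_in_def)
  qed
  have vout: "v \<notin> set (seg l)" using v distinct_split2(2)[OF kl] by blast
  have adj: "E u v" if "u \<in> set (seg l)" for u
  proof (rule propagate[OF successively_seg[OF kl(2)], of "\<lambda>u. E u v" w])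
    show "E y v" if "x \<in> set (seg l)" "y \<in> set (seg l)" "E x y \<or> E y x" "E x v" for x y
      using outside_twins[OF N out[OF that(1)] out[OF that(2)] _ that(4)] that E_comm vout by blast
    show "E w v" using vw by (rule sym)
  qed (use w that in auto)
  have ne: "seg l \<noteq> []" using w by auto
  have "link 0 v (hd (seg l))" "link 0 v (last (seg l))"
    using adj ne sym by (auto simp: link_0)
  \<comment> \<open>The end vertices of segment \<open>l\<close> have nothing before or after them,
    so \<open>v\<close> alone must supply |H| vertices on each side.\<close>
  then have "card H \<le> pre k v + pre l (hd (seg l))" "card H \<le> post k v + post l (last (seg l))"
    using link_position(2)[OF kl v] link_position(3)[OF kl v] ne by auto
  then have "card H \<le> pre k v" "card H \<le> post k v" using pre_hd post_last kl ne by auto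
  moreover have "pre k v + post k v + 1 = card H + excess k" using pre_post[OF v] length_seg kl by simp
  moreover have "excess k + card H \<le> 5" using excess_le[OF kl(1)] budget by linarith
  ultimately show "card H = 2" "excess k = 3" "pre k v = 2" using card_H by linarith+
qed

text \<open>Under \<open>len\<close> the rerouting along the edge from \<open>v\<close> to
  \<open>w\<close> loses exactly |H| vertices and gains H. It is again a longest cycle, and the
  vertices of segment \<open>k\<close> after \<open>v\<close> lie outside it.\<close>

lemma twins_post:
  assumes kl: "k < s" "l < s" "k \<noteq> l" and v: "v \<in> set (seg k)" and w: "w \<in> set (seg l)" and vw: "E v w"
    and len: "post k v + post l w = card H"
    and xy: "x \<in> set (seg k)" "y \<in> set (seg k)" "pre k v < pre k x" "pre k v < pre k y" "E x y" "E x u" "u \<noteq> y"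
  shows "E y u"
proof -
  obtain X X' where X: "seg k = X @ v # X'" "pre k v = length X" "post k v = length X'" using split_seg v by blast
  obtain Y Y' where Y: "seg l = Y @ w # Y'" "pre l w = length Y" "post l w = length Y'" using split_seg w by blast
  obtain B1 B2 where B: "reordering (att k # seg k @ B1 @ att l # seg l @ B2)"
    "hd (B1 @ [att l]) = att (nx k)" "hd (B2 @ [att k]) = att (nx l)"
    using split_at2[OF kl] .
  define Z1 where "Z1 = B1 @ att l # Y @ [w]"
  define Z2 where "Z2 = B2 @ att k # X @ [v]"
  have "reordering ((att k # X @ [v]) @ (X' @ Z1 @ Y' @ B2))"
    using B X Y by (simp add: Z1_def)
  from reordering_rotate[OF this]
  have m: "max_cyc (X' @ Z1 @ Y' @ Z2)" and setC: "set (X' @ Z1 @ Y' @ Z2) = set C"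
    by (simp_all add: reordering_def Z2_def)
  have hds: "hd Z1 = att (nx k)" "hd Z2 = att (nx l)" using B(2,3) by (cases B1; cases B2; auto simp: Z1_def Z2_def)+
  obtain P where P: "path_in H P" "length P = card H" using H_path .
  have "cyc (P @ Z1 @ [] @ rev Z2)"
  proof (rule cyc_cross'[OF m])
    show "path_in (V - set (X' @ Z1 @ Y' @ Z2)) P" using path_in_H[OF P(1) setC] .
    show "E (hd Z2) (hd P)" "E (last P) (hd Z1)"
      using H_attached att_in_A nx_less path_ends[OF P(1)] hds E_comm by metis+
    show "successively E (last Z1 # [] @ [last Z2])" using vw E_comm by (simp add: Z1_def Z2_def)
  qed (auto simp: Z1_def Z2_def)
  moreover have "length (P @ Z1 @ [] @ rev Z2) = length (X' @ Z1 @ Y' @ Z2)" using P len X Y by simp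
  ultimately have N: "max_cyc (P @ Z1 @ [] @ rev Z2)" using max_cyc_same_length[OF m] by blast
  have out: "q \<in> V - set (P @ Z1 @ [] @ rev Z2)" if q: "q \<in> set (seg k)" "pre k v < pre k q" for q
  proof -
    have "seg k ! pre k q = X' ! (pre k q - length X - 1)"
      using q(2) X by (simp add: nth_append nth_Cons')
    moreover have "pre k q - length X - 1 < length X'"
      using pre_post[OF q(1)] q(2) X by simp
    ultimately have "q \<in> set X'" using nth_pre[OF q(1)] by (metis nth_mem)
    moreover have "set X' \<inter> set Z1 = {}" "set X' \<inter> set Z2 = {}" "set X' \<subseteq> set C"
      using max_cyc_distinct[OF m] setC by auto
    ultimately show ?thesis using P H_sub set_C_sub by (auto simp: path_in_def)
  qed
  show ?thesis using outside_twins[OF N out[OF xy(1,3)] out[OF xy(2,4)]] xy by blast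
qed

end

context segmented
begin

text \<open>As \<open>twins_post\<close>, with the parts before \<open>v\<close> and
  \<open>w\<close>.\<close>

lemma twins_pre:
  assumes kl: "k < s" "l < s" "k \<noteq> l" and v: "v \<in> set (seg k)" and w: "w \<in> set (seg l)" and vw: "E v w"
    and len: "pre k v + pre l w = card H"
    and xy: "x \<in> set (seg k)" "y \<in> set (seg k)" "pre k x < pre k v" "pre k y < pre k v" "E x y" "E x u" "u \<noteq> y"
  shows "E y u"
proof -
  obtain X X' where X: "seg k = X @ v # X'" "pre k v = length X" "post k v = length X'" using split_seg v by blast
  obtain Y Y' where Y: "seg l = Y @ w # Y'" "pre l w = length Y" "post l w = length Y'" using split_seg w by blast
  obtain B1 B2 where B: "reordering (att k # seg k @ B1 @ att l # seg l @ B2)"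
    "hd (B1 @ [att l]) = att (nx k)" "hd (B2 @ [att k]) = att (nx l)"
    using split_at2[OF kl] .
  define Z1 where "Z1 = v # X' @ B1 @ [att l]"
  define Z2 where "Z2 = w # Y' @ B2 @ [att k]"
  have "reordering ([att k] @ (X @ Z1 @ Y @ w # Y' @ B2))"
    using B X Y by (simp add: Z1_def)
  from reordering_rotate[OF this]
  have m: "max_cyc (X @ Z1 @ Y @ Z2)" and setC: "set (X @ Z1 @ Y @ Z2) = set C"
    by (simp_all add: reordering_def Z2_def)
  obtain P where P: "path_in H P" "length P = card H" using H_path .
  have "cyc (P @ rev Z1 @ [] @ Z2)"
  proof (rule cyc_cross[OF m])
    show "path_in (V - set (X @ Z1 @ Y @ Z2)) P" using path_in_H[OF P(1) setC] .
    have "last Z2 = att k" "last Z1 = att l" by (simp_all add: Z1_def Z2_def)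
    then show "E (last Z2) (hd P)" "E (last P) (last Z1)"
      using H_attached att_in_A kl path_ends[OF P(1)] E_comm by metis+
    show "successively E (hd Z1 # [] @ [hd Z2])" using vw by (simp add: Z1_def Z2_def)
  qed (auto simp: Z1_def Z2_def)
  moreover have "length (P @ rev Z1 @ [] @ Z2) = length (X @ Z1 @ Y @ Z2)" using P len X Y by simp
  ultimately have N: "max_cyc (P @ rev Z1 @ [] @ Z2)" using max_cyc_same_length[OF m] by blast
  have out: "q \<in> V - set (P @ rev Z1 @ [] @ Z2)" if q: "q \<in> set (seg k)" "pre k q < pre k v" for q
  proof -
    have "q = X ! pre k q" using nth_pre[OF q(1)] q(2) X by (simp add: nth_append)
    then have "q \<in> set X" using q(2) X by (metis nth_mem)
    moreover have "set X \<inter> set Z1 = {}" "set X \<inter> set Z2 = {}" "set X \<subseteq> set C"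
      using max_cyc_distinct[OF m] setC by auto
    ultimately show ?thesis using P H_sub set_C_sub by (auto simp: path_in_def)
  qed
  show ?thesis using outside_twins[OF N out[OF xy(1,3)] out[OF xy(2,4)]] xy by blast
qed

section \<open>Which segments are joined by edges\<close>

definition crossing :: "nat \<Rightarrow> nat \<Rightarrow> bool" where
  "crossing k l \<longleftrightarrow> (\<exists>v\<in>set (seg k). \<exists>w\<in>set (seg l). E v w)"

lemma crossing_sym: "crossing k l \<Longrightarrow> crossing l k"
  unfolding crossing_def using E_comm by blast

lemma link_index:
  assumes "v \<in> set C - A" "w \<in> set C - A" "link n v w" "index v \<noteq> index w"
  shows "E v w" "crossing (index v) (index w)"
  using link_position[OF _ _ assms(4) _ _ assms(3)] in_seg_index[OF assms(1)] in_seg_index[OF assms(2)]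
  unfolding crossing_def by blast+

lemma crossing_classes:
  fixes h :: "nat \<Rightarrow> nat"
  assumes "\<And>k l. k < s \<Longrightarrow> l < s \<Longrightarrow> k \<noteq> l \<Longrightarrow> crossing k l \<Longrightarrow> h k = h l"
  shows "card (h ` {..<s}) + 1 < s"
proof (rule link_classes)
  fix k l v w n
  assume *: "k < s" "l < s" "k \<noteq> l" "v \<in> set (seg k)" "w \<in> set (seg l)" "link n v w"
  then have "crossing k l" using link_position(1)[OF *] unfolding crossing_def by blast
  then show "h k = h l" using assms * by blast
qed

text \<open>Deleting \<open>A\<close> and \<open>z\<close>, s + 1 vertices, would leave all s
  segments apart from each other and from H.\<close>

lemma crossing_through_vertex:
  assumes z: "z \<in> set C - A" and ne: "\<And>i. i < s \<Longrightarrow> \<not> set (seg i) \<subseteq> {z}"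
    and cross: "\<And>v w. v \<in> set C - A \<Longrightarrow> w \<in> set C - A \<Longrightarrow> index v \<noteq> index w \<Longrightarrow> E v w \<Longrightarrow> v = z \<or> w = z"
  shows False
proof -
  define g where "g = (\<lambda>v. Suc (index v))"
  have im: "index ` (set C - insert z A) = {..<s}"
  proof (rule index_image)
    show "\<not> set (seg i) \<subseteq> insert z A" if "i < s" for i
      using ne[OF that] seg_not_A[OF that] by blast
  qed blast
  then have "g ` (set C - insert z A) = Suc ` {..<s}" unfolding g_def by (metis image_image)
  then have "card (g ` (set C - insert z A)) = s" by (simp add: card_image)
  moreover have "card (g ` (set C - insert z A)) + 1 < card (insert z A)"
  proof (rule tough_labels)
    show "set C - insert z A \<noteq> {}"
    proof
      assume "set C - insert z A = {}"
      then have "{..<s} = {}" using im by (metis image_empty)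
      then show False using s_ge by (simp add: lessThan_empty_iff)
    qed
    show "g v = g w" if "v \<in> set C - insert z A" "w \<in> set C - insert z A" "link n v w" for v w n
    proof (rule ccontr)
      assume "g v \<noteq> g w"
      then have "E v w" using link_index(1)[of v w n] that by (auto simp: g_def)
      then show False using cross[of v w] that \<open>g v \<noteq> g w\<close> by (auto simp: g_def)
    qed
  qed (use z A_sub in \<open>auto simp: g_def\<close>)
  moreover have "card (insert z A) = s + 1" using z finite_A card_A_s by simp
  ultimately show False by simp
qed

text \<open>Excess 3 exhausts the budget. Every edge between segments then meets segment
  \<open>k\<close>, by \<open>short_segment_link\<close> in its middle vertex, and
  \<open>crossing_through_vertex\<close> applies.\<close>

lemma excess_ne_3:
  assumes k: "k < s"
  shows "excess k \<noteq> 3"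
proof
  assume e3: "excess k = 3"
  have le: "3 \<le> (\<Sum>i<s. excess i)" using excess_le[OF k] e3 by simp
  then have h: "card H = 2" using budget card_H by linarith
  have zero: "excess l = 0" if "l < s" "l \<noteq> k" for l
    using excess_add_le[OF k that(1)] that e3 budget h by simp
  have len: "length (seg k) = 5" using length_seg[OF k] e3 h by simp
  have only: "pre k v = 2" if "v \<in> set C - A" "w \<in> set C - A" "index v \<noteq> index w" "E v w" "index v = k" for v w
    using short_segment_link(3)[of k "index w" v w] in_seg_index[OF that(1)] in_seg_index[OF that(2)] that k zero
    by simp
  have cov: "index v = k \<or> index w = k"
    if "v \<in> set C - A" "w \<in> set C - A" "index v \<noteq> index w" "E v w" for v w
    using link_position(4)[of "index v" "index w" v w 0] in_seg_index[OF that(1)] in_seg_index[OF that(2)] that zero link_0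
    by fastforce
  define z where "z = seg k ! 2"
  have zk: "z \<in> set (seg k)" using len by (simp add: z_def)
  have pz: "v = z" if "v \<in> set (seg k)" "pre k v = 2" for v using nth_pre[OF that(1)] that(2) by (simp add: z_def)
  show False
  proof (rule crossing_through_vertex[of z])
    show "z \<in> set C - A" using zk k set_C seg_not_A by blast
    show "\<not> set (seg i) \<subseteq> {z}" if "i < s" for i
    proof
      assume *: "set (seg i) \<subseteq> {z}"
      have "card (set (seg i)) = length (seg i)" using distinct_seg[OF that] by (rule distinct_card)
      then show False using card_mono[OF _ *] length_seg[OF that] h by simp
    qed
    show "v = z \<or> w = z" if "v \<in> set C - A" "w \<in> set C - A" "index v \<noteq> index w" "E v w" for v w
      using cov[OF that] only[OF that] only[OF that(2,1) that(3)[symmetric] sym[OF that(4)]]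
        pz in_seg_index[OF that(1)] in_seg_index[OF that(2)] by metis
  qed
qed

lemma crossing_excess:
  assumes "k < s" "l < s" "k \<noteq> l" "crossing k l"
  shows "0 < excess k" "0 < excess l"
proof -
  obtain v w where "v \<in> set (seg k)" "w \<in> set (seg l)" "E v w" using assms(4) by (auto simp: crossing_def)
  then show "0 < excess k" "0 < excess l"
    using short_segment_link(2)[of k l v w] short_segment_link(2)[of l k w v] excess_ne_3 assms sym by (metis gr0I)+
qed

text \<open>Only segments of positive excess are joined by edges. If there were at most two, merging
  them would leave at least s - 1 classes, too many for toughness; the budget allows at most
  three.\<close>

lemma three_positive:
  obtains k l m where "{i. i < s \<and> 0 < excess i} = {k, l, m}" "k \<noteq> l" "k \<noteq> m" "l \<noteq> m"
    "card H = 2" "R = {}" "excess k = 1" "excess l = 1" "excess m = 1"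
proof -
  define N where "N = {i. i < s \<and> 0 < excess i}"
  have fin: "finite N" and Ns: "N \<subseteq> {..<s}" by (auto simp: N_def)
  have sumN: "(\<Sum>i<s. excess i) = (\<Sum>i\<in>N. excess i)"
    using Ns by (intro sum.mono_neutral_right) (auto simp: N_def)
  have cN: "card N \<le> (\<Sum>i\<in>N. excess i)"
    using sum_bounded_below[of N 1 excess] by (auto simp: N_def Suc_le_eq)
  have ge: "3 \<le> card N"
  proof (rule ccontr)
    assume "\<not> 3 \<le> card N"
    \<comment> \<open>\<open>s\<close> is not an index, so it is a fresh label for the merged
      class.\<close>
    define h where "h = (\<lambda>i. if i \<in> N then s else i)"
    have c: "card (h ` {..<s}) + 1 < s"
    proof (rule crossing_classes)
      fix k l assume "k < s" "l < s" "k \<noteq> l" "crossing k l"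
      then show "h k = h l" using crossing_excess[of k l] by (simp add: h_def N_def)
    qed
    have "{..<s} - N \<subseteq> h ` {..<s}" by (force simp: h_def image_iff)
    show False
    proof (cases "N = {}")
      case True
      then have "h ` {..<s} = {..<s}" by (simp add: h_def)
      then show False using c by simp
    next
      case False
      then have "insert s ({..<s} - N) \<subseteq> h ` {..<s}" using \<open>{..<s} - N \<subseteq> h ` {..<s}\<close> Ns
        by (auto simp: h_def image_iff)
      then have "card (insert s ({..<s} - N)) \<le> card (h ` {..<s})" by (intro card_mono) auto
      moreover have "card (insert s ({..<s} - N)) = s - card N + 1"
        using Ns fin by (simp add: card_Diff_subset)
      ultimately show False using c \<open>\<not> 3 \<le> card N\<close> by linarith
    qed
  qed
  then have c3: "card N = 3" and h2: "card H = 2" and R0: "card R = 0" and sum3: "(\<Sum>i\<in>N. excess i) = 3"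
    using budget card_H cN sumN by linarith+
  obtain k l m where klm: "N = {k, l, m}" "k \<noteq> l" "k \<noteq> m" "l \<noteq> m" using c3 by (auto simp: card_3_iff)
  have "0 < excess k" "0 < excess l" "0 < excess m" using klm(1) by (auto simp: N_def)
  moreover have "excess k + excess l + excess m = 3" using sum3 klm by simp
  ultimately have "excess k = 1" "excess l = 1" "excess m = 1" by linarith+
  then show ?thesis using that klm h2 R0 finite_R by (simp add: N_def)
qed

lemma contradiction: False
proof -
  obtain k l m where N: "{i. i < s \<and> 0 < excess i} = {k, l, m}" and ne: "k \<noteq> l" "k \<noteq> m" "l \<noteq> m"
    and h: "card H = 2" and R: "R = {}" and e: "excess k = 1" "excess l = 1" "excess m = 1"
    using three_positive .
  have Nlt: "i < s" and len: "length (seg i) = 3" if "i \<in> {k, l, m}" for i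
  proof -
    have "i \<in> {i. i < s \<and> 0 < excess i}" using that N by simp
    then show "i < s" by simp
    then show "length (seg i) = 3" using length_seg h e that by auto
  qed
  have inN: "i \<in> {k, l, m}" "j \<in> {k, l, m}" if "i < s" "j < s" "i \<noteq> j" "crossing i j" for i j
    using crossing_excess[OF that] that N by blast+
  have pp: "pre i v + post i v = 2" if "i \<in> {k, l, m}" "v \<in> set (seg i)" for i v
    using pre_post[OF that(2)] len[OF that(1)] by simp
  have pos: "pre i v + pre j w = 2 \<and> post i v + post j w = 2"
    if ij: "i < s" "j < s" "i \<noteq> j" "v \<in> set (seg i)" "w \<in> set (seg j)" "E v w" for i j v w
  proof -
    have "i \<in> {k, l, m}" "j \<in> {k, l, m}" using inN[OF ij(1-3)] ij crossing_def by blast+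
    then have "pre i v + post i v = 2" "pre j w + post j w = 2" using pp ij by blast+
    moreover have "2 \<le> pre i v + pre j w" "2 \<le> post i v + post j w"
      using link_position(2,3)[OF ij(1-5), of 0] ij(6) h link_0 by simp_all
    ultimately show ?thesis by linarith
  qed
  have consec: "E x y" if "i \<in> {k, l, m}" "x \<in> set (seg i)" "y \<in> set (seg i)" "pre i y = Suc (pre i x)" for i x y
  proof -
    have "successively E (seg i)" using successively_seg Nlt that(1) by blast
    moreover have "Suc (pre i x) < length (seg i)" using pre_post[OF that(3)] that(4) by simp
    ultimately have "E (seg i ! pre i x) (seg i ! Suc (pre i x))" by (simp add: successively_conv_nth)
    then show ?thesis using nth_pre[OF that(2)] nth_pre[OF that(3)] that(4) by simp
  qed
  have nth: "seg i ! t \<in> set (seg i)" "pre i (seg i ! t) = t" if "i \<in> {k, l, m}" "t < 3" for i t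
  proof -
    show in_seg: "seg i ! t \<in> set (seg i)" using len[OF that(1)] that(2) by simp
    then have "seg i ! pre i (seg i ! t) = seg i ! t" "pre i (seg i ! t) < length (seg i)"
      using nth_pre pre_post[OF in_seg] by (blast, simp)
    then show "pre i (seg i ! t) = t"
      using distinct_seg[OF Nlt[OF that(1)]] len[OF that(1)] that(2) nth_eq_iff_index_eq by metis
  qed
  \<comment> \<open>An edge leaving at the first vertex lets a longest cycle avoid the other two
    vertices of the segment. These are twins, so an outgoing edge at one gives an edge at the other
    with the same end; but \<open>pos\<close> makes that end determine the position.\<close>
  have no_after: "\<not> E x w'"
    if i: "i \<in> {k, l, m}" "j < s" "i \<noteq> j" "v \<in> set (seg i)" "w \<in> set (seg j)" "E v w" "pre i v = 0"
      and x: "x \<in> set (seg i)" "0 < pre i x" "j' < s" "i \<noteq> j'" "w' \<in> set (seg j')" for i j v w x w' j'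
  proof
    assume xw: "E x w'"
    have ilt: "i < s" using Nlt i by blast
    have pq: "post i v + post j w = card H" using pos[OF ilt i(2-6)] h by simp
    have "pre i x = 1 \<or> pre i x = 2" using pp[OF i(1) x(1)] x(2) by linarith
    then obtain y where y: "y \<in> set (seg i)" "0 < pre i y" "pre i y \<noteq> pre i x" "E x y"
    proof
      assume "pre i x = 1"
      then show ?thesis using that[of "seg i ! 2"] nth[OF i(1), of 2] consec[OF i(1) x(1)] by simp
    next
      assume "pre i x = 2"
      then show ?thesis using that[of "seg i ! 1"] nth[OF i(1), of 1] consec[OF i(1) _ x(1)] sym by simp
    qed
    have "w' \<noteq> y" using distinct_split2(2)[OF ilt x(3,4)] y(1) x(5) by blast
    then have "E y w'" using twins_post[OF ilt i(2-6) pq x(1) y(1) _ _ y(4) xw] x(2) y(2) i(7) by simp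
    then show False using pos[OF ilt x(3,4,1,5) xw] pos[OF ilt x(3,4) y(1) x(5)] y(3) by simp
  qed
  have no_before: "\<not> E x w'"
    if i: "i \<in> {k, l, m}" "j < s" "i \<noteq> j" "v \<in> set (seg i)" "w \<in> set (seg j)" "E v w" "pre i v = 2"
      and x: "x \<in> set (seg i)" "pre i x < 2" "j' < s" "i \<noteq> j'" "w' \<in> set (seg j')" for i j v w x w' j'
  proof
    assume xw: "E x w'"
    have ilt: "i < s" using Nlt i by blast
    have pq: "pre i v + pre j w = card H" using pos[OF ilt i(2-6)] h by simp
    have "pre i x = 0 \<or> pre i x = 1" using x(2) by linarith
    then obtain y where y: "y \<in> set (seg i)" "pre i y < 2" "pre i y \<noteq> pre i x" "E x y"
    proof
      assume "pre i x = 0"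
      then show ?thesis using that[of "seg i ! 1"] nth[OF i(1), of 1] consec[OF i(1) x(1)] by simp
    next
      assume "pre i x = 1"
      then show ?thesis using that[of "seg i ! 0"] nth[OF i(1), of 0] consec[OF i(1) _ x(1)] sym by simp
    qed
    have "w' \<noteq> y" using distinct_split2(2)[OF ilt x(3,4)] y(1) x(5) by blast
    then have "E y w'" using twins_pre[OF ilt i(2-6) pq x(1) y(1) _ _ y(4) xw] x(2) y(2) i(7) by simp
    then show False using pos[OF ilt x(3,4,1,5) xw] pos[OF ilt x(3,4) y(1) x(5)] y(3) by simp
  qed
  \<comment> \<open>Outgoing edges at position 0 or 2 exclude those at any other position; otherwise
    both positions are 1.\<close>
  have unique: "v = v'"
    if i: "i \<in> {k, l, m}" and v: "j < s" "i \<noteq> j" "v \<in> set (seg i)" "w \<in> set (seg j)" "E v w"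
      and v': "j' < s" "i \<noteq> j'" "v' \<in> set (seg i)" "w' \<in> set (seg j')" "E v' w'" for i j j' v v' w w'
  proof -
    have "pre i v \<le> 2" "pre i v' \<le> 2" using pp[OF i v(3)] pp[OF i v'(3)] by linarith+
    moreover have "pre i v = 0 \<Longrightarrow> pre i v' = 0" using no_after[OF i v _ v'(3) _ v'(1,2,4)] v'(5) by blast
    moreover have "pre i v' = 0 \<Longrightarrow> pre i v = 0" using no_after[OF i v' _ v(3) _ v(1,2,4)] v(5) by blast
    moreover have "pre i v = 2 \<Longrightarrow> \<not> pre i v' < 2" using no_before[OF i v _ v'(3) _ v'(1,2,4)] v'(5) by blast
    moreover have "pre i v' = 2 \<Longrightarrow> \<not> pre i v < 2" using no_before[OF i v' _ v(3) _ v(1,2,4)] v(5) by blast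
    ultimately have "pre i v = pre i v'" by linarith
    then show ?thesis using pre_inj v(3) v'(3) by blast
  qed
  \<comment> \<open>Merging \<open>b\<close> and \<open>c\<close> still leaves s - 1
    classes.\<close>
  have isolated: False if abc: "{a, b, c} = {k, l, m}" "a \<noteq> b" "a \<noteq> c" "b \<noteq> c" "\<not> crossing a b" "\<not> crossing a c" for a b c
  proof -
    define h where "h = (\<lambda>i. if i = c then b else i)"
    have "card (h ` {..<s}) + 1 < s"
    proof (rule crossing_classes)
      fix i j assume ij: "i < s" "j < s" "i \<noteq> j" "crossing i j"
      have mem: "i \<in> {a, b, c}" "j \<in> {a, b, c}" using inN[OF ij] abc(1) by simp_all
      have "i \<noteq> a" using mem ij abc(5,6) by auto
      moreover have "j \<noteq> a" using mem ij(3) crossing_sym[OF ij(4)] abc(5,6) by auto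
      ultimately show "h i = h j" using mem by (auto simp: h_def)
    qed
    moreover have "{..<s} - {c} \<subseteq> h ` {..<s}" by (force simp: h_def image_iff)
    then have "card ({..<s} - {c}) \<le> card (h ` {..<s})" by (intro card_mono) auto
    moreover have "c < s" using Nlt abc(1) by blast
    ultimately show False by simp
  qed
  have size: "\<not> set (seg i) \<subseteq> {z}" if "i < s" for i z
  proof
    assume *: "set (seg i) \<subseteq> {z}"
    have "card (set (seg i)) = length (seg i)" using distinct_seg[OF that] by (rule distinct_card)
    then show False using card_mono[OF _ *] length_seg[OF that] h by simp
  qed
  \<comment> \<open>All edges between segments then meet segment \<open>a\<close>, and by
    \<open>unique\<close> all in the same vertex.\<close>
  have centre: False if abc: "{a, b, c} = {k, l, m}" "a \<noteq> b" "b \<noteq> c" "crossing a b" "\<not> crossing b c" for a b c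
  proof -
    have lt: "a < s" "b < s" using Nlt abc(1) by blast+
    have aN: "a \<in> {k, l, m}" using abc(1) by blast
    obtain z w where z: "z \<in> set (seg a)" "w \<in> set (seg b)" "E z w" using abc(4) by (auto simp: crossing_def)
    show False
    proof (rule crossing_through_vertex[of z])
      show "z \<in> set C - A" using z lt set_C seg_not_A by blast
      show "\<not> set (seg i) \<subseteq> {z}" if "i < s" for i using size[OF that] .
      show "v = z \<or> w = z" if vw: "v \<in> set C - A" "w \<in> set C - A" "index v \<noteq> index w" "E v w" for v w
      proof -
        have iv: "index v < s" "v \<in> set (seg (index v))" and iw: "index w < s" "w \<in> set (seg (index w))"
          using in_seg_index vw by blast+
        have cr: "crossing (index v) (index w)" using iv iw vw crossing_def by blast
        have "index v \<in> {a, b, c}" "index w \<in> {a, b, c}" using inN[OF iv(1) iw(1) vw(3) cr] abc(1) by simp_all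
        then have "index v = a \<or> index w = a" using cr crossing_sym[OF cr] abc(5) vw(3) by fastforce
        then show ?thesis
        proof
          assume a: "index v = a"
          then have "v \<in> set (seg a)" "a \<noteq> index w" using iv vw by auto
          from unique[OF aN iw(1) this(2,1) iw(2) vw(4) lt(2) abc(2) z] show ?thesis by blast
        next
          assume a: "index w = a"
          then have "w \<in> set (seg a)" "a \<noteq> index v" using iw vw by auto
          from unique[OF aN iv(1) this(2,1) iv(2) sym[OF vw(4)] lt(2) abc(2) z] show ?thesis by blast
        qed
      qed
    qed
  qed
  have all: "crossing k l" "crossing k m" "crossing l m"
  proof -
    have perm: "{l, k, m} = {k, l, m}" "{m, k, l} = {k, l, m}" "{m, l, k} = {k, l, m}" "{l, m, k} = {k, l, m}"
      "{k, m, l} = {k, l, m}" by auto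
    show "crossing k l"
    proof (rule ccontr)
      assume no: "\<not> crossing k l"
      have "crossing m k \<or> crossing m l"
        using isolated[OF refl ne no] crossing_sym by blast
      then show False
        using centre[of m k l] centre[of m l k] perm ne no crossing_sym by metis
    qed
    show "crossing k m"
    proof (rule ccontr)
      assume no: "\<not> crossing k m"
      have "crossing l k \<or> crossing l m"
        using isolated[of k l m] ne no crossing_sym by blast
      then show False
        using centre[of l k m] centre[of l m k] perm ne no crossing_sym by metis
    qed
    show "crossing l m"
    proof (rule ccontr)
      assume no: "\<not> crossing l m"
      then show False
        using centre[of k l m] \<open>crossing k l\<close> ne by blast
    qed
  qed
  obtain zk zl where kl: "zk \<in> set (seg k)" "zl \<in> set (seg l)" "E zk zl" using all(1) by (auto simp: crossing_def)
  obtain zk' zm where km: "zk' \<in> set (seg k)" "zm \<in> set (seg m)" "E zk' zm" using all(2) by (auto simp: crossing_def)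
  obtain zl' zm' where lm: "zl' \<in> set (seg l)" "zm' \<in> set (seg m)" "E zl' zm'" using all(3) by (auto simp: crossing_def)
  have lt: "k < s" "l < s" "m < s" using Nlt by blast+
  have eqs: "zk' = zk" "zl' = zl" "zm' = zm"
    using unique[of k m zk' zm l zk zl] unique[of l m zl' zm' k zl zk] unique[of m l zm' zl' k zm zk']
      kl km lm lt ne sym by auto
  \<comment> \<open>Three positions with all pairwise sums 2 are all 1, so the edges join middle
    vertices.\<close>
  have "pre k zk + pre l zl = 2" "pre k zk + pre m zm = 2" "pre l zl + pre m zm = 2"
    using pos[OF lt(1,2) ne(1) kl] pos[OF lt(1,3) ne(2) km] pos[OF lt(2,3) ne(3) lm] eqs by auto
  then have p1: "pre k zk = 1" "pre l zl = 1" by linarith+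
  define u where "u = seg k ! 0"
  define t where "t = seg k ! 2"
  have segk: "seg k = [u, zk, t]"
  proof (rule nth_equalityI)
    show "length (seg k) = length [u, zk, t]" using len[of k] by simp
    fix i assume "i < length (seg k)"
    then have "i = 0 \<or> i = 1 \<or> i = 2" using len[of k] by auto
    then show "seg k ! i = [u, zk, t] ! i" using nth_pre[OF kl(1)] p1 by (auto simp: u_def t_def)
  qed
  obtain ul tl' where segl: "seg l = [ul, zl, tl']"
  proof -
    obtain Y Y' where Y: "seg l = Y @ zl # Y'" "pre l zl = length Y" "post l zl = length Y'" using split_seg kl(2) by blast
    moreover have "length Y = 1" "length Y' = 1" using Y p1 pp[of l zl] kl(2) by auto
    ultimately show ?thesis using that by (auto simp: length_Suc_conv)
  qed
  \<comment> \<open>With this edge, the edge from \<open>zk\<close> to \<open>zl\<close> and a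
    detour from \<open>att k\<close> to \<open>att l\<close>, a cycle would lose only
    \<open>ul\<close> and gain two vertices of H.\<close>
  have nut: "\<not> E u t"
  proof
    assume ut: "E u t"
    obtain B1 B2 where B: "reordering (att k # seg k @ B1 @ att l # seg l @ B2)"
      using split_at2[OF lt(1,2) ne(1)] by blast
    have "reordering ([att k] @ ([u, zk] @ (t # B1 @ [att l]) @ [ul] @ zl # tl' # B2))"
      using B segk segl by simp
    from reordering_rotate[OF this]
    have r: "reordering ([u, zk] @ (t # B1 @ [att l]) @ [ul] @ (zl # tl' # B2 @ [att k]))" by simp
    obtain P where P: "path_in H P" "length P = card H" using H_path .
    have "length P \<le> 1"
    proof (rule skip_le)
      show "max_cyc ([u, zk] @ (t # B1 @ [att l]) @ [ul] @ (zl # tl' # B2 @ [att k]))"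
        using r by (simp add: reordering_def)
      show "path_in (V - set ([u, zk] @ (t # B1 @ [att l]) @ [ul] @ (zl # tl' # B2 @ [att k]))) P"
        using path_in_H[OF P(1)] r unfolding reordering_def by blast
      show "E (last (zl # tl' # B2 @ [att k])) (hd P)" "E (last P) (last (t # B1 @ [att l]))"
        using H_attached[OF att_in_A] lt path_ends[OF P(1)] E_comm by auto
      show "E (hd (t # B1 @ [att l])) u" using ut E_comm by simp
      show "E zk (hd (zl # tl' # B2 @ [att k]))" using kl by simp
    qed auto
    then show False using P h by simp
  qed
  \<comment> \<open>Against s + 2 deleted vertices remain s + 2 parts: \<open>t\<close> alone, the
    rest of each of the s segments, and H. In \<open>g\<close>, \<open>Suc s\<close> is the label of
    \<open>t\<close>.\<close>
  define S where "S = insert zk (insert zl A)"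
  define g where "g = (\<lambda>v. if v = t then Suc s else Suc (index v))"
  have zC: "zk \<in> set C - A" "zl \<in> set C - A" using kl lt set_C seg_not_A by blast+
  have zkl: "zk \<noteq> zl" using kl irrefl by blast
  have dk: "u \<noteq> zk" "u \<noteq> t" "zk \<noteq> t" using distinct_seg[OF lt(1)] segk by auto
  have tk: "t \<in> set (seg k)" "u \<in> set (seg k)" using segk by auto
  have disj: "set (seg k) \<inter> set (seg l) = {}" using distinct_split2(2)[OF lt(1,2) ne(1)] .
  have tS: "t \<in> set C - S" using tk lt set_C seg_not_A dk disj kl by (auto simp: S_def)
  have cov: "v \<in> S \<or> w \<in> S"
    if vw: "v \<in> set C - A" "w \<in> set C - A" "index v \<noteq> index w" "E v w" for v w
  proof -
    have iv: "index v < s" "v \<in> set (seg (index v))" and iw: "index w < s" "w \<in> set (seg (index w))"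
      using in_seg_index vw by blast+
    have cr: "crossing (index v) (index w)" using iv iw vw crossing_def by blast
    have N': "index v \<in> {k, l, m}" "index w \<in> {k, l, m}" using inN[OF iv(1) iw(1) vw(3) cr] .
    then consider "index v = k" | "index v = l" | "index w = k" | "index w = l" using vw(3) by auto
    then show ?thesis
    proof cases
      case 1
      then have "v = zk" using unique[of k "index w" v w l zk zl] iv iw vw kl lt ne by auto
      then show ?thesis by (simp add: S_def)
    next
      case 2
      then have "v = zl" using unique[of l "index w" v w k zl zk] iv iw vw kl lt ne sym[OF kl(3)] by auto
      then show ?thesis by (simp add: S_def)
    next
      case 3
      then have "w = zk" using unique[of k "index v" w v l zk zl] iv iw vw kl lt ne sym[OF vw(4)] by auto
      then show ?thesis by (simp add: S_def)
    next
      case 4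
      then have "w = zl" using unique[of l "index v" w v k zl zk] iv iw vw kl lt ne sym[OF kl(3)] sym[OF vw(4)] by auto
      then show ?thesis by (simp add: S_def)
    qed
  qed
  have gt: "g w = Suc s" if "v = t" "link n v w" "w \<in> set C - S" for v w n
  proof (rule ccontr)
    assume gw: "g w \<noteq> Suc s"
    then have "w \<noteq> t" by (auto simp: g_def)
    have "E v w" using that(2) R by (auto simp: link_def)
    have w: "w \<in> set C - A" using that(3) by (auto simp: S_def)
    have t: "t \<in> set C - A" using tS by (auto simp: S_def)
    have "index t = k" using index_eq lt tk by blast
    show False
    proof (cases "index w = k")
      case True
      then have "w \<in> set (seg k)" using in_seg_index[OF w] by simp
      then have "w = u" using segk \<open>w \<noteq> t\<close> that(3) by (auto simp: S_def)
      then show False using nut \<open>E v w\<close> that(1) E_comm by blast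
    next
      case False
      then show False using cov[OF t w] \<open>index t = k\<close> \<open>E v w\<close> that(1,3) tS by auto
    qed
  qed
  have "card (g ` (set C - S)) + 1 < card S"
  proof (rule tough_labels)
    show "A \<subseteq> S" "S \<subseteq> set C" using zC A_sub by (auto simp: S_def)
    show "set C - S \<noteq> {}" using tS by blast
    show "0 < g v" for v by (simp add: g_def)
    show "g v = g w" if vw: "v \<in> set C - S" "w \<in> set C - S" "link n v w" for v w n
    proof -
      have "E v w" using vw(3) R by (auto simp: link_def)
      then have wv: "link 0 w v" using sym link_0 by blast
      show ?thesis
      proof (cases "v = t \<or> w = t")
        case True
        then show ?thesis using gt[OF _ vw(3,2)] gt[OF _ wv vw(1)] by (auto simp: g_def)
      next
        case False
        have "v \<in> set C - A" "w \<in> set C - A" using vw by (auto simp: S_def)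
        then have "index v = index w" using cov[of v w] \<open>E v w\<close> vw by blast
        then show ?thesis using False by (simp add: g_def)
      qed
    qed
  qed
  moreover have "Suc ` {..s} \<subseteq> g ` (set C - S)"
  proof (rule image_subsetI)
    fix i assume "i \<in> {..s}"
    then consider "i = s" | "i < s" "i = k" | "i < s" "i \<noteq> k" by fastforce
    then show "Suc i \<in> g ` (set C - S)"
    proof cases
      case 1
      have "g t = Suc s" by (simp add: g_def)
      then show ?thesis using tS 1 by (metis imageI)
    next
      case 2
      have "u \<in> set C - S" using tk lt set_C seg_not_A dk disj kl by (auto simp: S_def)
      moreover have "g u = Suc k" using dk index_eq[OF lt(1) tk(2)] by (simp add: g_def)
      ultimately show ?thesis using 2 by (metis imageI)
    next
      case 3
      obtain v where v: "v \<in> set (seg i)" "v \<noteq> zl" using size[OF 3(1), of zl] by blast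
      have "set (seg i) \<inter> set (seg k) = {}" using distinct_split2(2)[OF 3(1) lt(1) 3(2)] .
      then have "v \<noteq> zk" "v \<noteq> t" using v kl(1) tk by blast+
      moreover have "v \<in> set C - A" using v 3 set_C seg_not_A by blast
      ultimately have "v \<in> set C - S" "g v = Suc i"
        using v index_eq[OF 3(1) v(1)] by (auto simp: S_def g_def)
      then show ?thesis by (metis imageI)
    qed
  qed
  then have "card (Suc ` {..s}) \<le> card (g ` (set C - S))" by (intro card_mono) auto
  moreover have "card S = s + 2" using zC zkl finite_A card_A_s by (simp add: S_def)
  ultimately show False by (simp add: card_image)
qed

end

section \<open>Transfer to digraphs\<close>

lemma (in fin_graph) cyc_iff_nth:
  "cyc xs \<longleftrightarrow> 2 \<le> length xs \<and> distinct xs \<and> set xs \<subseteq> V \<and>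
     (\<forall>i < length xs. E (xs ! i) (xs ! (Suc i mod length xs)))"
proof -
  have "successively E xs \<and> E (last xs) (hd xs) \<longleftrightarrow>
      (\<forall>i < length xs. E (xs ! i) (xs ! (Suc i mod length xs)))" if len: "2 \<le> length xs"
  proof -
    have ne: "xs \<noteq> []" using len by auto
    define m where "m = length xs - 1"
    have m: "length xs = Suc m" using len by (simp add: m_def)
    have "(\<forall>i < length xs. E (xs ! i) (xs ! (Suc i mod length xs))) \<longleftrightarrow>
        (\<forall>i < m. E (xs ! i) (xs ! (Suc i mod Suc m))) \<and> E (xs ! m) (xs ! 0)"
      by (auto simp: m less_Suc_eq)
    also have "(\<forall>i < m. E (xs ! i) (xs ! (Suc i mod Suc m))) \<longleftrightarrow> (\<forall>i < m. E (xs ! i) (xs ! Suc i))"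
      by (intro all_cong) simp
    finally show ?thesis using ne m by (simp add: successively_conv_nth last_conv_nth hd_conv_nth)
  qed
  then show ?thesis unfolding cyc_def by blast
qed

text \<open>A labelling constant along arcs is constant on strong components, so picking a vertex
  from each component maps the components onto the labels.\<close>

lemma card_labels_le_num_components:
  fixes f :: "'a \<Rightarrow> nat"
  assumes "graph G" and "S \<subseteq> verts G"
    and f: "\<And>x y. x \<in> verts G - S \<Longrightarrow> y \<in> verts G - S \<Longrightarrow> x \<rightarrow>\<^bsub>G\<^esub> y \<Longrightarrow> f x = f y"
  shows "card (f ` (verts G - S)) \<le> num_components (delete_verts G S)"
proof -
  interpret graph G by fact
  define K where "K = delete_verts G S"
  have vK: "verts K = verts G - S" by (auto simp: K_def delete_verts_def)
  have "wf_digraph K" unfolding K_def delete_verts_def by (rule wellformed_induce_subgraph)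
  then interpret K: wf_digraph K .
  have adj: "x \<rightarrow>\<^bsub>G\<^esub> y" if "x \<rightarrow>\<^bsub>K\<^esub> y" for x y
    using that by (auto simp: K_def delete_verts_def arcs_ends_conv)
  have const: "f x = f y" if "x \<rightarrow>\<^sup>*\<^bsub>K\<^esub> y" for x y
    using that
  proof (induction rule: K.reachable_induct)
    case (step x y)
    then show ?case using f[of x y] adj vK K.adj_in_verts by metis
  qed simp
  define scc where "scc = (\<lambda>v. {w. v \<rightarrow>\<^sup>*\<^bsub>K\<^esub> w \<and> w \<rightarrow>\<^sup>*\<^bsub>K\<^esub> v})"
  have scc: "scc v \<in> pre_digraph.sccs_verts K" if "v \<in> verts K" for v
    using that K.reachable_trans unfolding pre_digraph.sccs_verts_def scc_def by blast
  have "f ` (verts G - S) \<subseteq> (\<lambda>c. f (SOME v. v \<in> c)) ` pre_digraph.sccs_verts K"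
  proof (rule image_subsetI)
    fix v assume "v \<in> verts G - S"
    then have v: "v \<in> verts K" by (simp add: vK)
    then have "v \<in> scc v" by (simp add: scc_def)
    then have "(SOME w. w \<in> scc v) \<in> scc v" by (rule someI)
    then have "f v = f (SOME w. w \<in> scc v)" by (intro const) (simp add: scc_def)
    then show "f v \<in> (\<lambda>c. f (SOME v. v \<in> c)) ` pre_digraph.sccs_verts K" using scc[OF v] by (metis imageI)
  qed
  moreover have "finite (pre_digraph.sccs_verts K)"
  proof (rule finite_subset)
    show "pre_digraph.sccs_verts K \<subseteq> Pow (verts K)"
      unfolding pre_digraph.sccs_verts_def using K.reachable_in_verts by fast
    show "finite (Pow (verts K))" by (simp add: vK)
  qed
  ultimately have "card (f ` (verts G - S)) \<le> card (pre_digraph.sccs_verts K)"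
    by (meson card_image_le card_mono finite_imageI order_trans)
  then show ?thesis by (simp add: num_components_def K.card_sccs_verts flip: K_def)
qed

text \<open>In a complete graph, where the toughness is infinite, the labelling would be constant,
  against \<open>two\<close>. Otherwise the maximum r > 1 exists and |S| \<ge> r c > c for the
  number c of components.\<close>

lemma card_labels_less:
  fixes f :: "'a \<Rightarrow> nat"
  assumes G: "graph G" and t: "toughness G > 1" and S: "S \<subseteq> verts G"
    and f: "\<And>x y. x \<in> verts G - S \<Longrightarrow> y \<in> verts G - S \<Longrightarrow> x \<rightarrow>\<^bsub>G\<^esub> y \<Longrightarrow> f x = f y"
    and two: "2 \<le> card (f ` (verts G - S))"
  shows "card (f ` (verts G - S)) < card S"
proof (cases "\<exists>n. complete_digraph n G")
  case True
  then have adj: "x \<rightarrow>\<^bsub>G\<^esub> y" if "x \<in> verts G" "y \<in> verts G" "x \<noteq> y" for x y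
    using that by (auto simp: complete_digraph_def)
  have "f x = f y" if "x \<in> verts G - S" "y \<in> verts G - S" for x y
    using f[OF that] adj that by blast
  moreover have "verts G - S \<noteq> {}" using two by (metis card.empty image_empty not_numeral_le_zero)
  ultimately obtain x where "f ` (verts G - S) \<subseteq> {f x}" by blast
  then have "card (f ` (verts G - S)) \<le> card {f x}" by (intro card_mono) auto
  then show ?thesis using two by simp
next
  case False
  obtain r where r: "toughness G = ereal r" "tough r G"
    using toughness_maximum[OF G False] by blast
  define c where "c = num_components (delete_verts G S)"
  have le: "card (f ` (verts G - S)) \<le> c"
    unfolding c_def by (rule card_labels_le_num_components[OF G S f])
  then have "1 < c" using two by simp
  then have "r * real c \<le> real (card S)" using r(2) S by (auto simp: tough_def c_def)
  moreover have "1 * real c < r * real c" using t r(1) \<open>1 < c\<close> by (intro mult_strict_right_mono) (auto simp: one_ereal_def)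
  ultimately show ?thesis using le by linarith
qed

lemma tough_graph_of_digraph:
  fixes G :: "('a, 'b) pre_digraph"
  assumes G: "graph G" and t: "toughness G > 1"
    and d: "real (min_degree G) \<ge> 1 / 3 * (real (card (verts G)) - 2)"
  shows "tough_graph (verts G) (\<lambda>u v. u \<rightarrow>\<^bsub>G\<^esub> v) (min_degree G)"
proof -
  interpret graph G by fact
  show ?thesis
  proof unfold_locales
    show "finite (verts G)" by simp
    show "y \<rightarrow>\<^bsub>G\<^esub> x" if "x \<rightarrow>\<^bsub>G\<^esub> y" for x y using that arcs_ends_symmetric[OF sym_arcs] by blast
    show "\<not> x \<rightarrow>\<^bsub>G\<^esub> x" for x using adj_not_same by blast
    show "x \<in> verts G" if "x \<rightarrow>\<^bsub>G\<^esub> y" for x y using that by (rule adj_in_verts)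
    show "min_degree G \<le> card {w. v \<rightarrow>\<^bsub>G\<^esub> w}" if v: "v \<in> verts G" for v
    proof -
      have "min_degree G \<le> out_degree G v" unfolding min_degree_def using v by (intro Min_le) auto
      also have "out_degree G v = card (head G ` out_arcs G v)"
        unfolding out_degree_def
        by (intro card_image[symmetric] inj_onI no_multi_arcs) (auto simp: out_arcs_def arc_to_ends_def)
      also have "\<dots> \<le> card {w. v \<rightarrow>\<^bsub>G\<^esub> w}"
      proof (rule card_mono)
        show "finite {w. v \<rightarrow>\<^bsub>G\<^esub> w}"
          by (rule finite_subset[of _ "verts G"]) (auto simp: adj_in_verts)
        show "head G ` out_arcs G v \<subseteq> {w. v \<rightarrow>\<^bsub>G\<^esub> w}" by (auto simp: arcs_ends_conv)
      qed
      finally show ?thesis .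
    qed
    show "card (verts G) \<le> 3 * min_degree G + 2" using d by (simp add: field_simps)
    show "card (f ` (verts G - S)) < card S"
      if "S \<subseteq> verts G" "\<And>x y. x \<in> verts G - S \<Longrightarrow> y \<in> verts G - S \<Longrightarrow> x \<rightarrow>\<^bsub>G\<^esub> y \<Longrightarrow> f x = f y"
        "2 \<le> card (f ` (verts G - S))" for S and f :: "'a \<Rightarrow> nat"
      using card_labels_less[OF G t that] .
  qed
qed

theorem theorem1:
  fixes G :: "('a, 'b) pre_digraph"
  assumes "graph G"
    and "toughness G > 1"
    and "real (min_degree G) \<ge> 1 / 3 * (real (card (verts G)) - 2)"
  shows "\<forall>C. longest_cycle G C \<longrightarrow> dominating_cycle G C"
proof (intro allI impI)
  fix C assume C: "longest_cycle G C"
  interpret graph G by fact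
  interpret t: tough_graph "verts G" "\<lambda>u v. u \<rightarrow>\<^bsub>G\<^esub> v" "min_degree G"
    using tough_graph_of_digraph[OF assms] .
  have cyc: "t.cyc xs \<longleftrightarrow> 2 \<le> length xs \<and> is_cycle G xs" for xs
    unfolding t.cyc_iff_nth is_cycle_def by auto
  have "arcs (delete_verts G (set C)) = {}"
  proof (rule ccontr)
    assume "arcs (delete_verts G (set C)) \<noteq> {}"
    then obtain e where e: "e \<in> arcs G" "tail G e \<in> verts G - set C" "head G e \<in> verts G - set C"
      by (auto simp: delete_verts_def)
    define x where "x = tail G e"
    define y where "y = head G e"
    have xy: "x \<rightarrow>\<^bsub>G\<^esub> y" "x \<in> verts G - set C" "y \<in> verts G - set C"
      using e by (auto simp: x_def y_def arcs_ends_conv)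
    have "x \<noteq> y" using xy(1) t.irrefl by blast
    \<comment> \<open>The edge outside \<open>C\<close> is a cycle of length 2. So \<open>C\<close>
      is not a single vertex, the only case in which \<open>is_cycle\<close> and
      \<open>t.cyc\<close> differ.\<close>
    then have "t.cyc [x, y]" using xy t.sym by (auto simp: t.cyc_def)
    then have "2 \<le> length C" using C cyc[of "[x, y]"] unfolding longest_cycle_def by fastforce
    then have "t.max_cyc C" using C cyc unfolding t.max_cyc_def longest_cycle_def by blast
    then obtain C' H D where "segmented (verts G) (\<lambda>u v. u \<rightarrow>\<^bsub>G\<^esub> v) (min_degree G) C' H D"
      using t.ex_segmented[OF _ xy(2,3,1)] by blast
    then show False by (rule segmented.contradiction)
  qed
  then show "dominating_cycle G C" using C by (simp add: dominating_cycle_def longest_cycle_def)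
qed

end
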